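(* Let $n>5$ be an integer and let $N$ be the homogeneous norm on the anisotropic Heisenberg group $\mathbb{R}^{2n+1}$ associated with the fundamental solution $N^{-2n}$ of the sub-Laplacian. Let $k\ge4$ and let $d\mu=\frac{\exp(-N^{k})}{Z}\,d\lambda$, where $\lambda$ is Lebesgue measure on $\mathbb{R}^{2n+1}$ and $Z$ is the normalization constant making $\mu$ a probability measure. Then for every $q\ge2$ the $q$-Poincaré inequality holds for $\mu$: there is a constant $c\in(0,\infty)$, independent of $f$, such that $$\int\Big|f-\int f\,d\mu\Big|^{q}\,d\mu\ \le\ c\int|\nabla f|^{q}\,d\mu$$ for all functions $f$ for which the right-hand side is well defined.
   Context: The anisotropic Heisenberg group is $\mathbb{R}^{2n+1}$, with points $(x,t)=(x_1,\dots,x_{2n},t)$ and group law $$(x,t)\circ(\eta,\tau)=\Big(x+\eta,\ t+\tau+\tfrac{x_1\eta_{n+1}}{2}-\tfrac{x_{n+1}\eta_1}{2}+\sum_{j=2}^n (x_j\eta_{j+n}-\eta_j x_{j+n})\Big).$$ The sub-gradient is $\nabla=(X_1,\dots,X_{2n})$, where $X_1=\partial_{x_1}-\frac{x_{n+1}}{2}\partial_t$, $X_{n+1}=\partial_{x_{n+1}}+\frac{x_1}{2}\partial_t$, $X_j=\partial_{x_j}-x_{j+n}\partial_t$ for $j=2,\dots,n$, and $X_j=\partial_{x_j}+x_{j-n}\partial_t$ for $j=n+2,\dots,2n$; $|\nabla f|^2=\sum_j (X_jf)^2$; the sub-Laplacian is $\sum_{j=1}^{2n}X_j^2$. The norm $N$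 is given explicitly by $$N(x,t)=\frac{\left(B^{2}+t^{2}\right)^{\frac{1}{4n}}\left(AB+t^{2}+A\sqrt{B^{2}+t^{2}}\right)^{\frac{1}{2}-\frac{1}{4n}}}{\left(B+\sqrt{B^{2}+t^{2}}\right)^{\frac{1}{2}}}\quad((x,t)\ne0),\qquad N(0,0)=0,$$ with $A=\frac{x_1^2+x_{n+1}^2}{2}+\frac12\sum_{2\le j\le 2n,\,j\ne n+1}x_j^2$ and $B=\frac{x_1^2+x_{n+1}^2}{4}+\frac12\sum_{2\le j\le 2n,\,j\ne n+1}x_j^2$. The inequality is understood for real-valued $\mu$-integrable functions $f$ with (weak) sub-gradient. *)

theory Defs
  imports "HOL-Probability.Probability"
begin

text \<open>
  Points of $R^{2n+1}$ are pairs \<open>(x, t)\<close> with \<open>n = CARD('n)\<close>. The horizontal coordinates are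
  indexed by \<open>'n + 'n\<close>: \<open>x $ Inl j\<close> is $x_j$ and \<open>x $ Inr j\<close> is $x_{n+j}$. The parameter \<open>e :: 'n\<close>
  of the definitions below is the distinguished index, written 1 in the usual notation, whose
  symplectic weight is 1/2 instead of 1.
\<close>

type_synonym 'n heis = "(real ^ ('n + 'n)) \<times> real"

definition weight :: "'n \<Rightarrow> 'n \<Rightarrow> real" where
  "weight e j = (if j = e then 1/2 else 1)"

definition heis_mult :: "'n::finite \<Rightarrow> 'n heis \<Rightarrow> 'n heis \<Rightarrow> 'n heis" where
  "heis_mult e p p' =
     (fst p + fst p',
      snd p + snd p' +
        (\<Sum>j\<in>UNIV. weight e j * (fst p $ Inl j * fst p' $ Inr j - fst p' $ Inl j * fst p $ Inr j)))"

text \<open>The vector fields $X_1, \dots, X_{2n}$, given by their coefficient vectors in the coordinate frame.\<close>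

fun heis_field :: "'n::finite \<Rightarrow> 'n + 'n \<Rightarrow> 'n heis \<Rightarrow> 'n heis" where
  "heis_field e (Inl j) p = (axis (Inl j) 1, - (weight e j * fst p $ Inr j))"
| "heis_field e (Inr j) p = (axis (Inr j) 1, weight e j * fst p $ Inl j)"

lemma heis_mult_axis:
  "heis_mult e p (s *\<^sub>R axis i 1, 0) = p + s *\<^sub>R heis_field e i p"
proof (cases i)
  case (Inl j)
  have "(\<Sum>l\<in>UNIV. weight e l * (- (s * (if l = j then 1 else 0) * fst p $ Inr l)))
      = (\<Sum>l\<in>UNIV. if l = j then - (s * (weight e j * fst p $ Inr j)) else 0)"
    by (intro sum.cong) auto
  with Inl show ?thesis
    by (simp add: heis_mult_def axis_def prod_eq_iff)
next
  case (Inr j)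
  have "(\<Sum>l\<in>UNIV. weight e l * (fst p $ Inl l * (s * (if l = j then 1 else 0))))
      = (\<Sum>l\<in>UNIV. if l = j then s * (weight e j * fst p $ Inl j) else 0)"
    by (intro sum.cong) auto
  with Inr show ?thesis
    by (simp add: heis_mult_def axis_def prod_eq_iff)
qed

definition norm_A :: "'n::finite \<Rightarrow> 'n heis \<Rightarrow> real" where
  "norm_A e p = ((fst p $ Inl e)\<^sup>2 + (fst p $ Inr e)\<^sup>2) / 2
     + 1/2 * (\<Sum>i\<in>UNIV - {Inl e, Inr e}. (fst p $ i)\<^sup>2)"

definition norm_B :: "'n::finite \<Rightarrow> 'n heis \<Rightarrow> real" where
  "norm_B e p = ((fst p $ Inl e)\<^sup>2 + (fst p $ Inr e)\<^sup>2) / 4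
     + 1/2 * (\<Sum>i\<in>UNIV - {Inl e, Inr e}. (fst p $ i)\<^sup>2)"

definition heis_norm :: "'n::finite \<Rightarrow> 'n heis \<Rightarrow> real" where
  "heis_norm e p =
     (let n = real CARD('n); A = norm_A e p; B = norm_B e p; t = snd p in
      if p = 0 then 0
      else (B\<^sup>2 + t\<^sup>2) powr (1 / (4 * n))
           * (A * B + t\<^sup>2 + A * sqrt (B\<^sup>2 + t\<^sup>2)) powr (1/2 - 1 / (4 * n))
           / (B + sqrt (B\<^sup>2 + t\<^sup>2)) powr (1/2))"

definition heis_Z :: "'n::finite \<Rightarrow> real \<Rightarrow> real" where
  "heis_Z e k = (LINT p|lebesgue. exp (- (heis_norm e p powr k)))"

definition heis_mu :: "'n::finite \<Rightarrow> real \<Rightarrow> 'n heis measure" where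
  "heis_mu e k = density lebesgue (\<lambda>p. ennreal (exp (- (heis_norm e p powr k)) / heis_Z e k))"

text \<open>\<open>heis_Z\<close> is indeed the constant that makes \<open>heis_mu\<close> a probability measure.\<close>

lemma norm_AB_bounds:
  fixes e :: "'n::finite" and p :: "'n heis"
  shows "norm_B e p \<le> norm_A e p" and "(norm (fst p))\<^sup>2 \<le> 4 * norm_B e p"
proof -
  let ?S = "\<Sum>i\<in>UNIV - {Inl e, Inr e}. (fst p $ i)\<^sup>2"
  have "(norm (fst p))\<^sup>2 = (\<Sum>i\<in>UNIV. (fst p $ i)\<^sup>2)"
    by (simp add: norm_vec_def L2_set_def sum_nonneg)
  also have "\<dots> = (\<Sum>i\<in>{Inl e, Inr e}. (fst p $ i)\<^sup>2) + ?S"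
    by (subst sum.union_disjoint[symmetric]) (auto intro: sum.cong)
  finally have eq: "(norm (fst p))\<^sup>2 = (fst p $ Inl e)\<^sup>2 + (fst p $ Inr e)\<^sup>2 + ?S" by simp
  have "0 \<le> ?S" by (intro sum_nonneg) simp
  then show "norm_B e p \<le> norm_A e p" "(norm (fst p))\<^sup>2 \<le> 4 * norm_B e p"
    unfolding eq norm_A_def norm_B_def
    by (auto simp: add_divide_distrib intro: add_mono divide_left_mono)
qed

lemma heis_norm_lower:
  fixes e :: "'n::finite" and p :: "'n heis"
  assumes "p \<noteq> 0"
  shows "sqrt (sqrt ((norm_B e p)\<^sup>2 + (snd p)\<^sup>2)) / 2 \<le> heis_norm e p"
proof -
  define A B R a where "A = norm_A e p" and "B = norm_B e p"
    and "R = sqrt ((norm_B e p)\<^sup>2 + (snd p)\<^sup>2)" and "a = 1 / (4 * real CARD('n))"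
  have AB: "B \<le> A" and nB: "(norm (fst p))\<^sup>2 \<le> 4 * B"
    using norm_AB_bounds(1)[of e p] norm_AB_bounds(2)[of p e] unfolding A_def B_def by blast+
  have B0: "0 \<le> B" using nB zero_le_power2[of "norm (fst p)"] by linarith
  have R2: "R\<^sup>2 = B\<^sup>2 + (snd p)\<^sup>2" by (simp add: R_def B_def)
  have R0: "R > 0"
  proof (rule ccontr)
    assume "\<not> R > 0"
    then have "B\<^sup>2 + (snd p)\<^sup>2 \<le> 0" by (simp add: R_def B_def)
    then have "B = 0" "snd p = 0" by (auto simp: sum_power2_le_zero_iff)
    with nB have "p = 0" by (simp add: prod_eq_iff)
    with assms show False by simp
  qed
  have BR: "B \<le> R" unfolding R_def B_def by (rule real_le_rsqrt) simp
  have a: "0 \<le> a" "a \<le> 1/4"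
  proof -
    have "1 \<le> real CARD('n)" by (simp add: Suc_le_eq)
    then show "0 \<le> a" "a \<le> 1/4" by (auto simp: a_def field_simps)
  qed
  have "R * (R + B) \<le> A * B + (snd p)\<^sup>2 + A * R"
    using mult_right_mono[OF AB less_imp_le[OF R0]] mult_right_mono[OF AB B0] R2
    by (simp add: power2_eq_square algebra_simps)
  then have 1: "(R * (R + B)) powr (1/2 - a) \<le> (A * B + (snd p)\<^sup>2 + A * R) powr (1/2 - a)"
    using R0 B0 a by (intro powr_mono2) auto
  have e1: "(R\<^sup>2) powr a = R powr (2 * a)"
    using R0 by (simp add: powr_powr flip: powr_numeral)
  have "R powr (1/2) / 2 \<le> R powr (1/2) * 2 powr (-a)"
    using mult_left_mono[OF powr_mono[of "-1" "-a" "2::real"], of "R powr (1/2)"] a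
    by (simp add: powr_minus_divide)
  also have "\<dots> = R powr (1/2 + a) * (2 * R) powr (-a)"
    using R0 by (simp only: powr_mult powr_add powr_minus) simp
  also have "\<dots> \<le> R powr (1/2 + a) * (R + B) powr (-a)"
    using R0 B0 BR a by (intro mult_left_mono powr_mono2') auto
  also have "\<dots> = R powr (2*a) * (R * (R + B)) powr (1/2 - a) / (R + B) powr (1/2)"
  proof -
    have "R powr (1/2 + a) = R powr (2*a) * R powr (1/2 - a)"
      by (simp add: add.commute flip: powr_add)
    moreover have "(R + B) powr (-a) = (R+B) powr (1/2 - a) / (R + B) powr (1/2)"
      by (simp flip: powr_diff)
    moreover have "(R * (R+B)) powr (1/2 - a) = R powr (1/2 - a) * (R+B) powr (1/2 - a)"
      using R0 B0 by (simp add: powr_mult)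
    ultimately show ?thesis by simp
  qed
  also have "\<dots> \<le> (R\<^sup>2) powr a * (A * B + (snd p)\<^sup>2 + A * R) powr (1/2 - a) / (B + R) powr (1/2)"
    unfolding e1 by (subst add.commute[of B R]) (intro divide_right_mono mult_left_mono 1; simp)
  also have "\<dots> = heis_norm e p"
    using assms unfolding heis_norm_def Let_def
    by (simp add: R2 a_def A_def B_def flip: R_def)
  finally show ?thesis using R0 by (simp add: powr_half_sqrt R_def)
qed

lemma exp_heis_norm_le:
  fixes e :: "'n::finite" and p :: "'n heis"
  assumes "k \<ge> 4"
  shows "exp (- (heis_norm e p powr k)) \<le> exp 2 * exp (- (norm p)\<^sup>2 / 64)"
proof (cases "p = 0")
  case True
  then show ?thesis by (simp add: heis_norm_def)
next
  case False
  define R B N where "R = sqrt ((norm_B e p)\<^sup>2 + (snd p)\<^sup>2)" and "B = norm_B e p"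
    and "N = heis_norm e p"
  have N: "sqrt R / 2 \<le> N"
    using heis_norm_lower[OF False, of e] by (simp add: R_def N_def)
  have R0: "0 \<le> R" by (simp add: R_def)
  have "(sqrt R / 2) ^ 4 \<le> N ^ 4" using N R0 by (intro power_mono) auto
  moreover have "(sqrt R) ^ 4 = ((sqrt R)\<^sup>2)\<^sup>2" by (simp flip: power_mult)
  ultimately have "R\<^sup>2 / 16 \<le> N ^ 4" using R0 by (simp add: power_divide)
  moreover have "N ^ 4 - 1 \<le> N powr k"
  proof (cases "N \<ge> 1")
    case True
    then have "N ^ 4 = N powr 4" by simp
    also have "\<dots> \<le> N powr k" using True assms by (intro powr_mono) auto
    finally show ?thesis by simp
  next
    case False
    moreover have "0 \<le> N" using N R0 real_sqrt_ge_zero[of R] by linarith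
    ultimately have "N ^ 4 \<le> 1" by (intro power_le_one) auto
    then show ?thesis using powr_ge_zero[of N k] by linarith
  qed
  moreover have "R\<^sup>2 = B\<^sup>2 + (snd p)\<^sup>2" by (simp add: R_def B_def)
  moreover have "B - 1/4 \<le> B\<^sup>2"
    using zero_le_power2[of "B - 1/2"] by (simp add: power2_eq_square algebra_simps)
  moreover have "(norm (fst p))\<^sup>2 \<le> 4 * B" unfolding B_def by (rule norm_AB_bounds(2))
  moreover have "(norm p)\<^sup>2 = (norm (fst p))\<^sup>2 + (snd p)\<^sup>2"
    by (simp add: norm_prod_def)
  moreover have "0 \<le> (snd p)\<^sup>2" by simp
  ultimately have "(norm p)\<^sup>2 / 64 \<le> 2 + N powr k" by linarith
  then show ?thesis by (simp add: N_def flip: exp_add)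
qed

lemma heis_norm_measurable [measurable]: "heis_norm (e :: 'a::finite) \<in> borel_measurable borel"
proof -
  have [measurable]: "(\<lambda>p :: 'a heis. fst p $ i) \<in> borel_measurable borel" for i
    by (intro borel_measurable_continuous_onI continuous_intros)
  have [measurable]: "(snd :: 'a heis \<Rightarrow> real) \<in> borel_measurable borel"
    by (intro borel_measurable_continuous_onI continuous_intros)
  have [measurable]: "{p \<in> space borel. p = (0 :: 'a heis)} \<in> sets borel" by simp
  show ?thesis unfolding heis_norm_def norm_A_def norm_B_def Let_def by measurable
qed

lemma gaussian_integrable:
  "integrable lborel (\<lambda>p::'a::euclidean_space. exp (- (norm p)\<^sup>2 / 64))"
proof (rule integrableI_nonneg)
  have 1: "integrable lborel (\<lambda>x::real. exp (- x\<^sup>2 / 64))"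
  proof -
    have "integrable lborel (\<lambda>x. sqrt (2 * pi * (sqrt 32)\<^sup>2) * normal_density 0 (sqrt 32) x)"
      by (intro integrable_mult_right integrable_normal_density) simp
    then show ?thesis by (simp add: normal_density_def)
  qed
  have "(norm p)\<^sup>2 = (\<Sum>b\<in>Basis. (p \<bullet> b)\<^sup>2)" for p :: 'a
    by (subst power2_norm_eq_inner, subst euclidean_inner, simp add: power2_eq_square)
  then have "(\<integral>\<^sup>+p. ennreal (exp (- (norm p)\<^sup>2 / 64)) \<partial>(lborel :: 'a measure))
      = (\<integral>\<^sup>+p. ennreal (\<Prod>b\<in>Basis. exp (- (p \<bullet> b)\<^sup>2 / 64)) \<partial>(lborel :: 'a measure))"
    by (simp add: exp_sum[symmetric] sum_negf sum_divide_distrib)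
  also have "\<dots> = (\<Prod>b\<in>(Basis :: 'a set). \<integral>\<^sup>+x. ennreal (exp (- x\<^sup>2 / 64)) \<partial>lborel)"
    by (subst nn_integral_lborel_prod[symmetric]) (auto simp: prod_ennreal)
  also have "\<dots> < \<infinity>"
    using nn_integral_eq_integral[OF 1] by (simp add: ennreal_power)
  finally show "(\<integral>\<^sup>+p. ennreal (exp (- (norm p)\<^sup>2 / 64)) \<partial>(lborel :: 'a measure)) < \<infinity>" .
qed auto

lemma prob_space_heis_mu:
  assumes "k \<ge> 4"
  shows "prob_space (heis_mu (e :: 'n::finite) k)"
proof -
  let ?h = "\<lambda>p :: 'n heis. exp (- (heis_norm e p powr k))"
  have "integrable lborel ?h"
    using exp_heis_norm_le[OF assms, of e]
    by (intro Bochner_Integration.integrable_bound[OF integrable_mult_right[OF gaussian_integrable, of "exp 2"]])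
       (auto intro!: AE_I2)
  then have int: "integrable lebesgue ?h"
    by (subst integrable_completion) auto
  have "heis_Z e k \<noteq> 0"
  proof
    assume "heis_Z e k = 0"
    then have "AE p in lebesgue. ?h p = 0"
      using int by (simp add: heis_Z_def integral_nonneg_eq_0_iff_AE)
    then have "AE p :: 'n heis in lebesgue. False" by simp
    then show False by (simp add: AE_iff_null null_sets_completion_iff null_sets_def)
  qed
  moreover have "0 \<le> heis_Z e k" unfolding heis_Z_def by (intro integral_nonneg_AE) simp
  ultimately have Z: "heis_Z e k > 0" by simp
  have hm: "?h \<in> borel_measurable lebesgue" using int by blast
  show ?thesis
  proof (rule prob_spaceI)
    have "emeasure (heis_mu e k) (space (heis_mu e k)) = (\<integral>\<^sup>+p. ennreal (?h p / heis_Z e k) \<partial>lebesgue)"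
      using hm unfolding heis_mu_def by (simp add: emeasure_density)
    also have "\<dots> = ennreal (LINT p|lebesgue. ?h p / heis_Z e k)"
      using int Z by (intro nn_integral_eq_integral) auto
    also have "\<dots> = 1" using Z by (simp add: heis_Z_def)
    finally show "emeasure (heis_mu e k) (space (heis_mu e k)) = 1" .
  qed
qed

primrec C_k :: "nat \<Rightarrow> ('a::euclidean_space \<Rightarrow> real) \<Rightarrow> bool" where
  "C_k 0 \<phi> \<longleftrightarrow> continuous_on UNIV \<phi>"
| "C_k (Suc m) \<phi> \<longleftrightarrow>
     (\<forall>x. \<phi> differentiable at x) \<and> (\<forall>v. C_k m (\<lambda>x. frechet_derivative \<phi> (at x) v))"

definition test_function :: "('a::euclidean_space \<Rightarrow> real) \<Rightarrow> bool" where
  "test_function \<phi> \<longleftrightarrow> (\<forall>m. C_k m \<phi>) \<and> compact (closure {x. \<phi> x \<noteq> 0})"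

text \<open>
  \<open>g $ i\<close> is the distributional derivative of \<open>f\<close> along \<open>X_i\<close>. The fields are divergence free, so
  the formal adjoint of \<open>X_i\<close> is \<open>- X_i\<close>.
\<close>

definition weak_subgradient ::
    "'n::finite \<Rightarrow> ('n heis \<Rightarrow> real) \<Rightarrow> ('n heis \<Rightarrow> real ^ ('n + 'n)) \<Rightarrow> bool" where
  "weak_subgradient e f g \<longleftrightarrow>
     (\<forall>K. compact K \<longrightarrow> f absolutely_integrable_on K) \<and>
     (\<forall>K. compact K \<longrightarrow> g absolutely_integrable_on K) \<and>
     (\<forall>i \<phi>. test_function \<phi> \<longrightarrow>
        (LINT p|lebesgue. f p * frechet_derivative \<phi> (at p) (heis_field e i p))
        = - (LINT p|lebesgue. g p $ i * \<phi> p))"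

end

theory Submission
  imports Defs
begin

text \<open>
  Throughout, $B$ is \<open>norm_B\<close>, $A$ is \<open>norm_A\<close> (which equals $|x|^2/2$), $D = A - B$,
  $R = \sqrt{B^2 + t^2}$ and $V = N^k$.

  \<^bold>\<open>Increments instead of derivatives.\<close> The flow of a horizontal field $X_i$ is the right translation
  \<open>move e i s\<close>. It is a shear, so it preserves Lebesgue measure, and it integrates the
  weak sub-gradient: the increment of \<open>f\<close> along the flow is the line integral of \<open>g $ i\<close>, almost
  everywhere (\<open>weak_subgradient_along_lines\<close>). The rest of the proof sees \<open>f\<close> only through the $L^q$
  form of this fact, the predicate \<open>line_bound\<close>. Since it bounds increments only, it survives
  subtraction of constants and truncation, and neither mollification nor a chain rule for weak
  derivatives is needed.

  \<^bold>\<open>Local inequality.\<close> Every bounded group element is a product of boundedly many bounded moves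
  along the axes, vertical ones being commutators. Telescoping along such a product and averaging
  over pairs of points of a ball yields \<open>local_poincare\<close>: near the origin \<open>f\<close> is $L^q$-close to a
  constant $m$, with an error controlled by the sub-gradient on a larger ball.

  \<^bold>\<open>Tail.\<close> Away from a compact set one uses the horizontal field $Y = \sum_i y_i X_i$ with
  $y = (B - 1) x + t J x$, where $J$ is the quarter turn $(x_j, x_{n+j}) \mapsto (-x_{n+j}, x_j)$. The
  field $\sum_i x_i X_i$ is the radial field $\sum_i x_i \partial_{x_i}$, and $\sum_i (Jx)_i X_i$ is a
  rotation plus $2 B \partial_t$. Hence $\mathrm{div}\, Y = (2n + 4) B - 2n$, and in
  $$\log N = \frac{\log R}{2n} - \frac{\log (R + B)}{4n} + \Big(\frac12 - \frac1{4n}\Big) \log (D + R)$$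
  one computes $Y \log N = B - 1 + 2\tau$, where $\tau$ is \<open>vertical_share\<close>. Homogeneity of $N$ gives
  $1 - 2\tau \le 3B/R$, so $Y \log N \ge B/2$ once $R \ge 6$. Consequently
  $Y V - \mathrm{div}\, Y \ge 1 + B V$ outside a compact set (\<open>confining_drift\<close>); on the $t$-axis, where
  $Y$ vanishes, the whole contribution comes from the inward radial part, whose divergence is $-2n$.
  Moreover $|Y|^2$ is at most a constant times $1 + B V$ (\<open>drift_bound\<close>). This is where $k \ge 4$ enters,
  as $V$ must dominate $R^2$. Integrating by parts,
  $$\int |u|^q (Y V - \mathrm{div}\, Y)\, e^{-V} = \int Y(|u|^q)\, e^{-V} \le q \int |u|^{q-1} |Y| |\nabla u|\, e^{-V},$$
  and Young's inequality absorbs the factor $|u|^{q-1}$ into the left-hand side. The remaining power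
  of $1 + B V$ is harmless exactly because $q/2 \le q - 1$, that is, $q \ge 2$ (\<open>weighted_young\<close>). As \<open>u\<close> is
  not differentiable, the integration by parts is carried out with difference quotients, and
  $e^{-V}$ is first replaced by compactly supported functions of $V$ (\<open>cutoff\<close>).

  \<^bold>\<open>Conclusion.\<close> The tail estimate for truncations of $f - m$ leaves an integral over a ball, which the
  local inequality controls. Removing the truncation gives \<open>weighted_poincare\<close>, and Jensen's inequality
  replaces $m$ by the mean of \<open>f\<close>.
\<close>

section \<open>Test functions and the fundamental lemma\<close>

lemma cball_measurable [measurable]: "cball a \<rho> \<in> sets borel"
  by (simp add: borel_closed)

lemma C_k_const: "C_k m (\<lambda>x::'a::euclidean_space. c)"
  by (induction m arbitrary: c) auto

lemma C_k_add: "C_k m f \<Longrightarrow> C_k m g \<Longrightarrow> C_k m (\<lambda>x. f x + g x)"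
proof (induction m arbitrary: f g)
  case 0 then show ?case by (auto intro: continuous_intros)
next
  case (Suc m)
  have "frechet_derivative (\<lambda>x. f x + g x) (at x) v
      = frechet_derivative f (at x) v + frechet_derivative g (at x) v" for x v
  proof -
    have "((\<lambda>x. f x + g x) has_derivative
        (\<lambda>v. frechet_derivative f (at x) v + frechet_derivative g (at x) v)) (at x)"
      using Suc.prems by (intro has_derivative_add) (auto simp flip: frechet_derivative_works)
    from frechet_derivative_at[OF this] show ?thesis by (metis)
  qed
  with Suc show ?case by (auto intro: differentiable_add)
qed

lemma C_k_Suc_imp: "C_k (Suc m) f \<Longrightarrow> C_k m f"
proof (induction m arbitrary: f)
  case 0
  then show ?case
    by (auto intro!: differentiable_imp_continuous_on simp: differentiable_on_def
        intro: differentiable_at_withinI)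
qed (simp only: C_k.simps, blast)

lemma C_k_mult: "C_k m f \<Longrightarrow> C_k m g \<Longrightarrow> C_k m (\<lambda>x. f x * g x)"
proof (induction m arbitrary: f g)
  case 0 then show ?case by (auto intro: continuous_intros)
next
  case (Suc m)
  have "frechet_derivative (\<lambda>x. f x * g x) (at x) v
      = f x * frechet_derivative g (at x) v + frechet_derivative f (at x) v * g x" for x v
  proof -
    have "((\<lambda>x. f x * g x) has_derivative
        (\<lambda>v. f x * frechet_derivative g (at x) v + frechet_derivative f (at x) v * g x)) (at x)"
      using Suc.prems by (intro has_derivative_mult) (auto simp flip: frechet_derivative_works)
    from frechet_derivative_at[OF this] show ?thesis by metis
  qed
  moreover have "C_k m f" "C_k m g" using Suc.prems C_k_Suc_imp by blast+
  ultimately show ?case using Suc by (auto intro!: C_k_add differentiable_mult)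
qed

lemma C_k_prod:
  "finite I \<Longrightarrow> (\<And>i. i \<in> I \<Longrightarrow> C_k m (f i)) \<Longrightarrow> C_k m (\<lambda>x. \<Prod>i\<in>I. f i x)"
  by (induction I rule: finite_induct) (auto intro: C_k_const C_k_mult)

lemma C_k_affine:
  assumes "bounded_linear L" "C_k m f"
  shows "C_k m (\<lambda>x. f (c + L x))"
  using assms(2)
proof (induction m arbitrary: f)
  case 0
  have "continuous_on UNIV (\<lambda>x. c + L x)"
    using assms(1) by (intro continuous_intros linear_continuous_on)
  with 0 show ?case by (auto intro: continuous_on_compose2)
next
  case (Suc m)
  have d: "((\<lambda>x. f (c + L x)) has_derivative
      (\<lambda>v. frechet_derivative f (at (c + L x)) (L v))) (at x)" for x
  proof -
    have "((\<lambda>x. c + L x) has_derivative L) (at x)"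
      using has_derivative_add[OF has_derivative_const bounded_linear_imp_has_derivative[OF assms(1)]]
      by simp
    moreover have "(f has_derivative frechet_derivative f (at (c + L x))) (at (c + L x))"
      using Suc.prems by (auto simp flip: frechet_derivative_works)
    ultimately show ?thesis using has_derivative_compose by blast
  qed
  have "frechet_derivative (\<lambda>x. f (c + L x)) (at x) v
      = (\<lambda>y. frechet_derivative f (at y) (L v)) (c + L x)" for x v
    using frechet_derivative_at[OF d] by metis
  moreover have "C_k m (\<lambda>x. (\<lambda>y. frechet_derivative f (at y) (L v)) (c + L x))" for v
    using Suc.prems by (intro Suc.IH) auto
  moreover have "\<forall>x. (\<lambda>x. f (c + L x)) differentiable at x"
    using d unfolding differentiable_def by blast
  ultimately show ?case by simp
qed

text \<open>
  The whole sequence of derivatives of the outer function is a parameter, so that the induction on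
  the order of smoothness can move along it.
\<close>

lemma C_k_compose_real:
  fixes \<rho> :: "nat \<Rightarrow> real \<Rightarrow> real"
  assumes \<rho>: "\<And>j x. (\<rho> j has_real_derivative \<rho> (Suc j) x) (at x)" and "C_k m f"
  shows "C_k m (\<lambda>x. \<rho> j (f x))"
  using assms(2)
proof (induction m arbitrary: j)
  case 0
  have "continuous_on UNIV (\<rho> j)" using \<rho> DERIV_continuous_on by blast
  with 0 show ?case by (auto intro: continuous_on_compose2)
next
  case (Suc m)
  have d: "((\<lambda>x. \<rho> j (f x)) has_derivative
      (\<lambda>v. \<rho> (Suc j) (f x) * frechet_derivative f (at x) v)) (at x)" for x
  proof -
    have "(f has_derivative frechet_derivative f (at x)) (at x)"
      using Suc.prems by (auto simp flip: frechet_derivative_works)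
    from has_derivative_compose[OF this] \<rho>[of j "f x"] show ?thesis
      by (auto simp: has_field_derivative_def)
  qed
  have "frechet_derivative (\<lambda>x. \<rho> j (f x)) (at x) v
      = \<rho> (Suc j) (f x) * frechet_derivative f (at x) v" for x v
    using frechet_derivative_at[OF d] by metis
  moreover have "C_k m f" using Suc.prems C_k_Suc_imp by blast
  then have "C_k m (\<lambda>x. \<rho> (Suc j) (f x))" by (rule Suc.IH)
  ultimately show ?case unfolding C_k.simps differentiable_def using d Suc.prems by (auto intro!: C_k_mult)
qed

lemma C_k_inner: "C_k m (\<lambda>x. x \<bullet> b)"
proof (cases m)
  case 0 then show ?thesis by (auto intro: continuous_intros)
next
  case (Suc j)
  have d: "((\<lambda>x. x \<bullet> b) has_derivative (\<lambda>v. v \<bullet> b)) (at x)" for x :: 'a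
    by (auto intro!: derivative_eq_intros)
  then have "frechet_derivative (\<lambda>x. x \<bullet> b) (at x) v = v \<bullet> b" for x v :: 'a
    using frechet_derivative_at by metis
  with d show ?thesis unfolding Suc by (auto simp: differentiable_def intro: C_k_const)
qed

text \<open>
  Functions $P(1/x) e^{-1/x}$, extended by 0 to $x \le 0$. Polynomial factors are admitted because this
  makes the family closed under differentiation; \<open>flat_next\<close> is the action on $P$.
\<close>

definition flat_exp :: "real poly \<Rightarrow> real \<Rightarrow> real" where
  "flat_exp P x = (if x > 0 then poly P (1/x) * exp (- (1/x)) else 0)"

definition flat_next :: "real poly \<Rightarrow> real poly" where
  "flat_next P = [:0, 0, 1:] * (P - pderiv P)"

lemma poly_times_exp_minus_tendsto_0: "((\<lambda>y::real. poly P y * exp (- y)) \<longlongrightarrow> 0) at_top"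
proof -
  have "((\<lambda>y::real. \<Sum>i\<le>degree P. coeff P i * (y ^ i / exp y)) \<longlongrightarrow> (\<Sum>i\<le>degree P. coeff P i * 0)) at_top"
    by (intro tendsto_intros tendsto_power_div_exp_0)
  then show ?thesis
    by (simp add: poly_altdef sum_distrib_right sum_divide_distrib exp_minus field_simps)
qed

lemma flat_exp_has_derivative: "(flat_exp P has_real_derivative flat_exp (flat_next P) x) (at x)"
proof -
  consider "x > 0" | "x < 0" | "x = 0" by linarith
  then show ?thesis
  proof cases
    case 1
    have "((\<lambda>x. poly P (1/x) * exp (- (1/x))) has_real_derivative flat_exp (flat_next P) x) (at x)"
      using 1 by (auto intro!: derivative_eq_intros poly_DERIV[THEN DERIV_chain2]
          simp: flat_exp_def flat_next_def field_simps power2_eq_square)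
    then show ?thesis
      by (rule has_field_derivative_transform_within_open[where S="{0<..}"]) (use 1 in \<open>auto simp: flat_exp_def\<close>)
  next
    case 2
    have "((\<lambda>x. 0) has_real_derivative flat_exp (flat_next P) x) (at x)"
      using 2 by (auto simp: flat_exp_def)
    then show ?thesis
      by (rule has_field_derivative_transform_within_open[where S="{..<0}"]) (use 2 in \<open>auto simp: flat_exp_def\<close>)
  next
    case 3
    have "((\<lambda>y::real. poly ([:0,1:] * P) y * exp (- y)) \<longlongrightarrow> 0) at_top"
      by (rule poly_times_exp_minus_tendsto_0)
    then have "((\<lambda>h::real. poly ([:0,1:] * P) (inverse h) * exp (- inverse h)) \<longlongrightarrow> 0) (at_right 0)"
      by (rule filterlim_compose[OF _ filterlim_inverse_at_top_right])
    then have "((\<lambda>h. flat_exp P h / h) \<longlongrightarrow> 0) (at_right 0)"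
      by (rule Lim_transform_eventually)
         (auto simp: flat_exp_def field_simps eventually_at_right_less intro!: eventually_mono[OF eventually_at_right_less[of 0]])
    moreover have "((\<lambda>h. flat_exp P h / h) \<longlongrightarrow> 0) (at_left 0)"
      by (rule Lim_transform_eventually[OF tendsto_const])
         (auto simp: flat_exp_def eventually_at_filter)
    ultimately have "((\<lambda>h. flat_exp P h / h) \<longlongrightarrow> 0) (at 0)"
      by (auto simp: filterlim_split_at)
    then show ?thesis using 3 by (auto simp: DERIV_def flat_exp_def)
  qed
qed

definition smooth_step :: "real \<Rightarrow> real" where "smooth_step = flat_exp 1"

lemma smooth_step_le_0: "x \<le> 0 \<Longrightarrow> smooth_step x = 0"
  and smooth_step_nonneg: "0 \<le> smooth_step x" and smooth_step_le_1: "smooth_step x \<le> 1"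
  by (auto simp: smooth_step_def flat_exp_def)

lemma smooth_step_tendsto: "x > 0 \<Longrightarrow> (\<lambda>j. smooth_step (real j * x)) \<longlonglongrightarrow> 1"
proof -
  assume x: "x > 0"
  have "(\<lambda>j. exp (- (1 / (real j * x)))) \<longlonglongrightarrow> exp (- 0)"
    using x by (intro tendsto_intros tendsto_divide_0[OF tendsto_const] filterlim_at_top_imp_at_infinity)
      (rule filterlim_at_top_mult_tendsto_pos[OF tendsto_const _ filterlim_real_sequentially], auto)
  then have "(\<lambda>j. exp (- (1 / (real j * x)))) \<longlonglongrightarrow> 1" by simp
  then show ?thesis
    by (rule Lim_transform_eventually)
       (use x in \<open>auto simp: smooth_step_def flat_exp_def intro!: eventually_mono[OF eventually_gt_at_top[of 0]]\<close>)
qed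

lemma C_k_smooth_step: "C_k m f \<Longrightarrow> C_k m (\<lambda>x. smooth_step (f x))"
  using C_k_compose_real[of "\<lambda>j. flat_exp ((flat_next ^^ j) 1)" m f 0] flat_exp_has_derivative
  by (simp add: smooth_step_def)

definition box_bump :: "'a::euclidean_space \<Rightarrow> 'a \<Rightarrow> nat \<Rightarrow> 'a \<Rightarrow> real" where
  "box_bump a c j x = (\<Prod>b\<in>Basis. smooth_step (j * (x \<bullet> b - a \<bullet> b)) * smooth_step (j * (c \<bullet> b - x \<bullet> b)))"

lemma box_bump_eq_0: "x \<notin> box a c \<Longrightarrow> box_bump a c j x = 0"
  unfolding box_bump_def mem_box
  by (intro prod_zero) (auto simp: not_less intro!: smooth_step_le_0 mult_nonneg_nonpos)

lemma abs_box_bump_le: "\<bar>box_bump a c j x\<bar> \<le> indicator (box a c) x"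
proof (cases "x \<in> box a c")
  case True
  have "\<bar>box_bump a c j x\<bar> \<le> (\<Prod>b\<in>(Basis::'a set). 1)"
    unfolding box_bump_def abs_prod
    by (intro prod_mono) (auto simp: abs_mult smooth_step_nonneg smooth_step_le_1 intro!: mult_le_one)
  with True show ?thesis by simp
qed (simp add: box_bump_eq_0)

lemma box_bump_tendsto: "(\<lambda>j. box_bump a c j x) \<longlonglongrightarrow> indicator (box a c) x"
proof (cases "x \<in> box a c")
  case True
  have "(\<lambda>j. box_bump a c j x) \<longlonglongrightarrow> (\<Prod>b\<in>(Basis::'a set). 1 * 1)"
    unfolding box_bump_def using True by (intro tendsto_intros smooth_step_tendsto) (auto simp: mem_box)
  with True show ?thesis by simp
qed (simp add: box_bump_eq_0)

lemma test_function_box_bump: "test_function (box_bump a c j)"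
  unfolding test_function_def
proof
  have inner: "C_k m (\<lambda>x. j * (x \<bullet> b - d))" "C_k m (\<lambda>x. j * (d - x \<bullet> b))" for m d and b :: 'a
    using C_k_mult[OF C_k_const[of m j] C_k_add[OF C_k_inner[of m b] C_k_const[of m "-d"]]]
      C_k_mult[OF C_k_const[of m "-j"] C_k_add[OF C_k_inner[of m b] C_k_const[of m "-d"]]]
    by (simp_all add: algebra_simps)
  show "\<forall>m. C_k m (box_bump a c j)"
    unfolding box_bump_def by (intro allI C_k_prod C_k_mult C_k_smooth_step inner) auto
  have "{x. box_bump a c j x \<noteq> 0} \<subseteq> cbox a c"
    using box_bump_eq_0 box_subset_cbox by blast
  then show "compact (closure {x. box_bump a c j x \<noteq> 0})"
    by (meson bounded_cbox bounded_subset compact_closure)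
qed

lemma test_function_affine:
  assumes "bounded_linear L" "test_function \<phi>" "inj L"
  shows "test_function (\<lambda>x. \<phi> (c + L x))"
  unfolding test_function_def
proof
  show "\<forall>m. C_k m (\<lambda>x. \<phi> (c + L x))"
    using assms C_k_affine unfolding test_function_def by blast
  interpret L: bounded_linear L by fact
  have "linear L" using assms(1) by (simp add: bounded_linear.linear)
  then obtain B where B: "B > 0" "\<And>x. B * norm x \<le> norm (L x)"
    using linear_inj_bounded_below_pos[OF _ assms(3)] by metis
  have "bounded {x. \<phi> x \<noteq> 0}"
    using assms(2) bounded_subset[OF compact_imp_bounded closure_subset] unfolding test_function_def by blast
  then obtain M where M: "\<And>x. \<phi> x \<noteq> 0 \<Longrightarrow> norm x \<le> M" unfolding bounded_iff by auto
  have "norm x \<le> (M + norm c) / B" if "\<phi> (c + L x) \<noteq> 0" for x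
  proof -
    have "B * norm x \<le> norm (L x)" by (rule B)
    also have "\<dots> \<le> norm (c + L x) + norm c" by norm
    also have "\<dots> \<le> M + norm c" using M[OF that] by simp
    finally show ?thesis using B(1) by (simp add: field_simps)
  qed
  then have "bounded {x. \<phi> (c + L x) \<noteq> 0}" unfolding bounded_iff by blast
  then show "compact (closure {x. \<phi> (c + L x) \<noteq> 0})" by simp
qed

text \<open>
  Open boxes form a generator of the Borel sets that is stable under intersection, hence they
  determine the measures with densities $h^+$ and $h^-$.
\<close>

lemma AE_eq_0_if_box_integrals_0:
  fixes h :: "'a::euclidean_space \<Rightarrow> real"
  assumes h[measurable]: "h \<in> borel_measurable borel"
    and int: "\<And>a c. set_integrable lborel (box a c) h"
    and 0: "\<And>a c. (LINT x:box a c|lborel. h x) = 0"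
  shows "AE x in lborel. h x = 0"
proof -
  let ?P = "density lborel (\<lambda>x. ennreal (h x))" and ?N = "density lborel (\<lambda>x. ennreal (- h x))"
  have box: "emeasure ?P (box a c) = emeasure ?N (box a c) \<and> emeasure ?P (box a c) \<noteq> \<infinity>" for a c
  proof -
    let ?h = "\<lambda>x. indicator (box a c) x * h x"
    have ih: "integrable lborel ?h"
      using int[of a c] by (simp add: set_integrable_def)
    have P: "emeasure ?P (box a c) = (\<integral>\<^sup>+x. ennreal (?h x) \<partial>lborel)"
      by (subst emeasure_density) (auto intro!: nn_integral_cong simp: indicator_def)
    have N: "emeasure ?N (box a c) = (\<integral>\<^sup>+x. ennreal (- ?h x) \<partial>lborel)"
      by (subst emeasure_density) (auto intro!: nn_integral_cong simp: indicator_def)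
    have fin: "(\<integral>\<^sup>+x. ennreal (?h x) \<partial>lborel) < \<infinity>" "(\<integral>\<^sup>+x. ennreal (- ?h x) \<partial>lborel) < \<infinity>"
      using ih[unfolded real_integrable_def] by (auto simp: less_top)
    have "enn2real (\<integral>\<^sup>+x. ennreal (?h x) \<partial>lborel) = enn2real (\<integral>\<^sup>+x. ennreal (- ?h x) \<partial>lborel)"
      using 0[of a c] real_lebesgue_integral_def[OF ih] by (simp add: set_lebesgue_integral_def)
    then have "(\<integral>\<^sup>+x. ennreal (?h x) \<partial>lborel) = (\<integral>\<^sup>+x. ennreal (- ?h x) \<partial>lborel)"
      using fin ennreal_enn2real by (metis infinity_ennreal_def)
    then show ?thesis unfolding P N using fin by auto
  qed
  have "?P = ?N"
  proof (rule measure_eqI_generator_eq[where A="\<lambda>i::nat. box (- (real i *\<^sub>R One)) (real i *\<^sub>R One)"])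
    let ?E = "range (\<lambda>(a, b). box a b::'a set)"
    show "Int_stable ?E" by (auto simp: Int_stable_def box_Int_box)
    show "sets ?P = sigma_sets UNIV ?E" "sets ?N = sigma_sets UNIV ?E"
      by (simp_all add: borel_eq_box)
    show "(\<Union>i::nat. box (- (real i *\<^sub>R One)) (real i *\<^sub>R One)) = (UNIV :: 'a set)"
      by (rule UN_box_eq_UNIV)
    show "emeasure ?P (box (- (real i *\<^sub>R One)) (real i *\<^sub>R One)) \<noteq> \<infinity>" for i :: nat
      using box by blast
  qed (use box in auto)
  then have "AE x in lborel. ennreal (h x) = ennreal (- h x)"
    by (intro sigma_finite_measure.density_unique[OF sigma_finite_lborel]) auto
  then show ?thesis
  proof eventually_elim
    case (elim x)
    then show ?case by (cases "h x \<ge> 0") (auto simp: ennreal_neg)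
  qed
qed

text \<open>
  Products of one-dimensional smooth steps converge boundedly to the indicator of an open box, so all
  integrals of \<open>h\<close> over boxes vanish.
\<close>

lemma fundamental_lemma_of_variations:
  fixes h :: "'a::euclidean_space \<Rightarrow> real"
  assumes h[measurable]: "h \<in> borel_measurable borel"
    and int: "\<And>a c. set_integrable lborel (cbox a c) h"
    and 0: "\<And>\<phi>. test_function \<phi> \<Longrightarrow> (LINT x|lborel. h x * \<phi> x) = 0"
  shows "AE x in lborel. h x = 0"
proof (rule AE_eq_0_if_box_integrals_0[OF h])
  fix a c :: 'a
  show si: "set_integrable lborel (box a c) h"
    using int[of a c] by (rule set_integrable_subset) (auto simp: box_subset_cbox)
  have [measurable]: "box_bump a c j \<in> borel_measurable borel" for j
    using test_function_box_bump[of a c j] unfolding test_function_def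
    by (metis C_k.simps(1) borel_measurable_continuous_onI)
  have "(\<lambda>j. LINT x|lborel. h x * box_bump a c j x) \<longlonglongrightarrow> (LINT x|lborel. h x * indicator (box a c) x)"
  proof (rule integral_dominated_convergence)
    show "integrable lborel (\<lambda>x. \<bar>indicator (box a c) x * h x\<bar>)"
      using si by (simp add: set_integrable_def)
    show "AE x in lborel. norm (h x * box_bump a c j x) \<le> \<bar>indicator (box a c) x * h x\<bar>" for j
      using mult_left_mono[OF abs_box_bump_le[of a c j], of "\<bar>h _\<bar>"]
      by (auto simp: abs_mult mult.commute)
  qed (auto intro!: tendsto_intros box_bump_tendsto)
  then have "(LINT x|lborel. h x * indicator (box a c) x) = 0"
    unfolding 0[OF test_function_box_bump] by (simp add: LIMSEQ_const_iff)
  then show "(LINT x:box a c|lborel. h x) = 0"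
    by (simp add: set_lebesgue_integral_def mult.commute)
qed

section \<open>Moves along the horizontal directions\<close>

text \<open>
  Both the left and the right translations of the group have this form, with \<open>l\<close> an affine function;
  integrating first over the vertical fibre shows that they preserve Lebesgue measure.
\<close>

lemma nn_integral_shear:
  fixes F :: "'a::euclidean_space \<times> real \<Rightarrow> ennreal"
  assumes F[measurable]: "F \<in> borel_measurable borel" and l[measurable]: "l \<in> borel_measurable borel"
  shows "(\<integral>\<^sup>+p. F (a + fst p, snd p + l (fst p)) \<partial>lborel) = (\<integral>\<^sup>+p. F p \<partial>lborel)"
proof -
  have [measurable]: "F \<in> borel_measurable (borel \<Otimes>\<^sub>M borel)" by (simp add: borel_prod)
  have "(\<integral>\<^sup>+p. F (a + fst p, snd p + l (fst p)) \<partial>lborel)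
      = (\<integral>\<^sup>+p. F (a + fst p, snd p + l (fst p)) \<partial>(lborel \<Otimes>\<^sub>M lborel))"
    by (simp only: lborel_prod)
  also have "\<dots> = (\<integral>\<^sup>+x. \<integral>\<^sup>+t. F (a + x, t + l x) \<partial>lborel \<partial>lborel)"
    by (subst lborel.nn_integral_fst[symmetric]) (auto simp del: lborel_prod)
  also have "\<dots> = (\<integral>\<^sup>+x. \<integral>\<^sup>+t. F (a + x, t) \<partial>lborel \<partial>lborel)"
  proof (rule nn_integral_cong)
    fix x :: 'a
    show "(\<integral>\<^sup>+t. F (a + x, t + l x) \<partial>lborel) = (\<integral>\<^sup>+t. F (a + x, t) \<partial>lborel)"
      using nn_integral_real_affine[of "\<lambda>t. F (a + x, t)" 1 "l x"] by (simp add: add.commute)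
  qed
  also have "\<dots> = (\<integral>\<^sup>+x. (\<integral>\<^sup>+t. F (x, t) \<partial>lborel) \<partial>distr lborel borel ((+) a))"
    by (subst nn_integral_distr) auto
  also have "\<dots> = (\<integral>\<^sup>+p. F p \<partial>(lborel \<Otimes>\<^sub>M lborel))"
    by (subst lborel_distr_plus, subst lborel.nn_integral_fst) auto
  finally show ?thesis by (simp only: lborel_prod)
qed

definition wt :: "'n \<Rightarrow> 'n + 'n \<Rightarrow> real" where
  "wt e i = (case i of Inl j \<Rightarrow> weight e j | Inr j \<Rightarrow> weight e j)"

definition quarter_turn :: "real ^ ('n + 'n) \<Rightarrow> 'n::finite + 'n \<Rightarrow> real" where
  "quarter_turn x i = (case i of Inl j \<Rightarrow> - (x $ Inr j) | Inr j \<Rightarrow> x $ Inl j)"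

lemma wt_bounds: "1/2 \<le> wt e i" "wt e i \<le> 1"
  by (auto simp: wt_def weight_def split: sum.splits)

lemma heis_field_eq: "heis_field e i p = (axis i 1, wt e i * quarter_turn (fst p) i)"
  by (cases i) (auto simp: wt_def quarter_turn_def)

lemma quarter_turn_simps [simp]:
  "quarter_turn (x + y) i = quarter_turn x i + quarter_turn y i"
  "quarter_turn (c *\<^sub>R x) i = c * quarter_turn x i"
  "quarter_turn (axis i c) i = 0"
  "quarter_turn 0 i = 0"
  by (auto simp: quarter_turn_def axis_def split: sum.splits)

lemma continuous_quarter_turn [continuous_intros]:
  "continuous_on S f \<Longrightarrow> continuous_on S (\<lambda>p. quarter_turn (f p) i)"
  by (cases i) (auto simp: quarter_turn_def intro!: continuous_intros)

definition move :: "'n::finite \<Rightarrow> 'n + 'n \<Rightarrow> real \<Rightarrow> 'n heis \<Rightarrow> 'n heis" where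
  "move e i s p = p + s *\<^sub>R heis_field e i p"

lemma move_eq: "move e i s p = (s *\<^sub>R axis i 1 + fst p, snd p + s * (wt e i * quarter_turn (fst p) i))"
  by (simp add: move_def heis_field_eq prod_eq_iff)

lemma move_move [simp]: "move e i r (move e i s p) = move e i (r + s) p"
  by (simp add: move_eq algebra_simps)

lemma move_0 [simp]: "move e i 0 p = p"
  by (simp add: move_def)

lemma heis_field_move [simp]: "heis_field e i (move e i s p) = heis_field e i p"
  by (simp add: heis_field_eq move_eq)

lemma continuous_move [continuous_intros]:
  "continuous_on S f \<Longrightarrow> continuous_on S g \<Longrightarrow> continuous_on S (\<lambda>p. move e i (f p) (g p))"
  by (simp add: move_eq) (intro continuous_intros; simp)

lemma move_measurable [measurable]: "move e i s \<in> borel_measurable borel"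
  by (intro borel_measurable_continuous_onI continuous_intros)

lemma move_pair_measurable [measurable]:
  "(\<lambda>z. move e i (fst z) (snd z)) \<in> borel_measurable (borel \<Otimes>\<^sub>M borel)"
  "(\<lambda>z. move e i (snd z) (fst z)) \<in> borel_measurable (borel \<Otimes>\<^sub>M borel)"
  unfolding borel_prod by (intro borel_measurable_continuous_onI continuous_intros)+

lemma move_measurable2 [measurable (raw)]:
  assumes "f \<in> borel_measurable M" "g \<in> borel_measurable M"
  shows "(\<lambda>x. move e i (f x) (g x)) \<in> borel_measurable M"
  using measurable_compose[OF measurable_Pair[OF assms] move_pair_measurable(1)] by simp

lemma nn_integral_move:
  assumes [measurable]: "F \<in> borel_measurable borel"
  shows "(\<integral>\<^sup>+p. F (move e i s p) \<partial>lborel) = (\<integral>\<^sup>+p. F p \<partial>lborel)"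
proof -
  have [measurable]: "(\<lambda>x. s * (wt e i * quarter_turn x i)) \<in> borel_measurable borel"
    by (intro borel_measurable_continuous_onI continuous_intros)
  show ?thesis unfolding move_eq by (rule nn_integral_shear) auto
qed

lemma distr_move: "distr lborel borel (move e i s) = lborel"
  by (rule measure_eqI)
     (auto simp: nn_integral_move nn_integral_distr simp flip: nn_integral_indicator)

lemma integral_move:
  fixes F :: "'n::finite heis \<Rightarrow> real"
  assumes [measurable]: "F \<in> borel_measurable borel"
  shows "(LINT p|lborel. F (move e i s p)) = (LINT p|lborel. F p)"
  using integral_distr[of "move e i s" lborel borel F] by (simp add: distr_move)

lemma integrable_move:
  fixes F :: "'n::finite heis \<Rightarrow> real"
  assumes "integrable lborel F"
  shows "integrable lborel (\<lambda>p. F (move e i s p))"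
  using integrable_distr[of "move e i s" lborel borel F] assms by (simp add: distr_move)

lemma move_bounded:
  assumes "bounded K"
  shows "\<exists>\<rho>. \<forall>r p. \<bar>r\<bar> \<le> s \<longrightarrow> p \<in> K \<longrightarrow> norm (move e i r p) \<le> \<rho>"
proof -
  define I where "I = (\<lambda>z. move e i (fst z) (snd z)) ` ({-s..s} \<times> closure K)"
  have "compact I"
    unfolding I_def using assms by (intro compact_continuous_image continuous_intros compact_Times) auto
  then have "bounded I" by (rule compact_imp_bounded)
  then obtain \<rho> where \<rho>: "\<And>y. y \<in> I \<Longrightarrow> norm y \<le> \<rho>" unfolding bounded_iff by blast
  have "norm (move e i r p) \<le> \<rho>" if "\<bar>r\<bar> \<le> s" "p \<in> K" for r p
    using that closure_subset[of K] by (intro \<rho>) (auto simp: I_def abs_le_iff intro!: image_eqI[of _ _ "(r, p)"])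
  then show ?thesis by blast
qed

lemma test_function_move:
  assumes "test_function \<phi>" shows "test_function (\<lambda>p. \<phi> (move e i s p))"
proof -
  define L where "L = (\<lambda>p :: 'a heis. (fst p, snd p + s * (wt e i * quarter_turn (fst p) i)))"
  have "bounded_linear L" unfolding L_def
    by (rule linear_conv_bounded_linear[THEN iffD1]) (auto intro!: linearI simp: prod_eq_iff algebra_simps)
  moreover have "inj L" by (auto simp: inj_def prod_eq_iff L_def)
  ultimately have "test_function (\<lambda>p. \<phi> ((s *\<^sub>R axis i 1, 0) + L p))"
    using assms by (intro test_function_affine)
  moreover have "move e i s p = (s *\<^sub>R axis i 1, 0) + L p" for p by (simp add: move_eq L_def)
  ultimately show ?thesis by simp
qed

lemma test_function_continuous: "test_function \<phi> \<Longrightarrow> continuous_on UNIV \<phi>"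
  unfolding test_function_def by (metis C_k.simps(1))

lemma test_function_has_derivative:
  "test_function \<phi> \<Longrightarrow> (\<phi> has_derivative frechet_derivative \<phi> (at p)) (at p)"
  unfolding test_function_def by (metis C_k.simps(2) frechet_derivative_works)

lemma test_function_deriv_continuous:
  "test_function \<phi> \<Longrightarrow> continuous_on UNIV (\<lambda>p. frechet_derivative \<phi> (at p) v)"
  unfolding test_function_def by (metis C_k.simps)

lemma test_function_bounded_support:
  assumes "test_function \<phi>" shows "bounded {p. \<phi> p \<noteq> 0}"
  using assms bounded_subset[OF compact_imp_bounded closure_subset] unfolding test_function_def by blast

lemma heis_derivative_eq:
  assumes "test_function \<phi>"
  shows "frechet_derivative \<phi> (at p) (heis_field e i p') = frechet_derivative \<phi> (at p) (axis i 1, 0)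
      + wt e i * quarter_turn (fst p') i * frechet_derivative \<phi> (at p) (0, 1)"
proof -
  interpret bounded_linear "frechet_derivative \<phi> (at p)"
    using test_function_has_derivative[OF assms] has_derivative_bounded_linear by blast
  have "heis_field e i p' = (axis i 1, 0) + (wt e i * quarter_turn (fst p') i) *\<^sub>R (0, 1)"
    by (simp add: heis_field_eq)
  then show ?thesis by (simp only: add scaleR real_scaleR_def)
qed

text \<open>
  A left-invariant field commutes with its own flow. This is what allows the weak derivative to be
  tested against a transported test function.
\<close>

lemma heis_derivative_move:
  assumes "test_function \<phi>"
  shows "frechet_derivative (\<lambda>p. \<phi> (move e i s p)) (at p) (heis_field e i p)
       = frechet_derivative \<phi> (at (move e i s p)) (heis_field e i p)"
proof -
  define L where "L = (\<lambda>v :: 'a heis. (fst v, snd v + s * (wt e i * quarter_turn (fst v) i)))"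
  have "bounded_linear L" unfolding L_def
    by (rule linear_conv_bounded_linear[THEN iffD1]) (auto intro!: linearI simp: prod_eq_iff algebra_simps)
  then have "((\<lambda>p. (s *\<^sub>R axis i 1, 0) + L p) has_derivative L) (at p)"
    using has_derivative_add[OF has_derivative_const bounded_linear_imp_has_derivative] by fastforce
  moreover have "move e i s = (\<lambda>p. (s *\<^sub>R axis i 1, 0) + L p)"
    by (simp add: fun_eq_iff move_eq L_def)
  ultimately have "(move e i s has_derivative L) (at p)" by simp
  from has_derivative_compose[OF this test_function_has_derivative[OF assms]]
  have "frechet_derivative (\<lambda>p. \<phi> (move e i s p)) (at p)
      = (\<lambda>v. frechet_derivative \<phi> (at (move e i s p)) (L v))"
    by (rule frechet_derivative_at[symmetric])
  then show ?thesis by (simp add: heis_field_eq L_def)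
qed

lemma test_function_along_line:
  assumes \<phi>: "test_function \<phi>" and "0 \<le> s"
  shows "(LINT r|lborel. indicator {0..s} r * frechet_derivative \<phi> (at (move e i (- r) p)) (heis_field e i p))
       = \<phi> p - \<phi> (move e i (- s) p)"
proof -
  let ?D = "\<lambda>r. frechet_derivative \<phi> (at (move e i (- r) p)) (heis_field e i p)"
  have "(\<integral>r. indicator {0..s} r *\<^sub>R ?D r \<partial>lborel) = - \<phi> (move e i (- s) p) - (- \<phi> (move e i (- 0) p))"
  proof (rule integral_FTC_Icc)
    fix r
    have "((\<lambda>r. move e i (- r) p) has_derivative (\<lambda>h. - h *\<^sub>R heis_field e i p)) (at r within {0..s})"
      unfolding move_def by (auto intro!: derivative_eq_intros)
    from has_derivative_compose[OF this test_function_has_derivative[OF \<phi>]]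
    have "((\<lambda>r. - \<phi> (move e i (- r) p)) has_derivative
        (\<lambda>h. - frechet_derivative \<phi> (at (move e i (- r) p)) (- h *\<^sub>R heis_field e i p))) (at r within {0..s})"
      by (rule has_derivative_minus)
    moreover have "- frechet_derivative \<phi> (at q) (- h *\<^sub>R heis_field e i p)
        = h *\<^sub>R frechet_derivative \<phi> (at q) (heis_field e i p)" for h q
    proof -
      interpret bounded_linear "frechet_derivative \<phi> (at q)"
        using test_function_has_derivative[OF \<phi>] has_derivative_bounded_linear by blast
      show ?thesis by (simp add: scaleR neg)
    qed
    ultimately show "((\<lambda>r. - \<phi> (move e i (- r) p)) has_vector_derivative ?D r) (at r within {0..s})"
      by (simp add: has_vector_derivative_def)
    show "continuous_on {0..s} ?D" unfolding heis_derivative_eq[OF \<phi>]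
      by (intro continuous_intros continuous_on_compose2[OF test_function_deriv_continuous[OF \<phi>]]) auto
  qed fact
  then show ?thesis by simp
qed

section \<open>Weak sub-gradients and increments along lines\<close>

text \<open>
  Tonelli, followed by a translation of the inner integral along the line: the weight is moved
  instead of \<open>\<gamma>\<close>, which is known only almost everywhere.
\<close>

lemma nn_integral_along_lines:
  fixes w \<gamma> :: "'n::finite heis \<Rightarrow> ennreal"
  assumes [measurable]: "w \<in> borel_measurable borel" "\<gamma> \<in> borel_measurable borel"
  shows "(\<integral>\<^sup>+p. w p * (\<integral>\<^sup>+r. indicator {0..s} r * \<gamma> (move e i r p) \<partial>lborel) \<partial>lborel)
       = (\<integral>\<^sup>+r. indicator {0..s} r * (\<integral>\<^sup>+p. w (move e i (- r) p) * \<gamma> p \<partial>lborel) \<partial>lborel)"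
proof -
  have "(\<integral>\<^sup>+p. w p * (\<integral>\<^sup>+r. indicator {0..s} r * \<gamma> (move e i r p) \<partial>lborel) \<partial>lborel)
      = (\<integral>\<^sup>+p. (\<integral>\<^sup>+r. w p * (indicator {0..s} r * \<gamma> (move e i r p)) \<partial>lborel) \<partial>lborel)"
    by (intro nn_integral_cong nn_integral_cmult[symmetric]) measurable
  also have "\<dots> = (\<integral>\<^sup>+r. (\<integral>\<^sup>+p. w p * (indicator {0..s} r * \<gamma> (move e i r p)) \<partial>lborel) \<partial>lborel)"
    by (rule lborel_pair.Fubini'[symmetric]) measurable
  also have "\<dots> = (\<integral>\<^sup>+r. indicator {0..s} r * (\<integral>\<^sup>+p. w p * \<gamma> (move e i r p) \<partial>lborel) \<partial>lborel)"
    by (intro nn_integral_cong, subst nn_integral_cmult[symmetric]) (auto simp: mult_ac)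
  also have "\<dots> = (\<integral>\<^sup>+r. indicator {0..s} r * (\<integral>\<^sup>+p. w (move e i (- r) p) * \<gamma> p \<partial>lborel) \<partial>lborel)"
  proof (rule nn_integral_cong)
    fix r :: real
    show "indicator {0..s} r * (\<integral>\<^sup>+p. w p * \<gamma> (move e i r p) \<partial>lborel)
        = indicator {0..s} r * (\<integral>\<^sup>+p. w (move e i (- r) p) * \<gamma> p \<partial>lborel)"
      using nn_integral_move[of "\<lambda>p. w (move e i (- r) p) * \<gamma> p" e i r] by simp
  qed
  finally show ?thesis .
qed

lemma integrable_along_lines:
  fixes \<gamma> :: "'n::finite heis \<Rightarrow> real"
  assumes [measurable]: "\<gamma> \<in> borel_measurable borel" "w \<in> borel_measurable borel"
    and loc: "\<And>\<rho>. set_integrable lborel (cball 0 \<rho>) \<gamma>"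
    and w: "\<And>p. \<bar>w p\<bar> \<le> M" "bounded {p. w p \<noteq> 0}"
  shows "integrable (lborel \<Otimes>\<^sub>M lborel) (\<lambda>(p, r). w p * (indicator {0..s} r * \<gamma> (move e i r p)))"
    (is "integrable _ ?F")
proof (rule integrableI_bounded)
  show "?F \<in> borel_measurable (lborel \<Otimes>\<^sub>M lborel)" by measurable
  obtain \<rho> where \<rho>: "\<And>r p. \<bar>r\<bar> \<le> s \<Longrightarrow> w p \<noteq> 0 \<Longrightarrow> norm (move e i r p) \<le> \<rho>"
    using move_bounded[OF w(2)] by blast
  have M: "0 \<le> M" using w(1)[of 0] by linarith
  have "(\<integral>\<^sup>+z. ennreal (norm (?F z)) \<partial>(lborel \<Otimes>\<^sub>M lborel))
      = (\<integral>\<^sup>+p. (\<integral>\<^sup>+r. ennreal (norm (?F (p, r))) \<partial>lborel) \<partial>lborel)"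
    by (rule lborel.nn_integral_fst[symmetric]) measurable
  also have "\<dots> = (\<integral>\<^sup>+p. ennreal \<bar>w p\<bar> * (\<integral>\<^sup>+r. indicator {0..s} r * ennreal \<bar>\<gamma> (move e i r p)\<bar> \<partial>lborel) \<partial>lborel)"
    by (intro nn_integral_cong, subst nn_integral_cmult[symmetric])
       (auto simp: abs_mult ennreal_mult' indicator_def intro!: nn_integral_cong)
  also have "\<dots> = (\<integral>\<^sup>+r. indicator {0..s} r * (\<integral>\<^sup>+p. ennreal \<bar>w (move e i (- r) p)\<bar> * ennreal \<bar>\<gamma> p\<bar> \<partial>lborel) \<partial>lborel)"
    by (rule nn_integral_along_lines) measurable
  also have "\<dots> \<le> (\<integral>\<^sup>+r. indicator {0..s} r * (\<integral>\<^sup>+p. ennreal M * ennreal (norm (indicator (cball 0 \<rho>) p *\<^sub>R \<gamma> p)) \<partial>lborel) \<partial>lborel)"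
  proof (intro nn_integral_mono)
    fix r
    show "indicator {0..s} r * (\<integral>\<^sup>+p. ennreal \<bar>w (move e i (- r) p)\<bar> * ennreal \<bar>\<gamma> p\<bar> \<partial>lborel)
      \<le> indicator {0..s} r * (\<integral>\<^sup>+p. ennreal M * ennreal (norm (indicator (cball 0 \<rho>) p *\<^sub>R \<gamma> p)) \<partial>lborel)"
    proof (cases "r \<in> {0..s}")
      case True
      have "ennreal \<bar>w (move e i (- r) p)\<bar> * ennreal \<bar>\<gamma> p\<bar>
          \<le> ennreal M * ennreal (norm (indicator (cball 0 \<rho>) p *\<^sub>R \<gamma> p))" for p
      proof (cases "w (move e i (- r) p) = 0")
        case False
        then have "norm p \<le> \<rho>" using \<rho>[of r "move e i (- r) p"] True by auto
        then show ?thesis using w(1)[of "move e i (- r) p"] by (auto intro!: mult_right_mono ennreal_leI)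
      qed simp
      then show ?thesis by (intro mult_left_mono nn_integral_mono) auto
    qed simp
  qed
  also have "\<dots> = ennreal M * (\<integral>\<^sup>+p. ennreal (norm (indicator (cball 0 \<rho>) p *\<^sub>R \<gamma> p)) \<partial>lborel) * emeasure lborel {0..s}"
    by (subst nn_integral_multc, simp, subst nn_integral_cmult) (auto simp: mult.commute)
  also have "\<dots> < \<infinity>"
    using loc[of \<rho>, unfolded set_integrable_def integrable_iff_bounded]
    by (auto intro!: ennreal_mult_less_top[THEN iffD2] simp: emeasure_lborel_Icc_eq)
  finally show "(\<integral>\<^sup>+z. ennreal (norm (?F z)) \<partial>(lborel \<Otimes>\<^sub>M lborel)) < \<infinity>" .
qed

lemma integrable_times_bounded_support:
  fixes \<gamma> w :: "'n::finite heis \<Rightarrow> real"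
  assumes [measurable]: "\<gamma> \<in> borel_measurable borel" "w \<in> borel_measurable borel"
    and loc: "\<And>\<rho>. set_integrable lborel (cball 0 \<rho>) \<gamma>"
    and w: "\<And>p. \<bar>w p\<bar> \<le> M" "bounded {p. w p \<noteq> 0}"
  shows "integrable lborel (\<lambda>p. \<gamma> p * w p)"
proof -
  obtain \<rho> where \<rho>: "\<And>p. w p \<noteq> 0 \<Longrightarrow> norm p \<le> \<rho>"
    using w(2) unfolding bounded_iff by blast
  show ?thesis
  proof (rule Bochner_Integration.integrable_bound)
    show "integrable lborel (\<lambda>p. M * (indicator (cball 0 \<rho>) p *\<^sub>R \<gamma> p))"
      using loc[of \<rho>] unfolding set_integrable_def by (intro integrable_mult_right)
    have "norm (\<gamma> p * w p) \<le> norm (M * (indicator (cball 0 \<rho>) p *\<^sub>R \<gamma> p))" for p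
    proof (cases "w p = 0")
      case False
      then show ?thesis using \<rho>[OF False] w(1)[of p]
        mult_right_mono[of "\<bar>w p\<bar>" "\<bar>M\<bar>" "\<bar>\<gamma> p\<bar>"]
        by (auto simp: abs_mult mult.commute)
    qed simp
    then show "AE p in lborel. norm (\<gamma> p * w p) \<le> norm (M * (indicator (cball 0 \<rho>) p *\<^sub>R \<gamma> p))"
      by simp
  qed measurable
qed

lemma test_function_bounded:
  assumes "test_function \<phi>" obtains M where "\<And>p. \<bar>\<phi> p\<bar> \<le> M"
proof -
  have "compact (\<phi> ` closure {p. \<phi> p \<noteq> 0})"
    using assms test_function_continuous[OF assms] unfolding test_function_def
    by (intro compact_continuous_image) (auto intro: continuous_on_subset)
  then obtain M where M: "\<And>y. y \<in> \<phi> ` closure {p. \<phi> p \<noteq> 0} \<Longrightarrow> \<bar>y\<bar> \<le> M"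
    unfolding compact_eq_bounded_closed bounded_iff by auto
  have "\<bar>\<phi> p\<bar> \<le> max M 0" for p
    using M[of "\<phi> p"] closure_subset[of "{p. \<phi> p \<noteq> 0}"] by (cases "\<phi> p = 0") auto
  then show thesis using that by blast
qed

lemma heis_derivative_bounded:
  fixes \<phi> :: "'n::finite heis \<Rightarrow> real"
  assumes \<phi>: "test_function \<phi>"
  obtains M where "\<And>p. \<bar>frechet_derivative \<phi> (at p) (heis_field e i p)\<bar> \<le> M"
    "bounded {p. frechet_derivative \<phi> (at p) (heis_field e i p) \<noteq> 0}"
    "(\<lambda>p. frechet_derivative \<phi> (at p) (heis_field e i p)) \<in> borel_measurable borel"
proof -
  let ?D = "\<lambda>p. frechet_derivative \<phi> (at p) (heis_field e i p)"
  let ?K = "closure {p. \<phi> p \<noteq> 0}"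
  have c: "continuous_on UNIV ?D"
    unfolding heis_derivative_eq[OF \<phi>] by (intro continuous_intros test_function_deriv_continuous \<phi>)
  have K: "compact ?K" using \<phi> unfolding test_function_def by blast
  have 0: "?D p = 0" if "p \<notin> ?K" for p
  proof -
    have "((\<lambda>p. 0 :: real) has_derivative (\<lambda>v. 0)) (at p)" by simp
    then have "(\<phi> has_derivative (\<lambda>v. 0)) (at p)"
      by (rule has_derivative_transform_within_open[where s="- ?K"])
         (use that closure_subset[of "{p. \<phi> p \<noteq> 0}"] in auto)
    from fun_cong[OF frechet_derivative_at[OF this], of "heis_field e i p"] show ?thesis by simp
  qed
  have "compact (?D ` ?K)" using c K by (intro compact_continuous_image) (auto intro: continuous_on_subset)
  then obtain M where M: "\<And>y. y \<in> ?D ` ?K \<Longrightarrow> \<bar>y\<bar> \<le> M"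
    unfolding compact_eq_bounded_closed bounded_iff by auto
  show thesis
  proof (rule that)
    show "\<bar>?D p\<bar> \<le> max M 0" for p
      using M[of "?D p"] 0[of p] by (cases "p \<in> ?K") auto
    have "{p. ?D p \<noteq> 0} \<subseteq> ?K" using 0 by blast
    then show "bounded {p. ?D p \<noteq> 0}" using K by (meson bounded_subset compact_imp_bounded)
    show "?D \<in> borel_measurable borel" using c by (rule borel_measurable_continuous_onI)
  qed
qed

lemma weak_subgradient_borelD:
  fixes f :: "'n::finite heis \<Rightarrow> real" and g :: "'n heis \<Rightarrow> real ^ ('n + 'n)"
  assumes "weak_subgradient e f g"
    and [measurable]: "f \<in> borel_measurable borel" "g \<in> borel_measurable borel"
  shows "set_integrable lborel (cball 0 \<rho>) f" "set_integrable lborel (cball 0 \<rho>) (\<lambda>p. g p $ i)"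
    and "test_function \<phi> \<Longrightarrow>
        (LINT p|lborel. f p * frechet_derivative \<phi> (at p) (heis_field e i p))
        = - (LINT p|lborel. g p $ i * \<phi> p)"
proof -
  have [measurable]: "(\<lambda>p. g p $ i) \<in> borel_measurable borel"
    using measurable_compose[OF assms(3), of "\<lambda>x. x $ i" borel]
    by (auto intro!: borel_measurable_continuous_onI continuous_intros)
  have *: "set_integrable lborel (cball 0 \<rho>) h"
    if [measurable]: "h \<in> borel_measurable borel" and "h absolutely_integrable_on (cball 0 \<rho>)"
    for h :: "'n heis \<Rightarrow> 'b::euclidean_space"
    using that(2) unfolding set_integrable_def 
    by (subst (asm) integrable_completion) (auto intro!: borel_measurable_scaleR borel_measurable_indicator)
  show "set_integrable lborel (cball 0 \<rho>) f"
    using assms unfolding weak_subgradient_def by (intro *) auto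
  have "set_integrable lborel (cball 0 \<rho>) g"
    using assms unfolding weak_subgradient_def by (intro *) auto
  then show "set_integrable lborel (cball 0 \<rho>) (\<lambda>p. g p $ i)"
    unfolding set_integrable_def
  proof (rule Bochner_Integration.integrable_bound)
    have "norm (indicator (cball 0 \<rho>) p *\<^sub>R g p $ i) \<le> norm (indicator (cball 0 \<rho>) p *\<^sub>R g p)" for p
      using component_le_norm_cart[of "g p" i] by (auto simp: indicator_def)
    then show "AE p in lborel. norm (indicator (cball 0 \<rho>) p *\<^sub>R g p $ i) \<le> norm (indicator (cball 0 \<rho>) p *\<^sub>R g p)"
      by simp
  qed measurable
  assume \<phi>: "test_function \<phi>"
  have [measurable]: "\<phi> \<in> borel_measurable borel"
    using \<phi> by (intro borel_measurable_continuous_onI test_function_continuous)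
  have [measurable]: "(\<lambda>p. frechet_derivative \<phi> (at p) (heis_field e i p)) \<in> borel_measurable borel"
    by (rule heis_derivative_bounded[OF \<phi>, of e i])
  show "(LINT p|lborel. f p * frechet_derivative \<phi> (at p) (heis_field e i p))
        = - (LINT p|lborel. g p $ i * \<phi> p)"
  proof -
    have "(LINT p|lebesgue. f p * frechet_derivative \<phi> (at p) (heis_field e i p))
        = - (LINT p|lebesgue. g p $ i * \<phi> p)"
      using assms(1) \<phi> unfolding weak_subgradient_def by blast
    moreover have "(\<lambda>p. f p * frechet_derivative \<phi> (at p) (heis_field e i p)) \<in> borel_measurable lborel"
      "(\<lambda>p. g p $ i * \<phi> p) \<in> borel_measurable lborel" by measurable
    ultimately show ?thesis by (simp only: integral_completion)
  qed
qed

text \<open>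
  Tested against \<open>\<phi>\<close>, the increment of \<open>f\<close> becomes an increment of \<open>\<phi>\<close> along the reversed flow. The latter
  is an integral of derivatives $X_i(\phi \circ \mathrm{flow})$, and for each of them the definition of
  the weak derivative applies.
\<close>

lemma weak_subgradient_along_lines:
  fixes f :: "'n::finite heis \<Rightarrow> real" and g :: "'n heis \<Rightarrow> real ^ ('n + 'n)"
  assumes wsg: "weak_subgradient e f g"
    and f[measurable]: "f \<in> borel_measurable borel" and g: "g \<in> borel_measurable borel"
    and s: "0 \<le> s"
  shows "AE p in lborel. f (move e i s p) - f p
      = (LINT r|lborel. indicator {0..s} r * g (move e i r p) $ i)"
proof -
  define \<gamma> where "\<gamma> p = g p $ i" for p
  have [measurable]: "\<gamma> \<in> borel_measurable borel" unfolding \<gamma>_def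
    using measurable_compose[OF g, of "\<lambda>x. x $ i" borel]
    by (auto intro!: borel_measurable_continuous_onI continuous_intros)
  note weak = weak_subgradient_borelD[OF wsg f g]
  have loc_f: "\<And>\<rho>. set_integrable lborel (cball 0 \<rho>) f" and loc: "\<And>\<rho>. set_integrable lborel (cball 0 \<rho>) \<gamma>"
    using weak(1) weak(2)[of _ i] by (simp_all add: \<gamma>_def[abs_def])
  let ?A = "\<lambda>p. LINT r|lborel. indicator {0..s} r * \<gamma> (move e i r p)"
  let ?h = "\<lambda>p. f (move e i s p) - f p - ?A p"
  \<comment> \<open>Each of the three terms of the increment may be integrated against a bounded function of bounded support.\<close>
  have int: "integrable lborel (\<lambda>p. f (move e i s p) * w p)" "integrable lborel (\<lambda>p. f p * w p)"
    "integrable lborel (\<lambda>p. w p * ?A p)"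
    if [measurable]: "w \<in> borel_measurable borel" and w: "\<And>p. \<bar>w p\<bar> \<le> M" "bounded {p. w p \<noteq> 0}" for w M
  proof -
    obtain \<rho> where \<rho>: "\<And>r p. \<bar>r\<bar> \<le> s \<Longrightarrow> w p \<noteq> 0 \<Longrightarrow> norm (move e i r p) \<le> \<rho>"
      using move_bounded[OF w(2)] by blast
    have "norm p \<le> \<rho>" if "w (move e i (- s) p) \<noteq> 0" for p
      using \<rho>[of s "move e i (- s) p"] that s by simp
    then have "bounded {p. w (move e i (- s) p) \<noteq> 0}" unfolding bounded_iff by blast
    then have "integrable lborel (\<lambda>p. f p * w (move e i (- s) p))"
      using w(1) by (intro integrable_times_bounded_support[where M=M] loc_f) auto
    from integrable_move[OF this, of e i s] show "integrable lborel (\<lambda>p. f (move e i s p) * w p)"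
      by simp
    show "integrable lborel (\<lambda>p. f p * w p)"
      using w by (intro integrable_times_bounded_support[where M=M] loc_f) auto
    have "integrable (lborel \<Otimes>\<^sub>M lborel) (\<lambda>(p, r). w p * (indicator {0..s} r * \<gamma> (move e i r p)))"
      using w by (intro integrable_along_lines[where M=M] loc) auto
    from lborel_pair.integrable_fst[OF this] show "integrable lborel (\<lambda>p. w p * ?A p)" by simp
  qed
  have "AE p in lborel. ?h p = 0"
  proof (rule fundamental_lemma_of_variations)
    show "?h \<in> borel_measurable borel" by measurable
  next
    fix a c :: "'n heis"
    have "{p. indicat_real (cbox a c) p \<noteq> 0} = cbox a c" by (simp add: indicator_eq_0_iff)
    then have "integrable lborel (\<lambda>p. f (move e i s p) * indicator (cbox a c) p - f p * indicator (cbox a c) p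
        - indicator (cbox a c) p * ?A p)"
      by (intro Bochner_Integration.integrable_diff int[of _ 1]) auto
    then show "set_integrable lborel (cbox a c) ?h"
      by (simp add: set_integrable_def algebra_simps)
  next
    fix \<phi> :: "'n heis \<Rightarrow> real" assume \<phi>: "test_function \<phi>"
    have [measurable]: "\<phi> \<in> borel_measurable borel"
      using \<phi> by (intro borel_measurable_continuous_onI test_function_continuous)
    obtain M where M: "\<And>p. \<bar>\<phi> p\<bar> \<le> M" using test_function_bounded[OF \<phi>] by blast
    note bs = test_function_bounded_support[OF \<phi>]
    define D where "D = (\<lambda>p. frechet_derivative \<phi> (at p) (heis_field e i p))"
    obtain M' where M': "\<And>p. \<bar>D p\<bar> \<le> M'" "bounded {p. D p \<noteq> 0}" and [measurable]: "D \<in> borel_measurable borel"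
    proof (rule heis_derivative_bounded[OF \<phi>, of e i])
      fix M' assume "\<And>p. \<bar>frechet_derivative \<phi> (at p) (heis_field e i p)\<bar> \<le> M'"
        "bounded {p. frechet_derivative \<phi> (at p) (heis_field e i p) \<noteq> 0}"
        "(\<lambda>p. frechet_derivative \<phi> (at p) (heis_field e i p)) \<in> borel_measurable borel"
      then show thesis unfolding D_def[symmetric] by (intro that[of M']) (auto simp: D_def)
    qed
    have D: "frechet_derivative (\<lambda>p. \<phi> (move e i (- r) p)) (at p) (heis_field e i p) = D (move e i (- r) p)" for r p
      using heis_derivative_move[OF \<phi>] by (simp add: D_def)
    have iD: "integrable (lborel \<Otimes>\<^sub>M lborel) (\<lambda>(p, r). f p * (indicator {0..s} r * D (move e i (- r) p)))"
    proof -
      obtain \<rho> where \<rho>: "\<And>r p. \<bar>r\<bar> \<le> s \<Longrightarrow> D p \<noteq> 0 \<Longrightarrow> norm (move e i r p) \<le> \<rho>"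
        using move_bounded[OF M'(2)] by blast
      define F where "F p = M' * (indicator (cball 0 \<rho>) p *\<^sub>R f p)" for p
      have [measurable]: "F \<in> borel_measurable borel" unfolding F_def by measurable
      have ind: "integrable lborel (indicat_real {0..s})"
        by (simp add: integrable_indicator_iff emeasure_lborel_Icc_eq)
      have "integrable (lborel \<Otimes>\<^sub>M lborel) (\<lambda>(p, r). F p * indicator {0..s} r)"
      proof (rule lborel_pair.Fubini_integrable)
        have iF: "integrable lborel F"
          using loc_f[of \<rho>] unfolding set_integrable_def F_def by (intro integrable_mult_right)
        then show "integrable lborel (\<lambda>p. LINT r|lborel. norm (case (p, r) of (p, r) \<Rightarrow> F p * indicator {0..s} r))"
          by (simp add: abs_mult)
      qed (use ind in \<open>simp_all\<close>)
      then show ?thesis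
      proof (rule Bochner_Integration.integrable_bound)
        show "AE z in lborel \<Otimes>\<^sub>M lborel. norm (case z of (p, r) \<Rightarrow> f p * (indicator {0..s} r * D (move e i (- r) p)))
            \<le> norm (case z of (p, r) \<Rightarrow> F p * indicator {0..s} r)"
        proof (intro AE_I2)
          fix z :: "'n heis \<times> real"
          obtain p r where z: "z = (p, r)" by (cases z)
          show "norm (case z of (p, r) \<Rightarrow> f p * (indicator {0..s} r * D (move e i (- r) p)))
            \<le> norm (case z of (p, r) \<Rightarrow> F p * indicator {0..s} r)"
          proof (cases "r \<in> {0..s} \<and> D (move e i (- r) p) \<noteq> 0")
            case True
            then have "norm p \<le> \<rho>" using \<rho>[of r "move e i (- r) p"] by auto
            then show ?thesis using True mult_right_mono[of "\<bar>D (move e i (- r) p)\<bar>" "\<bar>M'\<bar>" "\<bar>f p\<bar>"] M'(1)[of "move e i (- r) p"]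
              by (auto simp: z F_def abs_mult mult.commute)
          qed (auto simp: z)
        qed
      qed measurable
    qed
    have iA: "integrable (lborel \<Otimes>\<^sub>M lborel) (\<lambda>(p, r). \<phi> p * (indicator {0..s} r * \<gamma> (move e i r p)))"
      using M bs by (intro integrable_along_lines[where M=M] loc) auto
    \<comment> \<open>The increment is moved to \<open>\<phi>\<close>, written as an integral of derivatives, and moved back after the weak derivative has been applied.\<close>
    have "(LINT p|lborel. f (move e i s p) * \<phi> p) - (LINT p|lborel. f p * \<phi> p)
        = (LINT p|lborel. f p * \<phi> (move e i (- s) p)) - (LINT p|lborel. f p * \<phi> p)"
      using integral_move[of "\<lambda>p. f p * \<phi> (move e i (- s) p)" e i s] by simp
    also have "\<dots> = - (LINT p|lborel. f p * (\<phi> p - \<phi> (move e i (- s) p)))"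
    proof -
      obtain \<rho> where \<rho>: "\<And>r p. \<bar>r\<bar> \<le> s \<Longrightarrow> \<phi> p \<noteq> 0 \<Longrightarrow> norm (move e i r p) \<le> \<rho>"
        using move_bounded[OF bs] by blast
      have "norm p \<le> \<rho>" if "\<phi> (move e i (- s) p) \<noteq> 0" for p
        using \<rho>[of s "move e i (- s) p"] that s by simp
      then have "bounded {p. \<phi> (move e i (- s) p) \<noteq> 0}" unfolding bounded_iff by blast
      then have "integrable lborel (\<lambda>p. f p * \<phi> (move e i (- s) p))"
        using M by (intro int(2)[of _ M]) auto
      then show ?thesis using int(2)[of \<phi> M] M bs by (simp add: right_diff_distrib)
    qed
    also have "\<dots> = - (LINT p|lborel. f p * (LINT r|lborel. indicator {0..s} r * D (move e i (- r) p)))"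
      using test_function_along_line[OF \<phi> s, of e i] by (simp add: D_def)
    also have "\<dots> = - (LINT p|lborel. LINT r|lborel. f p * (indicator {0..s} r * D (move e i (- r) p)))"
      by simp
    also have "\<dots> = - (LINT r|lborel. LINT p|lborel. f p * (indicator {0..s} r * D (move e i (- r) p)))"
      using lborel_pair.Fubini_integral[OF iD] by simp
    also have "\<dots> = - (LINT r|lborel. indicator {0..s} r * (LINT p|lborel. f p * D (move e i (- r) p)))"
      by (simp only: mult.left_commute[of "f _"] integral_mult_right_zero)
    also have "\<dots> = (LINT r|lborel. indicator {0..s} r * (LINT p|lborel. \<gamma> p * \<phi> (move e i (- r) p)))"
      unfolding D[symmetric] weak(3)[OF test_function_move[OF \<phi>]] by (simp add: \<gamma>_def)
    also have "\<dots> = (LINT r|lborel. indicator {0..s} r * (LINT p|lborel. \<gamma> (move e i r p) * \<phi> p))"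
    proof -
      have "(LINT p|lborel. \<gamma> p * \<phi> (move e i (- r) p)) = (LINT p|lborel. \<gamma> (move e i r p) * \<phi> p)" for r
        using integral_move[of "\<lambda>p. \<gamma> p * \<phi> (move e i (- r) p)" e i r] by simp
      then show ?thesis by simp
    qed
    also have "\<dots> = (LINT r|lborel. LINT p|lborel. \<phi> p * (indicator {0..s} r * \<gamma> (move e i r p)))"
      by (simp add: mult_ac flip: integral_mult_right_zero)
    also have "\<dots> = (LINT p|lborel. LINT r|lborel. \<phi> p * (indicator {0..s} r * \<gamma> (move e i r p)))"
      by (rule lborel_pair.Fubini_integral[OF iA])
    also have "\<dots> = (LINT p|lborel. \<phi> p * ?A p)" by simp
    finally have "(LINT p|lborel. f (move e i s p) * \<phi> p) - (LINT p|lborel. f p * \<phi> p) - (LINT p|lborel. \<phi> p * ?A p) = 0"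
      by simp
    moreover have "(LINT p|lborel. ?h p * \<phi> p) = (LINT p|lborel. f (move e i s p) * \<phi> p) - (LINT p|lborel. f p * \<phi> p) - (LINT p|lborel. \<phi> p * ?A p)"
      using int[of \<phi> M] M bs by (simp add: algebra_simps)
    ultimately show "(LINT p|lborel. ?h p * \<phi> p) = 0" by simp
  qed
  then show ?thesis by (simp add: \<gamma>_def)
qed

abbreviation abs_powr :: "real \<Rightarrow> real \<Rightarrow> ennreal" where
  "abs_powr q x \<equiv> ennreal (\<bar>x\<bar> powr q)"

abbreviation ball_integral :: "real \<Rightarrow> ('a::euclidean_space \<Rightarrow> ennreal) \<Rightarrow> ennreal" where
  "ball_integral \<rho> h \<equiv> \<integral>\<^sup>+p. indicator (cball 0 \<rho>) p * h p \<partial>lborel"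

text \<open>
  Young's inequality for $a \cdot m^{q-1}$, read as convexity of the power at $m$. It yields both the Lipschitz
  estimate for powers and Jensen's inequality below.
\<close>

lemma powr_above_tangent:
  fixes a m q :: real
  assumes "0 \<le> a" "0 \<le> m" "1 < q"
  shows "m powr q + q * m powr (q - 1) * (a - m) \<le> a powr q"
proof -
  have "a * m powr (q - 1) \<le> a powr q / q + (m powr (q - 1)) powr (q / (q - 1)) / (q / (q - 1))"
    using assms by (intro Youngs_inequality) (auto simp: field_simps)
  moreover have "(m powr (q - 1)) powr (q / (q - 1)) = m powr q"
    using assms by (simp add: powr_powr)
  moreover have "m powr (q - 1) * m = m powr q"
    using assms by (cases "m = 0") (auto simp: powr_diff)
  ultimately show ?thesis using assms by (simp add: field_simps)
qed

lemma powr_diff_le: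
  fixes a b q :: real
  assumes "1 < q"
  shows "\<bar>\<bar>a\<bar> powr q - \<bar>b\<bar> powr q\<bar> \<le> q * (max \<bar>a\<bar> \<bar>b\<bar>) powr (q - 1) * \<bar>a - b\<bar>"
proof -
  have *: "\<bar>x\<bar> powr q - \<bar>y\<bar> powr q \<le> q * \<bar>x\<bar> powr (q - 1) * \<bar>x - y\<bar>" if "\<bar>y\<bar> \<le> \<bar>x\<bar>" for x y :: real
  proof -
    have "\<bar>x\<bar> powr q - \<bar>y\<bar> powr q \<le> q * \<bar>x\<bar> powr (q - 1) * (\<bar>x\<bar> - \<bar>y\<bar>)"
      using powr_above_tangent[of "\<bar>y\<bar>" "\<bar>x\<bar>" q] assms by (simp add: algebra_simps)
    also have "\<dots> \<le> q * \<bar>x\<bar> powr (q - 1) * \<bar>x - y\<bar>"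
      using assms by (intro mult_left_mono) auto
    finally show ?thesis .
  qed
  show ?thesis
  proof (cases "\<bar>b\<bar> \<le> \<bar>a\<bar>")
    case True
    then show ?thesis using *[OF True] powr_mono2[of q "\<bar>b\<bar>" "\<bar>a\<bar>"] assms by (simp add: max_def)
  next
    case False
    then show ?thesis using *[of a b] powr_mono2[of q "\<bar>a\<bar>" "\<bar>b\<bar>"] assms
      by (simp add: max_def abs_minus_commute)
  qed
qed

lemma abs_add_powr_le:
  fixes a b q :: real
  assumes "0 \<le> q"
  shows "\<bar>a + b\<bar> powr q \<le> 2 powr q * (\<bar>a\<bar> powr q + \<bar>b\<bar> powr q)"
proof -
  have "\<bar>a + b\<bar> powr q \<le> (2 * max \<bar>a\<bar> \<bar>b\<bar>) powr q"
    using assms by (intro powr_mono2) auto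
  also have "\<dots> = 2 powr q * (max \<bar>a\<bar> \<bar>b\<bar>) powr q" by (simp add: powr_mult)
  also have "\<dots> \<le> 2 powr q * (\<bar>a\<bar> powr q + \<bar>b\<bar> powr q)"
    by (intro mult_left_mono) (auto simp: max_def)
  finally show ?thesis .
qed

text \<open>
  Jensen's inequality for the power, without any integrability assumption: a divergent expectation is 0
  by convention, and a divergent right-hand side is \<open>\<infinity>\<close>.
\<close>

lemma (in prob_space) powr_abs_expectation_le:
  assumes q: "1 < q" and [measurable]: "X \<in> borel_measurable M"
  shows "abs_powr q (expectation X) \<le> (\<integral>\<^sup>+\<omega>. abs_powr q (X \<omega>) \<partial>M)"
proof (cases "integrable M X \<and> (\<integral>\<^sup>+\<omega>. abs_powr q (X \<omega>) \<partial>M) < \<infinity>")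
  case True
  then have X: "integrable M (\<lambda>\<omega>. \<bar>X \<omega>\<bar>)" and Xq: "integrable M (\<lambda>\<omega>. \<bar>X \<omega>\<bar> powr q)"
    by (auto intro: integrableI_nonneg)
  define m where "m = \<bar>expectation X\<bar>"
  have m: "0 \<le> m" "m \<le> expectation (\<lambda>\<omega>. \<bar>X \<omega>\<bar>)" unfolding m_def by simp_all
  have "m powr q \<le> m powr q + q * m powr (q - 1) * (expectation (\<lambda>\<omega>. \<bar>X \<omega>\<bar>) - m)"
    using m q by simp
  also have "\<dots> = expectation (\<lambda>\<omega>. m powr q + q * m powr (q - 1) * (\<bar>X \<omega>\<bar> - m))"
    using X by (simp add: prob_space)
  also have "\<dots> \<le> expectation (\<lambda>\<omega>. \<bar>X \<omega>\<bar> powr q)"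
    using X Xq q m by (intro integral_mono powr_above_tangent) auto
  finally show ?thesis
    using Xq by (subst nn_integral_eq_integral) (auto simp: m_def intro!: ennreal_leI)
next
  case False
  then show ?thesis by (auto simp: not_integrable_integral_eq less_top[symmetric])
qed

lemma powr_abs_interval_integral_le:
  fixes h :: "real \<Rightarrow> real"
  assumes q: "1 < q" and s: "0 < s" and [measurable]: "h \<in> borel_measurable borel"
  shows "abs_powr q (LINT r|lborel. indicator {0..s} r * h r)
      \<le> ennreal (s powr (q - 1)) * (\<integral>\<^sup>+r. indicator {0..s} r * abs_powr q (h r) \<partial>lborel)"
proof -
  define U where "U = density lborel (\<lambda>r. ennreal (indicator {0..s} r / s))"
  interpret prob_space U
  proof (rule prob_spaceI)
    have "emeasure U (space U) = (\<integral>\<^sup>+r. ennreal (1/s) * indicator {0..s} r \<partial>lborel)"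
      unfolding U_def by (subst emeasure_density) (auto intro!: nn_integral_cong simp: indicator_def)
    also have "\<dots> = 1" using s by (subst nn_integral_cmult_indicator) (auto simp flip: ennreal_mult)
    finally show "emeasure U (space U) = 1" .
  qed
  have "(LINT r|lborel. indicator {0..s} r * h r) = s * expectation h"
    unfolding U_def using s by (subst integral_density) (auto simp: mult.commute)
  then have "abs_powr q (LINT r|lborel. indicator {0..s} r * h r)
      = ennreal (s powr q) * abs_powr q (expectation h)"
    using s by (simp add: abs_mult powr_mult ennreal_mult')
  also have "\<dots> \<le> ennreal (s powr q) * (\<integral>\<^sup>+r. abs_powr q (h r) \<partial>U)"
    using q by (intro mult_left_mono powr_abs_expectation_le) (auto simp: U_def)
  also have "(\<integral>\<^sup>+r. abs_powr q (h r) \<partial>U)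
      = (\<integral>\<^sup>+r. ennreal (1/s) * (indicator {0..s} r * abs_powr q (h r)) \<partial>lborel)"
    unfolding U_def by (subst nn_integral_density) (auto intro!: nn_integral_cong simp: indicator_def)
  also have "\<dots> = ennreal (1/s) * (\<integral>\<^sup>+r. indicator {0..s} r * abs_powr q (h r) \<partial>lborel)"
    by (rule nn_integral_cmult) auto
  also have "ennreal (s powr q) * (ennreal (1/s) * (\<integral>\<^sup>+r. indicator {0..s} r * abs_powr q (h r) \<partial>lborel))
      = ennreal (s powr q * (1/s)) * (\<integral>\<^sup>+r. indicator {0..s} r * abs_powr q (h r) \<partial>lborel)"
    using s by (simp add: mult.assoc[symmetric] flip: ennreal_mult)
  also have "s powr q * (1/s) = s powr (q - 1)" using s by (simp add: powr_diff)
  finally show ?thesis .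
qed

text \<open>
  The only information about a function and (the $q$-th power of the length of) its sub-gradient that is
  used from here on. The weight \<open>w\<close> is arbitrary so that the same inequality serves for indicators of
  balls in the local estimate and for the Gibbs weight in the tail estimate.
\<close>

definition line_bound :: "'n::finite \<Rightarrow> real \<Rightarrow> ('n heis \<Rightarrow> real) \<Rightarrow> ('n heis \<Rightarrow> ennreal) \<Rightarrow> bool" where
  "line_bound e q f \<gamma> \<longleftrightarrow> f \<in> borel_measurable borel \<and> \<gamma> \<in> borel_measurable borel \<and>
     (\<forall>i s w. 0 < s \<longrightarrow> w \<in> borel_measurable borel \<longrightarrow>
        (\<integral>\<^sup>+p. w p * abs_powr q (f (move e i s p) - f p) \<partial>lborel)
        \<le> ennreal (s powr (q - 1)) *
           (\<integral>\<^sup>+r. indicator {0..s} r * (\<integral>\<^sup>+p. w (move e i (- r) p) * \<gamma> p \<partial>lborel) \<partial>lborel))"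

lemma weak_subgradient_line_bound:
  fixes f :: "'n::finite heis \<Rightarrow> real" and g :: "'n heis \<Rightarrow> real ^ ('n + 'n)"
  assumes wsg: "weak_subgradient e f g" and q: "1 < q"
    and f[measurable]: "f \<in> borel_measurable borel" and g[measurable]: "g \<in> borel_measurable borel"
  shows "line_bound e q f (\<lambda>p. ennreal (norm (g p) powr q))"
  unfolding line_bound_def
proof (intro conjI allI impI)
  fix i and s :: real and w :: "'n heis \<Rightarrow> ennreal"
  assume s: "0 < s" and [measurable]: "w \<in> borel_measurable borel"
  have [measurable]: "(\<lambda>p. g p $ i) \<in> borel_measurable borel"
    using measurable_compose[OF g, of "\<lambda>x. x $ i" borel]
    by (auto intro!: borel_measurable_continuous_onI continuous_intros)
  let ?\<gamma> = "\<lambda>p. ennreal (norm (g p) powr q)"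
  have "AE p in lborel. f (move e i s p) - f p = (LINT r|lborel. indicator {0..s} r * g (move e i r p) $ i)"
    using s by (intro weak_subgradient_along_lines[OF wsg]) auto
  then have "AE p in lborel. w p * abs_powr q (f (move e i s p) - f p)
      \<le> ennreal (s powr (q - 1)) * (w p * (\<integral>\<^sup>+r. indicator {0..s} r * ?\<gamma> (move e i r p) \<partial>lborel))"
  proof eventually_elim
    case (elim p)
    have m: "(\<lambda>r. g (move e i r p) $ i) \<in> borel_measurable borel" by measurable
    have "abs_powr q (f (move e i s p) - f p)
        \<le> ennreal (s powr (q - 1)) * (\<integral>\<^sup>+r. indicator {0..s} r * abs_powr q (g (move e i r p) $ i) \<partial>lborel)"
      unfolding elim using powr_abs_interval_integral_le[OF q s m] .
    also have "\<dots> \<le> ennreal (s powr (q - 1)) * (\<integral>\<^sup>+r. indicator {0..s} r * ?\<gamma> (move e i r p) \<partial>lborel)"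
      using q by (intro mult_left_mono nn_integral_mono ennreal_leI powr_mono2 component_le_norm_cart) auto
    finally have "w p * abs_powr q (f (move e i s p) - f p)
      \<le> w p * (ennreal (s powr (q - 1)) * (\<integral>\<^sup>+r. indicator {0..s} r * ?\<gamma> (move e i r p) \<partial>lborel))"
      by (rule mult_left_mono) simp
    then show ?case by (simp only: mult.left_commute)
  qed
  then have "(\<integral>\<^sup>+p. w p * abs_powr q (f (move e i s p) - f p) \<partial>lborel)
      \<le> (\<integral>\<^sup>+p. ennreal (s powr (q - 1)) * (w p * (\<integral>\<^sup>+r. indicator {0..s} r * ?\<gamma> (move e i r p) \<partial>lborel)) \<partial>lborel)"
    by (rule nn_integral_mono_AE)
  also have "\<dots> = ennreal (s powr (q - 1)) * (\<integral>\<^sup>+p. w p * (\<integral>\<^sup>+r. indicator {0..s} r * ?\<gamma> (move e i r p) \<partial>lborel) \<partial>lborel)"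
    by (rule nn_integral_cmult) measurable
  also have "(\<integral>\<^sup>+p. w p * (\<integral>\<^sup>+r. indicator {0..s} r * ?\<gamma> (move e i r p) \<partial>lborel) \<partial>lborel)
      = (\<integral>\<^sup>+r. indicator {0..s} r * (\<integral>\<^sup>+p. w (move e i (- r) p) * ?\<gamma> p \<partial>lborel) \<partial>lborel)"
    by (rule nn_integral_along_lines) measurable
  finally show "(\<integral>\<^sup>+p. w p * abs_powr q (f (move e i s p) - f p) \<partial>lborel)
        \<le> ennreal (s powr (q - 1)) *
           (\<integral>\<^sup>+r. indicator {0..s} r * (\<integral>\<^sup>+p. w (move e i (- r) p) * ?\<gamma> p \<partial>lborel) \<partial>lborel)" .
qed measurable

lemma locally_integrable_imp_lebesgue_measurable:
  fixes h :: "'a::euclidean_space \<Rightarrow> 'b::euclidean_space"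
  assumes "\<And>K. compact K \<Longrightarrow> h absolutely_integrable_on K"
  shows "h \<in> borel_measurable lebesgue"
proof (rule borel_measurable_LIMSEQ_metric)
  show "(\<lambda>p. indicator (cball 0 (real m)) p *\<^sub>R h p) \<in> borel_measurable lebesgue" for m
    using assms[of "cball 0 (real m)"] unfolding set_integrable_def
    by (intro borel_measurable_integrable) simp
  show "(\<lambda>m. indicator (cball 0 (real m)) p *\<^sub>R h p) \<longlonglongrightarrow> h p" for p
  proof (rule tendsto_eventually)
    have "\<forall>\<^sub>F m in sequentially. norm p \<le> real m"
      using eventually_ge_at_top[of "nat \<lceil>norm p\<rceil>"] by eventually_elim linarith
    then show "\<forall>\<^sub>F m in sequentially. indicator (cball 0 (real m)) p *\<^sub>R h p = h p"
      by eventually_elim simp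
  qed
qed

text \<open>
  A Borel version is needed for compositions with moves to be jointly measurable in the point and the time.
\<close>

lemma lebesgue_measurable_borel_version:
  fixes h :: "'a::euclidean_space \<Rightarrow> real ^ 'i::finite"
  assumes h: "h \<in> borel_measurable lebesgue"
  shows "\<exists>h'\<in>borel_measurable borel. AE p in lborel. h p = h' p"
proof -
  have "\<exists>h'\<in>borel_measurable borel. AE p in lborel. h p $ i = h' p" for i
  proof -
    have "(\<lambda>p. h p $ i) \<in> borel_measurable lebesgue"
      using measurable_compose[OF h, of "\<lambda>x. x $ i" borel]
      by (auto intro!: borel_measurable_continuous_onI continuous_intros)
    from completion_ex_borel_measurable_real[OF this] show ?thesis by simp
  qed
  then have "\<forall>i. \<exists>h'. h' \<in> borel_measurable borel \<and> (AE p in lborel. h p $ i = h' p)" by blast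
  from choice[OF this] obtain H where H: "\<And>i. H i \<in> borel_measurable borel" "\<And>i. AE p in lborel. h p $ i = H i p"
    by blast
  have meas: "(\<lambda>p. \<chi> i. H i p) \<in> borel_measurable borel"
    by (rule borel_measurable_euclidean_space[THEN iffD2])
       (use H(1) in \<open>auto simp: Basis_vec_def inner_axis\<close>)
  have "AE p in lborel. \<forall>i\<in>UNIV. h p $ i = H i p"
    using H(2) by (intro AE_finite_allI) auto
  then have "AE p in lborel. h p = (\<chi> i. H i p)"
    by eventually_elim (simp add: vec_eq_iff)
  then show ?thesis using meas by (rule bexI)
qed

lemma weak_subgradient_cong_AE:
  fixes f f' :: "'n::finite heis \<Rightarrow> real" and g g' :: "'n heis \<Rightarrow> real ^ ('n + 'n)"
  assumes wsg: "weak_subgradient e f g"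
    and [measurable]: "f' \<in> borel_measurable borel" "g' \<in> borel_measurable borel"
    and ff: "AE p in lborel. f p = f' p" and gg: "AE p in lborel. g p = g' p"
  shows "weak_subgradient e f' g'"
proof -
  have f[measurable]: "f \<in> borel_measurable lebesgue" and g[measurable]: "g \<in> borel_measurable lebesgue"
    using wsg unfolding weak_subgradient_def by (auto intro: locally_integrable_imp_lebesgue_measurable)
  have f'[measurable]: "f' \<in> borel_measurable lebesgue" and g'[measurable]: "g' \<in> borel_measurable lebesgue"
    by (auto intro: measurable_completion)
  have ff': "AE p in lebesgue. f p = f' p" and gg': "AE p in lebesgue. g p = g' p"
    using ff gg by (auto intro: AE_completion)
  have comp: "(\<lambda>p. h p $ i) \<in> borel_measurable lebesgue" if "h \<in> borel_measurable lebesgue" for h :: "'n heis \<Rightarrow> real ^ ('n + 'n)" and i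
    using measurable_compose[OF that, of "\<lambda>x. x $ i" borel]
    by (auto intro!: borel_measurable_continuous_onI continuous_intros)
  have si: "h' absolutely_integrable_on K"
    if "h absolutely_integrable_on K" "h' \<in> borel_measurable lebesgue" "AE p in lebesgue. h p = h' p" "compact K"
    for h h' :: "'n heis \<Rightarrow> 'b::euclidean_space" and K
  proof -
    have "K \<in> sets lebesgue" using borel_compact[OF that(4)] by (intro sets_completionI_sets) simp
    then have "(\<lambda>x. indicat_real K x *\<^sub>R h' x) \<in> borel_measurable lebesgue" using that(2)
      by (intro borel_measurable_scaleR borel_measurable_indicator)
    moreover have "integrable lebesgue (\<lambda>x. indicat_real K x *\<^sub>R h x)" using that(1) by (simp add: set_integrable_def)
    moreover have "AE x in lebesgue. indicat_real K x *\<^sub>R h x = indicat_real K x *\<^sub>R h' x"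
      using that(3) by eventually_elim simp
    ultimately show ?thesis unfolding set_integrable_def by (blast intro: integrable_cong_AE_imp)
  qed
  have "(LINT p|lebesgue. f' p * frechet_derivative \<phi> (at p) (heis_field e i p)) = - (LINT p|lebesgue. g' p $ i * \<phi> p)"
    if \<phi>: "test_function \<phi>" for i \<phi>
  proof -
    have "(\<lambda>p. frechet_derivative \<phi> (at p) (heis_field e i p)) \<in> borel_measurable borel"
      by (rule heis_derivative_bounded[OF \<phi>, of e i])
    then have [measurable]: "(\<lambda>p. frechet_derivative \<phi> (at p) (heis_field e i p)) \<in> borel_measurable lebesgue"
      by (auto intro: measurable_completion)
    have [measurable]: "\<phi> \<in> borel_measurable lebesgue"
      using test_function_continuous[OF \<phi>] by (auto intro!: measurable_completion borel_measurable_continuous_onI)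
    have "(LINT p|lebesgue. f' p * frechet_derivative \<phi> (at p) (heis_field e i p)) = (LINT p|lebesgue. f p * frechet_derivative \<phi> (at p) (heis_field e i p))"
    proof (rule integral_cong_AE)
      show "AE p in lebesgue. f' p * frechet_derivative \<phi> (at p) (heis_field e i p)
          = f p * frechet_derivative \<phi> (at p) (heis_field e i p)"
        using ff' by eventually_elim simp
    qed measurable
    also have "\<dots> = - (LINT p|lebesgue. g p $ i * \<phi> p)"
      using wsg \<phi> unfolding weak_subgradient_def by blast
    also have "(LINT p|lebesgue. g p $ i * \<phi> p) = (LINT p|lebesgue. g' p $ i * \<phi> p)"
    proof (rule integral_cong_AE)
      show "AE p in lebesgue. g p $ i * \<phi> p = g' p $ i * \<phi> p" using gg' by eventually_elim simp
    qed (use comp[OF g] comp[OF g'] in measurable)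
    finally show ?thesis .
  qed
  moreover have "f' absolutely_integrable_on K" "g' absolutely_integrable_on K" if K: "compact K" for K
  proof -
    have "f absolutely_integrable_on K" "g absolutely_integrable_on K"
      using wsg K by (simp_all add: weak_subgradient_def)
    then show "f' absolutely_integrable_on K" "g' absolutely_integrable_on K"
      using K by (auto intro: si[OF _ f' ff'] si[OF _ g' gg'])
  qed
  ultimately show ?thesis unfolding weak_subgradient_def by simp
qed

section \<open>The local inequality\<close>

definition sympl :: "'n::finite \<Rightarrow> real ^ ('n + 'n) \<Rightarrow> real ^ ('n + 'n) \<Rightarrow> real" where
  "sympl e x y = (\<Sum>j\<in>UNIV. weight e j * (x $ Inl j * y $ Inr j - y $ Inl j * x $ Inr j))"

lemma heis_mult_eq: "heis_mult e p h = (fst p + fst h, snd p + snd h + sympl e (fst p) (fst h))"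
  by (simp add: heis_mult_def sympl_def)

lemma sympl_simps [simp]:
  "sympl e (x + x') y = sympl e x y + sympl e x' y"
  "sympl e x (y + y') = sympl e x y + sympl e x y'"
  "sympl e (c *\<^sub>R x) y = c * sympl e x y"
  "sympl e x (c *\<^sub>R y) = c * sympl e x y"
  "sympl e (- x) y = - sympl e x y"
  "sympl e x (- y) = - sympl e x y"
  "sympl e (x - x') y = sympl e x y - sympl e x' y"
  "sympl e x (y - y') = sympl e x y - sympl e x y'"
  "sympl e x x = 0"
  by (simp_all add: sympl_def sum_distrib_left algebra_simps flip: sum.distrib sum_negf sum_subtractf)

lemma continuous_sympl [continuous_intros]:
  "continuous_on S f \<Longrightarrow> continuous_on S g \<Longrightarrow> continuous_on S (\<lambda>x. sympl e (f x) (g x))"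
  unfolding sympl_def by (intro continuous_intros)

lemma heis_mult_assoc: "heis_mult e (heis_mult e p h) h' = heis_mult e p (heis_mult e h h')"
  by (simp add: heis_mult_eq algebra_simps)

lemma heis_mult_minus [simp]: "heis_mult e (- p) (heis_mult e p h) = h"
  by (simp add: heis_mult_eq prod_eq_iff)

lemma continuous_heis_mult [continuous_intros]:
  "continuous_on S f \<Longrightarrow> continuous_on S g \<Longrightarrow> continuous_on S (\<lambda>x. heis_mult e (f x) (g x))"
  unfolding heis_mult_eq by (intro continuous_intros)

lemma heis_mult_measurable [measurable (raw)]:
  assumes "f \<in> borel_measurable M" "g \<in> borel_measurable M"
  shows "(\<lambda>x. heis_mult e (f x) (g x)) \<in> borel_measurable M"
proof -
  have "(\<lambda>z. heis_mult e (fst z) (snd z)) \<in> borel_measurable (borel \<Otimes>\<^sub>M borel)"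
    unfolding borel_prod by (intro borel_measurable_continuous_onI continuous_intros)
  from measurable_compose[OF measurable_Pair[OF assms] this] show ?thesis by simp
qed

lemma nn_integral_heis_mult_right:
  assumes [measurable]: "F \<in> borel_measurable borel"
  shows "(\<integral>\<^sup>+p. F (heis_mult e p h) \<partial>lborel) = (\<integral>\<^sup>+p. F p \<partial>lborel)"
proof -
  have [measurable]: "(\<lambda>x. snd h + sympl e x (fst h)) \<in> borel_measurable borel"
    by (intro borel_measurable_continuous_onI continuous_intros)
  show ?thesis
    using nn_integral_shear[of F "\<lambda>x. snd h + sympl e x (fst h)" "fst h"]
    by (simp add: heis_mult_eq add.assoc add.commute[of "fst h"])
qed

lemma nn_integral_heis_mult_left:
  assumes [measurable]: "F \<in> borel_measurable borel"
  shows "(\<integral>\<^sup>+h. F (heis_mult e p h) \<partial>lborel) = (\<integral>\<^sup>+h. F h \<partial>lborel)"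
proof -
  have [measurable]: "(\<lambda>x. snd p + sympl e (fst p) x) \<in> borel_measurable borel"
    by (intro borel_measurable_continuous_onI continuous_intros)
  show ?thesis
    using nn_integral_shear[of F "\<lambda>x. snd p + sympl e (fst p) x" "fst p"]
    by (simp add: heis_mult_eq add.assoc add.left_commute)
qed

lemma heis_mult_bounded:
  assumes "bounded A" "bounded B"
  obtains \<rho> where "\<And>p h. p \<in> A \<Longrightarrow> h \<in> B \<Longrightarrow> norm (heis_mult e p h) \<le> \<rho>"
proof -
  define I where "I = (\<lambda>z. heis_mult e (fst z) (snd z)) ` (closure A \<times> closure B)"
  have "compact I" unfolding I_def using assms
    by (intro compact_continuous_image continuous_intros compact_Times) auto
  then have "bounded I" by (rule compact_imp_bounded)
  then obtain \<rho> where \<rho>: "\<And>y. y \<in> I \<Longrightarrow> norm y \<le> \<rho>" unfolding bounded_iff by blast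
  have "norm (heis_mult e p h) \<le> \<rho>" if "p \<in> A" "h \<in> B" for p h
    using that closure_subset[of A] closure_subset[of B]
    by (intro \<rho>) (auto simp: I_def intro!: image_eqI[of _ _ "(p, h)"])
  then show thesis by (rule that)
qed

lemma bounded_heis_mult:
  assumes "bounded A" "bounded B"
  shows "bounded ((\<lambda>(h1, h2). heis_mult e h1 h2) ` (A \<times> B))"
proof (rule heis_mult_bounded[OF assms])
  fix \<rho> assume "\<And>p h. p \<in> A \<Longrightarrow> h \<in> B \<Longrightarrow> norm (heis_mult e p h) \<le> \<rho>"
  then show ?thesis unfolding bounded_iff by (intro exI[of _ \<rho>]) auto
qed

lemma line_boundD:
  assumes "line_bound e q f \<gamma>" "0 < s" "w \<in> borel_measurable borel"
  shows "(\<integral>\<^sup>+p. w p * abs_powr q (f (move e i s p) - f p) \<partial>lborel)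
        \<le> ennreal (s powr (q - 1)) *
           (\<integral>\<^sup>+r. indicator {0..s} r * (\<integral>\<^sup>+p. w (move e i (- r) p) * \<gamma> p \<partial>lborel) \<partial>lborel)"
  using assms unfolding line_bound_def by blast

text \<open>
  The constant and the larger radius may depend on the set \<open>H\<close> and on the radius \<open>\<rho>\<close>, but not on the
  function. In this form the property passes to products in the group.
\<close>

definition increments_controlled :: "'n::finite \<Rightarrow> real \<Rightarrow> 'n heis set \<Rightarrow> bool" where
  "increments_controlled e q H \<longleftrightarrow> (\<forall>\<rho>. \<exists>C \<rho>'. 0 \<le> C \<and> (\<forall>f \<gamma> h. line_bound e q f \<gamma> \<longrightarrow> h \<in> H \<longrightarrow>
     (ball_integral \<rho> (\<lambda>p. abs_powr q (f (heis_mult e p h) - f p)))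
     \<le> ennreal C * (ball_integral \<rho>' \<gamma>)))"

lemma increments_controlled_subset:
  "increments_controlled e q H' \<Longrightarrow> H \<subseteq> H' \<Longrightarrow> increments_controlled e q H"
  unfolding increments_controlled_def by (meson subsetD)

text \<open>
  Telescoping: $f(p h_1 h_2) - f(p)$ splits at the intermediate point $p h_1$, and right translation by
  $h_1$ preserves the measure.
\<close>

lemma increments_controlled_mult:
  assumes q: "0 \<le> q" and H1: "increments_controlled e q H1" "bounded H1" and H2: "increments_controlled e q H2"
  shows "increments_controlled e q ((\<lambda>(h1, h2). heis_mult e h1 h2) ` (H1 \<times> H2))"
  unfolding increments_controlled_def
proof
  fix \<rho>
  obtain \<rho>1 where \<rho>1: "\<And>p h. p \<in> cball 0 \<rho> \<Longrightarrow> h \<in> H1 \<Longrightarrow> norm (heis_mult e p h) \<le> \<rho>1"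
    using heis_mult_bounded[OF bounded_cball H1(2)] by blast
  obtain C1 r1 where C1: "0 \<le> C1" "\<And>f \<gamma> h. line_bound e q f \<gamma> \<Longrightarrow> h \<in> H1 \<Longrightarrow>
     (ball_integral \<rho> (\<lambda>p. abs_powr q (f (heis_mult e p h) - f p)))
     \<le> ennreal C1 * (ball_integral r1 \<gamma>)"
    using H1(1)[unfolded increments_controlled_def, rule_format, of \<rho>] by blast
  obtain C2 r2 where C2: "0 \<le> C2" "\<And>f \<gamma> h. line_bound e q f \<gamma> \<Longrightarrow> h \<in> H2 \<Longrightarrow>
     (ball_integral \<rho>1 (\<lambda>p. abs_powr q (f (heis_mult e p h) - f p)))
     \<le> ennreal C2 * (ball_integral r2 \<gamma>)"
    using H2[unfolded increments_controlled_def, rule_format, of \<rho>1] by blast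
  let ?r = "max r1 r2" and ?C = "2 powr q * (C2 + C1)"
  have "(ball_integral \<rho> (\<lambda>p. abs_powr q (f (heis_mult e p (heis_mult e h1 h2)) - f p)))
     \<le> ennreal ?C * (ball_integral ?r \<gamma>)"
    if lb: "line_bound e q f \<gamma>" and h: "h1 \<in> H1" "h2 \<in> H2" for f \<gamma> h1 h2
  proof -
    have [measurable]: "f \<in> borel_measurable borel" "\<gamma> \<in> borel_measurable borel"
      using lb by (auto simp: line_bound_def)
    let ?G = "\<integral>\<^sup>+p. indicator (cball 0 ?r) p * \<gamma> p \<partial>lborel"
    let ?d2 = "\<lambda>p. indicator (cball 0 \<rho>1) p * abs_powr q (f (heis_mult e p h2) - f p)"
    let ?d1 = "\<lambda>p. indicator (cball 0 \<rho>) p * abs_powr q (f (heis_mult e p h1) - f p)"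
    have "(ball_integral \<rho> (\<lambda>p. abs_powr q (f (heis_mult e p (heis_mult e h1 h2)) - f p)))
      \<le> (\<integral>\<^sup>+p. ennreal (2 powr q) * (?d2 (heis_mult e p h1) + ?d1 p) \<partial>lborel)"
    proof (rule nn_integral_mono)
      fix p :: "'a heis"
      let ?p = "heis_mult e p h1"
      show "indicator (cball 0 \<rho>) p * abs_powr q (f (heis_mult e p (heis_mult e h1 h2)) - f p)
        \<le> ennreal (2 powr q) * (?d2 ?p + ?d1 p)"
      proof (cases "p \<in> cball 0 \<rho>")
        case True
        then have "norm ?p \<le> \<rho>1" using \<rho>1 h by blast
        moreover have "\<bar>f (heis_mult e p (heis_mult e h1 h2)) - f p\<bar> powr q
          \<le> 2 powr q * (\<bar>f (heis_mult e ?p h2) - f ?p\<bar> powr q + \<bar>f ?p - f p\<bar> powr q)"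
          using abs_add_powr_le[OF q, of "f (heis_mult e ?p h2) - f ?p" "f ?p - f p"]
          by (simp add: heis_mult_assoc)
        ultimately show ?thesis using True
          by (simp flip: ennreal_plus ennreal_mult')
      qed simp
    qed
    also have "\<dots> = ennreal (2 powr q) * ((\<integral>\<^sup>+p. ?d2 (heis_mult e p h1) \<partial>lborel) + (\<integral>\<^sup>+p. ?d1 p \<partial>lborel))"
      by (subst nn_integral_cmult, measurable, subst nn_integral_add) auto
    also have "(\<integral>\<^sup>+p. ?d2 (heis_mult e p h1) \<partial>lborel) = (\<integral>\<^sup>+p. ?d2 p \<partial>lborel)"
      by (rule nn_integral_heis_mult_right) measurable
    also have "ennreal (2 powr q) * ((\<integral>\<^sup>+p. ?d2 p \<partial>lborel) + (\<integral>\<^sup>+p. ?d1 p \<partial>lborel))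
        \<le> ennreal (2 powr q) * (ennreal C2 * ?G + ennreal C1 * ?G)"
    proof (intro mult_left_mono add_mono)
      have "(\<integral>\<^sup>+p. ?d2 p \<partial>lborel) \<le> ennreal C2 * (ball_integral r2 \<gamma>)"
        using C2(2)[OF lb h(2)] .
      also have "\<dots> \<le> ennreal C2 * ?G"
        by (intro mult_left_mono nn_integral_mono mult_right_mono) (auto simp: indicator_def)
      finally show "(\<integral>\<^sup>+p. ?d2 p \<partial>lborel) \<le> ennreal C2 * ?G" .
      have "(\<integral>\<^sup>+p. ?d1 p \<partial>lborel) \<le> ennreal C1 * (ball_integral r1 \<gamma>)"
        using C1(2)[OF lb h(1)] .
      also have "\<dots> \<le> ennreal C1 * ?G"
        by (intro mult_left_mono nn_integral_mono mult_right_mono) (auto simp: indicator_def)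
      finally show "(\<integral>\<^sup>+p. ?d1 p \<partial>lborel) \<le> ennreal C1 * ?G" .
    qed auto
    also have "\<dots> = ennreal ?C * ?G"
      using C1(1) C2(1) by (simp add: ennreal_mult distrib_right mult.assoc)
    finally show ?thesis .
  qed
  moreover have "0 \<le> ?C" using C1(1) C2(1) by simp
  ultimately show "\<exists>C \<rho>'. 0 \<le> C \<and> (\<forall>f \<gamma> h. line_bound e q f \<gamma> \<longrightarrow> h \<in> (\<lambda>(h1, h2). heis_mult e h1 h2) ` (H1 \<times> H2) \<longrightarrow>
     (ball_integral \<rho> (\<lambda>p. abs_powr q (f (heis_mult e p h) - f p)))
     \<le> ennreal C * (ball_integral \<rho>' \<gamma>))"
    by (intro exI[of _ ?C] exI[of _ ?r]) auto
qed

lemma increments_controlled_axis: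
  assumes q: "1 < q"
  shows "increments_controlled e q {(s *\<^sub>R axis i 1, 0) |s. \<bar>s\<bar> \<le> S}"
  unfolding increments_controlled_def
proof
  fix \<rho>
  obtain \<rho>' where \<rho>': "\<And>r p. \<bar>r\<bar> \<le> 2 * S \<Longrightarrow> p \<in> cball 0 \<rho> \<Longrightarrow> norm (move e i r p) \<le> \<rho>'"
    using move_bounded[OF bounded_cball] by blast
  let ?C = "\<bar>S\<bar> powr q"
  have pos: "(\<integral>\<^sup>+p. indicator (cball 0 \<rho>) (move e i a p) * abs_powr q (f (move e i s p) - f p) \<partial>lborel)
      \<le> ennreal ?C * (ball_integral \<rho>' \<gamma>)"
    if lb: "line_bound e q f \<gamma>" and s: "0 < s" "s \<le> S" and a: "\<bar>a\<bar> \<le> s" for f \<gamma> s a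
  proof -
    have [measurable]: "f \<in> borel_measurable borel" "\<gamma> \<in> borel_measurable borel"
      using lb by (auto simp: line_bound_def)
    let ?G = "\<integral>\<^sup>+p. indicator (cball 0 \<rho>') p * \<gamma> p \<partial>lborel"
    have "(\<integral>\<^sup>+p. indicator (cball 0 \<rho>) (move e i a p) * abs_powr q (f (move e i s p) - f p) \<partial>lborel)
        \<le> ennreal (s powr (q - 1)) *
           (\<integral>\<^sup>+r. indicator {0..s} r * (\<integral>\<^sup>+p. indicator (cball 0 \<rho>) (move e i a (move e i (- r) p)) * \<gamma> p \<partial>lborel) \<partial>lborel)"
      by (rule line_boundD[OF lb s(1)]) measurable
    also have "\<dots> \<le> ennreal (s powr (q - 1)) * (\<integral>\<^sup>+r. indicator {0..s} r * ?G \<partial>lborel)"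
    proof (rule mult_left_mono, rule nn_integral_mono)
      fix r :: real
      show "indicator {0..s} r * (\<integral>\<^sup>+p. indicator (cball 0 \<rho>) (move e i a (move e i (- r) p)) * \<gamma> p \<partial>lborel)
        \<le> indicator {0..s} r * ?G"
      proof (cases "r \<in> {0..s}")
        case True
        have "indicator (cball 0 \<rho>) (move e i a (move e i (- r) p)) \<le> (indicator (cball 0 \<rho>') p :: ennreal)" for p
          using \<rho>'[of "r - a" "move e i a (move e i (- r) p)"] True a s by (auto simp: indicator_def)
        then show ?thesis by (intro mult_left_mono nn_integral_mono mult_right_mono) auto
      qed simp
    qed simp
    also have "\<dots> = ennreal (s powr (q - 1)) * (ennreal s * ?G)"
      using s by (subst nn_integral_multc) auto
    also have "\<dots> = ennreal (s powr q) * ?G"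
      using s by (simp add: mult.assoc[symmetric] powr_mult_base flip: ennreal_mult) (simp add: mult.commute powr_mult_base)
    also have "\<dots> \<le> ennreal ?C * ?G"
      using s q by (intro mult_right_mono ennreal_leI powr_mono2) auto
    finally show ?thesis .
  qed
  have "(ball_integral \<rho> (\<lambda>p. abs_powr q (f (move e i s p) - f p)))
      \<le> ennreal ?C * (ball_integral \<rho>' \<gamma>)"
    if lb: "line_bound e q f \<gamma>" and s: "\<bar>s\<bar> \<le> S" for f \<gamma> s
  proof -
    have [measurable]: "f \<in> borel_measurable borel" using lb by (auto simp: line_bound_def)
    \<comment> \<open>A backward move is the forward move seen from its end point.\<close>
    consider "s = 0" | "s > 0" | "s < 0" by linarith
    then show ?thesis
    proof cases
      case 2
      then show ?thesis using pos[OF lb, of s 0] s by simp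
    next
      case 3
      have "(ball_integral \<rho> (\<lambda>p. abs_powr q (f (move e i s p) - f p)))
        = (\<integral>\<^sup>+p. indicator (cball 0 \<rho>) (move e i (- s) p) * abs_powr q (f (move e i s (move e i (- s) p)) - f (move e i (- s) p)) \<partial>lborel)"
        by (rule nn_integral_move[symmetric]) measurable
      also have "\<dots> = (\<integral>\<^sup>+p. indicator (cball 0 \<rho>) (move e i (- s) p) * abs_powr q (f (move e i (- s) p) - f p) \<partial>lborel)"
        by (simp add: abs_minus_commute)
      also have "\<dots> \<le> ennreal ?C * (ball_integral \<rho>' \<gamma>)"
        using pos[OF lb, of "-s" "-s"] s 3 by simp
      finally show ?thesis .
    qed simp
  qed
  then show "\<exists>C \<rho>'. 0 \<le> C \<and> (\<forall>f \<gamma> h. line_bound e q f \<gamma> \<longrightarrow> h \<in> {(s *\<^sub>R axis i 1, 0) |s. \<bar>s\<bar> \<le> S} \<longrightarrow>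
     (ball_integral \<rho> (\<lambda>p. abs_powr q (f (heis_mult e p h) - f p)))
     \<le> ennreal C * (ball_integral \<rho>' \<gamma>))"
    by (intro exI[of _ ?C] exI[of _ \<rho>']) (auto simp: heis_mult_axis move_def)
qed

lemma bounded_axis_segment: "bounded {(s *\<^sub>R axis i (1 :: real), 0 :: real) |s. \<bar>s\<bar> \<le> S}"
  unfolding bounded_iff by (intro exI[of _ S]) (auto simp: norm_Pair norm_axis_1)

text \<open>
  The horizontal directions generate the vertical one: the commutator of the translations by $1$ in
  direction \<open>Inl e\<close> and by $t$ in direction \<open>Inr e\<close> is the vertical translation by $t$.
\<close>

lemma increments_controlled_vertical:
  assumes q: "1 < q"
  shows "increments_controlled e q {(0, t) |t. \<bar>t\<bar> \<le> T}"
proof -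
  let ?m = "\<lambda>H1 H2. (\<lambda>(h1, h2). heis_mult e h1 h2) ` (H1 \<times> H2)"
  let ?X = "\<lambda>i. {(s *\<^sub>R axis i 1, 0 :: real) |s. \<bar>s\<bar> \<le> max 1 T}"
  let ?A = "?X (Inl e)" and ?B = "?X (Inr e)"
  have b: "bounded (?m ?A ?B)"
    by (intro bounded_heis_mult bounded_axis_segment)
  have AB: "increments_controlled e q (?m ?A ?B)"
    using q by (intro increments_controlled_mult increments_controlled_axis bounded_axis_segment) auto
  have "increments_controlled e q (?m (?m ?A ?B) (?m ?A ?B))"
    using q by (intro increments_controlled_mult AB b) auto
  moreover have "{(0, t) |t. \<bar>t\<bar> \<le> T} \<subseteq> ?m (?m ?A ?B) (?m ?A ?B)"
  proof clarify
    fix t :: real assume t: "\<bar>t\<bar> \<le> T"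
    have *: "sympl e (axis (Inl e) 1) (axis (Inr e) 1) = 1/2" "sympl e (axis (Inr e) 1) (axis (Inl e) 1) = - 1/2"
    proof -
      have "sympl e (axis (Inl e) 1) (axis (Inr e) 1) = (\<Sum>j\<in>UNIV. if j = e then 1/2 else 0)"
        unfolding sympl_def by (intro sum.cong) (auto simp: axis_def weight_def)
      moreover have "sympl e (axis (Inr e) 1) (axis (Inl e) 1) = (\<Sum>j\<in>UNIV. if j = e then - 1/2 else 0)"
        unfolding sympl_def by (intro sum.cong) (auto simp: axis_def weight_def)
      ultimately show "sympl e (axis (Inl e) 1) (axis (Inr e) 1) = 1/2" "sympl e (axis (Inr e) 1) (axis (Inl e) 1) = - 1/2"
        by simp_all
    qed
    \<comment> \<open>The weight 1/2 of the distinguished pair enters twice, so the commutator has height exactly \<open>t\<close>.\<close>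
    let ?h1 = "heis_mult e (1 *\<^sub>R axis (Inl e) 1, 0) (t *\<^sub>R axis (Inr e) 1, 0)"
    let ?h2 = "heis_mult e ((-1) *\<^sub>R axis (Inl e) 1, 0) ((-t) *\<^sub>R axis (Inr e) 1, 0)"
    have "(0, t) = heis_mult e ?h1 ?h2"
      by (simp add: heis_mult_eq *)
    moreover have X: "(c *\<^sub>R axis i 1, 0) \<in> ?X i" if "\<bar>c\<bar> \<le> max 1 T" for c and i :: "'a + 'a"
      using that by blast
    have "?h1 \<in> ?m ?A ?B"
      by (rule image_eqI[OF _ SigmaI[OF X[of 1 "Inl e"] X[of t "Inr e"]]]) (use t in simp_all)
    moreover have "?h2 \<in> ?m ?A ?B"
      by (rule image_eqI[OF _ SigmaI[OF X[of "-1" "Inl e"] X[of "-t" "Inr e"]]]) (use t in simp_all)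
    ultimately show "(0, t) \<in> ?m (?m ?A ?B) (?m ?A ?B)"
      by (intro image_eqI[of _ _ "(?h1, ?h2)"]) auto
  qed
  ultimately show ?thesis by (rule increments_controlled_subset)
qed

text \<open>
  Coordinates are removed one at a time by a move along the axis; what is left at the end is vertical.
\<close>

lemma increments_controlled_cball:
  fixes e :: "'n::finite"
  assumes q: "1 < q"
  shows "increments_controlled e q (cball 0 r)"
proof -
  let ?S = "\<lambda>I r. {h :: 'n heis. norm h \<le> r \<and> (\<forall>i. i \<notin> I \<longrightarrow> fst h $ i = 0)}"
  have "increments_controlled e q (?S I r)" for I r
    using finite[of I]
  proof (induction I arbitrary: r rule: finite_induct)
    case empty
    have "?S {} r \<subseteq> {(0, t) |t. \<bar>t\<bar> \<le> r}"
    proof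
      fix h assume "h \<in> ?S {} r"
      then have "fst h = 0" "norm h \<le> r" by (auto simp: vec_eq_iff)
      moreover from this have "\<bar>snd h\<bar> \<le> r" by (cases h) (simp add: norm_Pair)
      ultimately show "h \<in> {(0, t) |t. \<bar>t\<bar> \<le> r}" by (cases h) auto
    qed
    then show ?case using increments_controlled_vertical[OF q] increments_controlled_subset by blast
  next
    case (insert i I)
    obtain r' where r': "\<And>s h. \<bar>s\<bar> \<le> r \<Longrightarrow> h \<in> cball 0 r \<Longrightarrow> norm (move e i s h) \<le> r'"
      using move_bounded[OF bounded_cball] by blast
    let ?A = "{(s *\<^sub>R axis i 1, 0 :: real) |s. \<bar>s\<bar> \<le> r}"
    let ?M = "(\<lambda>(h1, h2). heis_mult e h1 h2) ` (?S I r' \<times> ?A)"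
    have "increments_controlled e q ?M"
    proof (intro increments_controlled_mult insert.IH increments_controlled_axis q)
      show "bounded (?S I r')" unfolding bounded_iff by blast
    qed (use q in auto)
    moreover have "?S (insert i I) r \<subseteq> ?M"
    proof
      fix h assume h: "h \<in> ?S (insert i I) r"
      define c where "c = fst h $ i"
      have c: "\<bar>c\<bar> \<le> r"
        using component_le_norm_cart[of "fst h" i] norm_fst_le[of "fst h" "snd h"] h by (simp add: c_def)
      let ?h = "move e i (- c) h"
      have "h = heis_mult e ?h (c *\<^sub>R axis i 1, 0)"
        unfolding heis_mult_axis move_def[symmetric] by simp
      moreover have "?h \<in> ?S I r'"
        using r'[of "- c" h] c h by (auto simp: move_eq c_def axis_def)
      ultimately show "h \<in> ?M" using c by (intro image_eqI[of _ _ "(?h, (c *\<^sub>R axis i 1, 0))"]) auto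
    qed
    ultimately show ?case by (rule increments_controlled_subset)
  qed
  from this[where I=UNIV and r=r] show ?thesis by (rule increments_controlled_subset) auto
qed

text \<open>
  This picks the constant of the local inequality: a suitable value of the function does as well as its mean.
\<close>

lemma exists_point_below_average:
  assumes [measurable]: "a \<in> borel_measurable M" "K \<in> sets M"
    and K: "emeasure M K \<noteq> 0" "emeasure M K \<noteq> \<infinity>"
  shows "\<exists>p\<in>K. a p * emeasure M K \<le> (\<integral>\<^sup>+x. indicator K x * a x \<partial>M)"
proof (rule ccontr)
  let ?T = "\<integral>\<^sup>+x. indicator K x * a x \<partial>M"
  assume "\<not> (\<exists>p\<in>K. a p * emeasure M K \<le> ?T)"
  then have less: "\<And>p. p \<in> K \<Longrightarrow> ?T < a p * emeasure M K" by (auto simp: not_le)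
  have "K \<noteq> {}" using K(1) by auto
  then have fin: "?T < \<infinity>" using less by (metis ex_in_conv infinity_ennreal_def less_top not_less_iff_gr_or_eq top.not_eq_extremum)
  have "(\<integral>\<^sup>+x. ?T * indicator K x \<partial>M) < (\<integral>\<^sup>+x. (indicator K x * a x) * emeasure M K \<partial>M)"
  proof (rule nn_integral_less)
    show "(\<integral>\<^sup>+x. ?T * indicator K x \<partial>M) \<noteq> \<infinity>"
      using fin K(2) by (simp add: nn_integral_cmult_indicator ennreal_mult_eq_top_iff less_top[symmetric])
    show "AE x in M. ?T * indicator K x \<le> indicator K x * a x * emeasure M K"
      using less by (intro AE_I2) (auto simp: indicator_def intro: less_imp_le)
    show "\<not> (AE x in M. indicator K x * a x * emeasure M K \<le> ?T * indicator K x)"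
    proof
      assume "AE x in M. indicator K x * a x * emeasure M K \<le> ?T * indicator K x"
      then have "AE x in M. x \<notin> K"
        by eventually_elim (use less in \<open>fastforce simp: indicator_def not_le[symmetric]\<close>)
      then have "emeasure M K = 0" by (subst (asm) AE_iff_measurable[of K]) (use sets.sets_into_space[OF assms(2)] in auto)
      with K(1) show False by simp
    qed
  qed measurable
  then show False by (simp add: nn_integral_cmult_indicator nn_integral_multc)
qed

text \<open>
  Write a pair of points of the ball as $p$ and $p h$; then $h$ stays bounded, and left translation by $p$
  preserves the measure, so the double integral over the ball is an average of increments
  $f(p h) - f(p)$ over bounded $h$.
\<close>

lemma local_poincare:
  fixes e :: "'n::finite"
  assumes q: "1 < q" and \<rho>: "0 < \<rho>"
  obtains C \<rho>' where "0 \<le> C" "\<And>f \<gamma>. line_bound e q f \<gamma> \<Longrightarrow>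
    \<exists>m. (ball_integral \<rho> (\<lambda>p. abs_powr q (f p - m)))
        \<le> ennreal C * (ball_integral \<rho>' \<gamma>)"
proof -
  let ?K = "cball 0 \<rho> :: 'n heis set"
  obtain r where r: "\<And>p h. p \<in> uminus ` ?K \<Longrightarrow> h \<in> ?K \<Longrightarrow> norm (heis_mult e p h) \<le> r"
    using heis_mult_bounded[of "uminus ` ?K" ?K] by (metis bounded_cball bounded_uminus)
  obtain C \<rho>' where C: "0 \<le> C" "\<And>f \<gamma> h. line_bound e q f \<gamma> \<Longrightarrow> h \<in> cball 0 r \<Longrightarrow>
     (\<integral>\<^sup>+p. indicator ?K p * abs_powr q (f (heis_mult e p h) - f p) \<partial>lborel)
     \<le> ennreal C * (ball_integral \<rho>' \<gamma>)"
    using increments_controlled_cball[OF q, of e r] unfolding increments_controlled_def by meson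
  define k where "k = measure lborel ?K"
  have k: "emeasure lborel ?K = ennreal k" "0 < k"
    using \<rho> content_cball_pos[of \<rho> "0 :: 'n heis"] emeasure_lborel_cball_finite[of "0 :: 'n heis" \<rho>]
    by (auto simp: k_def emeasure_eq_ennreal_measure)
  define v where "v = measure lborel (cball (0 :: 'n heis) r)"
  have v: "emeasure lborel (cball (0 :: 'n heis) r) = ennreal v" "0 \<le> v"
    using emeasure_lborel_cball_finite[of "0 :: 'n heis" r]
    by (auto simp: v_def emeasure_eq_ennreal_measure)
  have "\<exists>m. (\<integral>\<^sup>+p. indicator ?K p * abs_powr q (f p - m) \<partial>lborel)
        \<le> ennreal (v * C / k) * (ball_integral \<rho>' \<gamma>)"
    if lb: "line_bound e q f \<gamma>" for f \<gamma>
  proof -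
    have [measurable]: "f \<in> borel_measurable borel" using lb by (auto simp: line_bound_def)
    let ?G = "\<integral>\<^sup>+p. indicator (cball 0 \<rho>') p * \<gamma> p \<partial>lborel"
    let ?d = "\<lambda>p p'. abs_powr q (f p - f p')"
    let ?a = "\<lambda>p'. \<integral>\<^sup>+p. indicator ?K p * ?d p p' \<partial>lborel"
    have "(\<integral>\<^sup>+p'. indicator ?K p' * ?a p' \<partial>lborel) = (\<integral>\<^sup>+p'. \<integral>\<^sup>+p. indicator ?K p' * (indicator ?K p * ?d p p') \<partial>lborel \<partial>lborel)"
      by (intro nn_integral_cong nn_integral_cmult[symmetric]) measurable
    also have "\<dots> = (\<integral>\<^sup>+p. \<integral>\<^sup>+p'. indicator ?K p' * (indicator ?K p * ?d p p') \<partial>lborel \<partial>lborel)"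
      by (rule lborel_pair.Fubini'[symmetric]) measurable
    also have "\<dots> = (\<integral>\<^sup>+p. \<integral>\<^sup>+h. indicator ?K (heis_mult e p h) * (indicator ?K p * ?d p (heis_mult e p h)) \<partial>lborel \<partial>lborel)"
      by (intro nn_integral_cong nn_integral_heis_mult_left[symmetric]) measurable
    also have "\<dots> \<le> (\<integral>\<^sup>+p. \<integral>\<^sup>+h. indicator (cball 0 r) h * (indicator ?K p * ?d (heis_mult e p h) p) \<partial>lborel \<partial>lborel)"
    proof (rule nn_integral_mono, rule nn_integral_mono)
      fix p h :: "'n heis"
      show "indicator ?K (heis_mult e p h) * (indicator ?K p * ?d p (heis_mult e p h))
         \<le> indicator (cball 0 r) h * (indicator ?K p * ?d (heis_mult e p h) p)"
        using r[of "- p" "heis_mult e p h"] by (auto simp: indicator_def abs_minus_commute)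
    qed
    also have "\<dots> = (\<integral>\<^sup>+h. \<integral>\<^sup>+p. indicator (cball 0 r) h * (indicator ?K p * ?d (heis_mult e p h) p) \<partial>lborel \<partial>lborel)"
      by (rule lborel_pair.Fubini'[symmetric]) measurable
    also have "\<dots> = (\<integral>\<^sup>+h. indicator (cball 0 r) h * (\<integral>\<^sup>+p. indicator ?K p * ?d (heis_mult e p h) p \<partial>lborel) \<partial>lborel)"
      by (intro nn_integral_cong nn_integral_cmult) measurable
    also have "\<dots> \<le> (\<integral>\<^sup>+h. indicator (cball (0 :: 'n heis) r) h * (ennreal C * ?G) \<partial>lborel)"
    proof (rule nn_integral_mono)
      fix h :: "'n heis"
      show "indicator (cball 0 r) h * (\<integral>\<^sup>+p. indicator ?K p * ?d (heis_mult e p h) p \<partial>lborel)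
          \<le> indicator (cball 0 r) h * (ennreal C * ?G)"
        using C(2)[OF lb, of h] by (cases "h \<in> cball 0 r") auto
    qed
    also have "\<dots> = ennreal v * (ennreal C * ?G)"
      by (subst nn_integral_multc) (auto simp: v)
    finally have total: "(\<integral>\<^sup>+p'. indicator ?K p' * ?a p' \<partial>lborel) \<le> ennreal v * (ennreal C * ?G)" .
    have "\<exists>p'\<in>?K. ?a p' * emeasure lborel ?K \<le> (\<integral>\<^sup>+p'. indicator ?K p' * ?a p' \<partial>lborel)"
      by (rule exists_point_below_average) (use k in auto)
    \<comment> \<open>The value of \<open>f\<close> at such a point serves as the constant.\<close>
    then obtain p' where "?a p' * ennreal k \<le> ennreal v * (ennreal C * ?G)"
      using total k(1) by (auto intro: order_trans)
    then have "ennreal (1/k) * (?a p' * ennreal k) \<le> ennreal (1/k) * (ennreal v * (ennreal C * ?G))"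
      by (rule mult_left_mono) simp
    moreover have "ennreal (1/k) * (?a p' * ennreal k) = ?a p'"
      using k(2) by (simp add: mult.left_commute[of _ "?a p'"] flip: ennreal_mult)
    moreover have "ennreal (1/k) * (ennreal v * (ennreal C * ?G)) = ennreal (v * C / k) * ?G"
      using k(2) v(2) C(1) by (simp add: mult.assoc[symmetric] flip: ennreal_mult)
    ultimately show ?thesis by (intro exI[of _ "f p'"]) simp
  qed
  moreover have "0 \<le> v * C / k" using k v C by simp
  ultimately show thesis by (rule that[rotated])
qed

section \<open>Integration by parts against a weight\<close>

text \<open>
  The factor \<open>indicator (cball 0 \<rho>)\<close> encodes the bounded support of \<open>F\<close>; the restriction to $s \le 1$ keeps the
  translated supports in one ball.
\<close>

definition lipschitz_along :: "'n::finite \<Rightarrow> 'n + 'n \<Rightarrow> ('n heis \<Rightarrow> real) \<Rightarrow> bool" where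
  "lipschitz_along e i F \<longleftrightarrow> (\<exists>C \<rho>. 0 \<le> C \<and>
     (\<forall>s p. 0 \<le> s \<longrightarrow> s \<le> 1 \<longrightarrow> \<bar>F (move e i (- s) p) - F p\<bar> \<le> C * s * indicator (cball 0 \<rho>) p))"

lemma lipschitz_alongI:
  assumes deriv: "\<And>p. ((\<lambda>s. F (move e i s p)) has_real_derivative d p) (at 0)"
    and d: "\<And>p. \<bar>d p\<bar> \<le> C" and supp: "bounded {p. F p \<noteq> 0}"
  shows "lipschitz_along e i F"
proof -
  obtain \<rho> where \<rho>: "\<And>s p. \<bar>s\<bar> \<le> 1 \<Longrightarrow> F p \<noteq> 0 \<Longrightarrow> norm (move e i s p) \<le> \<rho>"
    using move_bounded[OF supp] by blast
  have C: "0 \<le> C" using d[of 0] by linarith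
  have "\<bar>F (move e i (- s) p) - F p\<bar> \<le> C * s * indicator (cball 0 \<rho>) p" if s: "0 \<le> s" "s \<le> 1" for s p
  proof (cases "p \<in> cball 0 \<rho>")
    case True
    have "((\<lambda>s. F (move e i s p)) has_real_derivative d (move e i r p)) (at r)" for r
    proof -
      have "((\<lambda>s. F (move e i (s + r) p)) has_real_derivative d (move e i r p)) (at 0)"
        using deriv[of "move e i r p"] by (simp add: add.commute)
      then show ?thesis using DERIV_at_within_shift[of "\<lambda>s. F (move e i s p)" "d (move e i r p)" r 0 UNIV]
        by (simp add: add.commute)
    qed
    then have "norm (F (move e i (- s) p) - F (move e i 0 p)) \<le> C * norm (- s - 0)"
      by (intro field_differentiable_bound[of UNIV]) (auto simp: d)
    then show ?thesis using True s by simp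
  next
    case False
    have "F p = 0" using \<rho>[of 0 p] False by auto
    moreover have "F (move e i (- s) p) = 0" using \<rho>[of s "move e i (- s) p"] False s by auto
    ultimately show ?thesis using C s by simp
  qed
  then show ?thesis unfolding lipschitz_along_def using C by blast
qed

lemma integrable_bounded_support:
  fixes F :: "'a::euclidean_space \<Rightarrow> real"
  assumes [measurable]: "F \<in> borel_measurable borel" and F: "\<And>p. \<bar>F p\<bar> \<le> C * indicator (cball 0 \<rho>) p"
  shows "integrable lborel F"
proof (rule Bochner_Integration.integrable_bound)
  show "integrable lborel (\<lambda>p. C * indicator (cball 0 \<rho> :: 'a set) p)"
    using emeasure_lborel_cball_finite[of "0 :: 'a" \<rho>] by (intro integrable_mult_right) (simp add: integrable_indicator_iff)
  show "AE p in lborel. norm (F p) \<le> norm (C * indicator (cball 0 \<rho>) p)"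
    using F by (auto intro!: AE_I2 intro: order_trans[OF _ abs_ge_self])
qed measurable

lemma integrable_if_bounded_on_bounded_support:
  fixes F :: "'a::euclidean_space \<Rightarrow> real"
  assumes [measurable]: "F \<in> borel_measurable borel" and F: "\<And>p. \<bar>F p\<bar> \<le> C" "\<And>p. F p \<noteq> 0 \<Longrightarrow> norm p \<le> \<rho>"
  shows "integrable lborel F"
proof (rule integrable_bounded_support)
  show "\<bar>F p\<bar> \<le> \<bar>C\<bar> * indicator (cball 0 \<rho>) p" for p
    using F(1)[of p] F(2)[of p] by (cases "F p = 0") auto
qed fact

text \<open>
  Translating the weight by $s$ costs $O(s)$, because \<open>h\<close> is integrable on balls. This replaces continuity
  of translations in $L^1$ in the limit below.
\<close>

lemma lipschitz_nn_integral_le: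
  fixes W :: "'n::finite heis \<Rightarrow> real" and h :: "'n heis \<Rightarrow> ennreal"
  assumes lip: "lipschitz_along e i W" and [measurable]: "W \<in> borel_measurable borel" "h \<in> borel_measurable borel"
    and W: "\<And>p. 0 \<le> W p" and h: "\<And>\<rho>. (ball_integral \<rho> h) < \<infinity>"
  obtains E where "0 \<le> E" "\<And>s. 0 \<le> s \<Longrightarrow> s \<le> 1 \<Longrightarrow>
    (\<integral>\<^sup>+p. ennreal (W (move e i (- s) p)) * h p \<partial>lborel) \<le> (\<integral>\<^sup>+p. ennreal (W p) * h p \<partial>lborel) + ennreal (s * E)"
proof -
  obtain C \<rho> where C: "0 \<le> C" "\<And>s p. 0 \<le> s \<Longrightarrow> s \<le> 1 \<Longrightarrow>
      \<bar>W (move e i (- s) p) - W p\<bar> \<le> C * s * indicator (cball 0 \<rho>) p"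
    using lip unfolding lipschitz_along_def by blast
  define \<Gamma> where "\<Gamma> = enn2real (ball_integral \<rho> h)"
  have \<Gamma>: "0 \<le> \<Gamma>" "(ball_integral \<rho> h) = ennreal \<Gamma>"
    using h[of \<rho>] by (auto simp: \<Gamma>_def)
  have "(\<integral>\<^sup>+p. ennreal (W (move e i (- s) p)) * h p \<partial>lborel) \<le> (\<integral>\<^sup>+p. ennreal (W p) * h p \<partial>lborel) + ennreal (s * (C * \<Gamma>))"
    if s: "0 \<le> s" "s \<le> 1" for s
  proof -
    have "(\<integral>\<^sup>+p. ennreal (W (move e i (- s) p)) * h p \<partial>lborel)
        \<le> (\<integral>\<^sup>+p. ennreal (W p) * h p + ennreal (C * s) * (indicator (cball 0 \<rho>) p * h p) \<partial>lborel)"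
    proof (rule nn_integral_mono)
      fix p :: "'n heis"
      have "W (move e i (- s) p) \<le> W p + C * s * indicator (cball 0 \<rho>) p"
        using C(2)[OF s, of p] by linarith
      then have "ennreal (W (move e i (- s) p)) \<le> ennreal (W p) + ennreal (C * s) * indicator (cball 0 \<rho>) p"
        using W[of p] C(1) s by (auto simp: indicator_def simp flip: ennreal_plus intro!: ennreal_leI)
      from mult_right_mono[OF this, of "h p"]
      show "ennreal (W (move e i (- s) p)) * h p \<le> ennreal (W p) * h p + ennreal (C * s) * (indicator (cball 0 \<rho>) p * h p)"
        by (simp add: distrib_right mult.assoc)
    qed
    also have "\<dots> = (\<integral>\<^sup>+p. ennreal (W p) * h p \<partial>lborel) + ennreal (C * s) * ennreal \<Gamma>"
      by (subst nn_integral_add, measurable, subst nn_integral_cmult) (auto simp: \<Gamma>)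
    also have "ennreal (C * s) * ennreal \<Gamma> = ennreal (s * (C * \<Gamma>))"
      using C(1) s \<Gamma>(1) by (simp add: mult_ac flip: ennreal_mult)
    finally show ?thesis .
  qed
  moreover have "0 \<le> C * \<Gamma>" using C(1) \<Gamma>(1) by simp
  ultimately show thesis by (rule that[rotated])
qed

text \<open>
  The integration by parts of the tail estimate for one field $X_i$, with \<open>\<psi>\<close> the weighted coefficient
  $y_i \omega(V)$ and \<open>d\<close> its derivative along $X_i$. By invariance of the measure,
  $$\int |u|^q\, \frac{\psi \circ \mathrm{flow}_{-s} - \psi}{s} = \int \frac{|u \circ \mathrm{flow}_s|^q - |u|^q}{s}\, \psi ,$$
  and the left-hand side tends to $- \int |u|^q d$. On the right, the hypothesis \<open>young\<close> is applied before
  the limit, so that only powers of $|u|$ and of the increments occur and no differentiability of \<open>u\<close>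
  is required.
\<close>

lemma integration_by_parts_bound:
  fixes u :: "'n::finite heis \<Rightarrow> real" and w W \<psi> d :: "'n heis \<Rightarrow> real"
  assumes q: "1 < q" and lb: "line_bound e q u \<gamma>" and M: "\<And>p. \<bar>u p\<bar> \<le> M"
    and \<gamma>: "\<And>\<rho>. (ball_integral \<rho> \<gamma>) < \<infinity>"
    and meas[measurable]: "w \<in> borel_measurable borel" "W \<in> borel_measurable borel"
      "\<psi> \<in> borel_measurable borel" "d \<in> borel_measurable borel"
    and nonneg: "\<And>p. 0 \<le> w p" "\<And>p. 0 \<le> W p"
    and lip: "lipschitz_along e i w" "lipschitz_along e i W" "lipschitz_along e i \<psi>"
    and \<psi>: "\<And>p. \<bar>\<psi> p\<bar> \<le> B" "bounded {p. \<psi> p \<noteq> 0}"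
    and deriv: "\<And>p. ((\<lambda>s. \<psi> (move e i s p)) has_real_derivative d p) (at 0)"
    and \<delta>C: "0 \<le> \<delta>" "0 \<le> C"
    and young: "\<And>p x z. 0 \<le> x \<Longrightarrow> 0 \<le> z \<Longrightarrow>
      q * x powr (q - 1) * \<bar>\<psi> p\<bar> * z \<le> \<delta> * W p * x powr q + C * w p * z powr q"
    and a: "0 \<le> a" "(\<integral>\<^sup>+p. ennreal (W p) * abs_powr q (u p) \<partial>lborel) \<le> ennreal a"
    and g: "0 \<le> g" "(\<integral>\<^sup>+p. ennreal (w p) * \<gamma> p \<partial>lborel) \<le> ennreal g"
  shows "\<bar>LINT p|lborel. \<bar>u p\<bar> powr q * d p\<bar> \<le> 2 * \<delta> * a + C * g"
proof -
  have [measurable]: "u \<in> borel_measurable borel" "\<gamma> \<in> borel_measurable borel"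
    using lb by (auto simp: line_bound_def)
  define H where "H p = \<bar>u p\<bar> powr q" for p
  have [measurable]: "H \<in> borel_measurable borel" unfolding H_def by measurable
  have H: "0 \<le> H p" "H p \<le> M powr q" for p using M[of p] q by (auto simp: H_def intro!: powr_mono2)
  have M0: "0 \<le> M" using M[of 0] by linarith
  have H_loc: "(ball_integral \<rho> (\<lambda>p. ennreal (H p))) < \<infinity>" for \<rho>
  proof -
    have "(ball_integral \<rho> (\<lambda>p. ennreal (H p)))
        \<le> (\<integral>\<^sup>+p. ennreal (M powr q) * indicator (cball (0 :: 'n heis) \<rho>) p \<partial>lborel)"
      using H by (intro nn_integral_mono) (auto simp: indicator_def intro!: ennreal_leI)
    also have "\<dots> < \<infinity>"
      using emeasure_lborel_cball_finite[of "0 :: 'n heis" \<rho>]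
      by (subst nn_integral_cmult_indicator) (auto simp: ennreal_mult_less_top)
    finally show ?thesis .
  qed
  obtain E1 where E1: "0 \<le> E1" "\<And>s. 0 \<le> s \<Longrightarrow> s \<le> 1 \<Longrightarrow>
    (\<integral>\<^sup>+p. ennreal (W (move e i (- s) p)) * ennreal (H p) \<partial>lborel)
      \<le> (\<integral>\<^sup>+p. ennreal (W p) * ennreal (H p) \<partial>lborel) + ennreal (s * E1)"
    by (rule lipschitz_nn_integral_le[OF lip(2), of "\<lambda>p. ennreal (H p)"]) (use nonneg H_loc in auto)
  obtain E2 where E2: "0 \<le> E2" "\<And>s. 0 \<le> s \<Longrightarrow> s \<le> 1 \<Longrightarrow>
    (\<integral>\<^sup>+p. ennreal (w (move e i (- s) p)) * \<gamma> p \<partial>lborel) \<le> (\<integral>\<^sup>+p. ennreal (w p) * \<gamma> p \<partial>lborel) + ennreal (s * E2)"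
    by (rule lipschitz_nn_integral_le[OF lip(1), of \<gamma>]) (use nonneg \<gamma> in auto)
  define E where "E = \<delta> * E1 + C * E2"
  define I where "I s = (LINT p|lborel. H p * ((\<psi> (move e i (- s) p) - \<psi> p) / s))" for s
  have intH: "integrable lborel (\<lambda>p. H p * \<psi> (move e i r p))" for r
  proof -
    obtain \<rho> where \<rho>: "\<And>r' p. \<bar>r'\<bar> \<le> \<bar>r\<bar> \<Longrightarrow> \<psi> p \<noteq> 0 \<Longrightarrow> norm (move e i r' p) \<le> \<rho>"
      using move_bounded[OF \<psi>(2)] by blast
    have "\<bar>H p * \<psi> (move e i r p)\<bar> \<le> (M powr q * B) * indicator (cball 0 \<rho>) p" for p
    proof (cases "\<psi> (move e i r p) = 0")
      case True
      have "0 \<le> B" using \<psi>(1)[of 0] by linarith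
      with True show ?thesis by simp
    next
      case False
      then have "norm p \<le> \<rho>" using \<rho>[of "-r" "move e i r p"] by simp
      then show ?thesis using H[of p] \<psi>(1)[of "move e i r p"] by (auto simp: abs_mult intro!: mult_mono)
    qed
    then show ?thesis by (intro integrable_bounded_support) auto
  qed
  \<comment> \<open>For positive \<open>s\<close> the estimate holds up to the error \<open>s * E\<close>, the cost of translating the two weights.\<close>
  have I_bound: "\<bar>I s\<bar> \<le> 2 * \<delta> * a + C * g + s * E" if s: "0 < s" "s \<le> 1" for s
  proof -
    let ?D = "\<lambda>p. (H (move e i s p) - H p) / s * \<psi> p"
    have i1: "integrable lborel (\<lambda>p. H (move e i s p) * \<psi> p)"
      using integrable_move[OF intH[of "-s"], of e i s] by simp
    have "I s = (LINT p|lborel. H p * \<psi> (move e i (- s) p) / s - H p * \<psi> p / s)"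
      unfolding I_def by (simp add: diff_divide_distrib right_diff_distrib)
    also have "\<dots> = (LINT p|lborel. H p * \<psi> (move e i (- s) p) / s) - (LINT p|lborel. H p * \<psi> p / s)"
      using intH[of "-s"] intH[of 0] by (intro Bochner_Integration.integral_diff) auto
    also have "(LINT p|lborel. H p * \<psi> (move e i (- s) p) / s) = (LINT p|lborel. H (move e i s p) * \<psi> p / s)"
      using integral_move[of "\<lambda>p. H p * \<psi> (move e i (- s) p) / s" e i s, symmetric] by simp
    also have "\<dots> - (LINT p|lborel. H p * \<psi> p / s) = (LINT p|lborel. H (move e i s p) * \<psi> p / s - H p * \<psi> p / s)"
      using i1 intH[of 0] by (intro Bochner_Integration.integral_diff[symmetric]) auto
    also have "\<dots> = (LINT p|lborel. ?D p)"
      by (simp add: diff_divide_distrib left_diff_distrib)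
    finally have I: "I s = (LINT p|lborel. ?D p)" .
    have iD: "integrable lborel ?D"
      using i1 intH[of 0] by (simp add: diff_divide_distrib left_diff_distrib)
    have "ennreal \<bar>I s\<bar> \<le> (\<integral>\<^sup>+p. ennreal (norm (?D p)) \<partial>lborel)"
      unfolding I using integral_norm_bound_ennreal[OF iD] by simp
    also have "\<dots> \<le> (\<integral>\<^sup>+p. ennreal \<delta> * (ennreal (W p) * ennreal (H p)) + ennreal \<delta> * (ennreal (W p) * ennreal (H (move e i s p)))
        + ennreal (C * s powr (- q)) * (ennreal (w p) * abs_powr q (u (move e i s p) - u p)) \<partial>lborel)"
    proof (rule nn_integral_mono)
      fix p :: "'n heis"
      let ?u = "u (move e i s p)"
      let ?x = "max \<bar>?u\<bar> \<bar>u p\<bar>" and ?z = "\<bar>?u - u p\<bar> / s"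
      have "norm (?D p) = \<bar>H (move e i s p) - H p\<bar> * \<bar>\<psi> p\<bar> / s"
        using s by (simp add: abs_mult)
      also have "\<dots> \<le> (q * ?x powr (q - 1) * \<bar>?u - u p\<bar>) * \<bar>\<psi> p\<bar> / s"
        using s powr_diff_le[OF q, of ?u "u p"] unfolding H_def
        by (intro divide_right_mono mult_right_mono) auto
      also have "\<dots> = q * ?x powr (q - 1) * \<bar>\<psi> p\<bar> * ?z" by simp
      also have "\<dots> \<le> \<delta> * W p * ?x powr q + C * w p * ?z powr q"
        using s by (intro young) auto
      also have "\<delta> * W p * ?x powr q \<le> \<delta> * W p * (H p + H (move e i s p))"
        using \<delta>C nonneg H by (intro mult_left_mono) (auto simp: H_def max_def)
      also have "?z powr q = s powr (- q) * \<bar>?u - u p\<bar> powr q"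
        using s by (simp only: powr_divide powr_minus_divide) simp
      finally have "norm (?D p) \<le> \<delta> * (W p * H p) + \<delta> * (W p * H (move e i s p))
          + C * s powr (- q) * (w p * \<bar>?u - u p\<bar> powr q)"
        by (simp add: algebra_simps)
      then show "ennreal (norm (?D p)) \<le> ennreal \<delta> * (ennreal (W p) * ennreal (H p)) + ennreal \<delta> * (ennreal (W p) * ennreal (H (move e i s p)))
        + ennreal (C * s powr (- q)) * (ennreal (w p) * abs_powr q (u (move e i s p) - u p))"
        using \<delta>C nonneg H by (simp flip: ennreal_mult ennreal_plus)
    qed
    also have "\<dots> = ennreal \<delta> * (\<integral>\<^sup>+p. ennreal (W p) * ennreal (H p) \<partial>lborel)
        + ennreal \<delta> * (\<integral>\<^sup>+p. ennreal (W p) * ennreal (H (move e i s p)) \<partial>lborel)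
        + ennreal (C * s powr (- q)) * (\<integral>\<^sup>+p. ennreal (w p) * abs_powr q (u (move e i s p) - u p) \<partial>lborel)"
      by (simp add: nn_integral_add nn_integral_cmult)
    also have "(\<integral>\<^sup>+p. ennreal (W p) * ennreal (H (move e i s p)) \<partial>lborel)
        = (\<integral>\<^sup>+p. ennreal (W (move e i (- s) p)) * ennreal (H p) \<partial>lborel)"
      using nn_integral_move[of "\<lambda>p. ennreal (W (move e i (- s) p)) * ennreal (H p)" e i s] by simp
    also have "ennreal \<delta> * (\<integral>\<^sup>+p. ennreal (W p) * ennreal (H p) \<partial>lborel)
        + ennreal \<delta> * (\<integral>\<^sup>+p. ennreal (W (move e i (- s) p)) * ennreal (H p) \<partial>lborel)
        + ennreal (C * s powr (- q)) * (\<integral>\<^sup>+p. ennreal (w p) * abs_powr q (u (move e i s p) - u p) \<partial>lborel)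
        \<le> ennreal \<delta> * ennreal a + ennreal \<delta> * ennreal (a + s * E1)
          + ennreal (C * s powr (- q)) * (ennreal (s powr (q - 1)) * (ennreal (g + s * E2) * ennreal s))"
    proof (intro add_mono mult_left_mono)
      show aH: "(\<integral>\<^sup>+p. ennreal (W p) * ennreal (H p) \<partial>lborel) \<le> ennreal a" using a(2) by (simp add: H_def)
      show "(\<integral>\<^sup>+p. ennreal (W (move e i (- s) p)) * ennreal (H p) \<partial>lborel) \<le> ennreal (a + s * E1)"
        using order_trans[OF E1(2)[of s] add_right_mono[OF aH]] s a(1) E1(1) by simp
      have "(\<integral>\<^sup>+p. ennreal (w p) * abs_powr q (u (move e i s p) - u p) \<partial>lborel)
        \<le> ennreal (s powr (q - 1)) *
           (\<integral>\<^sup>+r. indicator {0..s} r * (\<integral>\<^sup>+p. ennreal (w (move e i (- r) p)) * \<gamma> p \<partial>lborel) \<partial>lborel)"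
        by (rule line_boundD[OF lb s(1)]) measurable
      also have "\<dots> \<le> ennreal (s powr (q - 1)) * (\<integral>\<^sup>+r. ennreal (g + s * E2) * indicator {0..s} r \<partial>lborel)"
      proof (rule mult_left_mono, rule nn_integral_mono)
        fix r :: real
        show "indicator {0..s} r * (\<integral>\<^sup>+p. ennreal (w (move e i (- r) p)) * \<gamma> p \<partial>lborel) \<le> ennreal (g + s * E2) * indicator {0..s} r"
        proof (cases "r \<in> {0..s}")
          case True
          then have "(\<integral>\<^sup>+p. ennreal (w (move e i (- r) p)) * \<gamma> p \<partial>lborel) \<le> ennreal g + ennreal (r * E2)"
            using order_trans[OF E2(2)[of r] add_right_mono[OF g(2)]] s by simp
          also have "\<dots> \<le> ennreal (g + s * E2)"
            using True E2(1) g(1) by (auto simp flip: ennreal_plus intro!: ennreal_leI mult_right_mono)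
          finally show ?thesis using True by simp
        qed simp
      qed simp
      also have "\<dots> = ennreal (s powr (q - 1)) * (ennreal (g + s * E2) * ennreal s)"
        using s by (subst nn_integral_cmult_indicator) auto
      finally show "(\<integral>\<^sup>+p. ennreal (w p) * abs_powr q (u (move e i s p) - u p) \<partial>lborel)
        \<le> ennreal (s powr (q - 1)) * (ennreal (g + s * E2) * ennreal s)" .
    qed auto
    also have "\<dots> = ennreal (\<delta> * a + \<delta> * (a + s * E1) + C * s powr (- q) * (s powr (q - 1) * ((g + s * E2) * s)))"
      using \<delta>C a(1) g(1) E1(1) E2(1) s by (simp flip: ennreal_mult ennreal_plus)
    also have "C * s powr (- q) * (s powr (q - 1) * ((g + s * E2) * s)) = C * (g + s * E2)"
    proof -
      have "s powr (- q) * s powr (q - 1) * s = 1"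
        using s by (simp add: powr_minus powr_diff field_simps)
      then show ?thesis by (simp add: mult_ac)
    qed
    also have "\<delta> * a + \<delta> * (a + s * E1) + C * (g + s * E2) = 2 * \<delta> * a + C * g + s * E"
      by (simp add: E_def algebra_simps)
    finally show ?thesis
      using \<delta>C a(1) g(1) E1(1) E2(1) s by (subst (asm) ennreal_le_iff) (auto simp: E_def)
  qed
  obtain K \<rho> where K: "0 \<le> K" "\<And>s p. 0 \<le> s \<Longrightarrow> s \<le> 1 \<Longrightarrow>
      \<bar>\<psi> (move e i (- s) p) - \<psi> p\<bar> \<le> K * s * indicator (cball 0 \<rho>) p"
    using lip(3) unfolding lipschitz_along_def by blast
  have "(\<lambda>m. I (inverse (real (Suc m)))) \<longlonglongrightarrow> (LINT p|lborel. H p * (- d p))"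
    unfolding I_def
  proof (rule integral_dominated_convergence)
    show "integrable lborel (\<lambda>p. M powr q * K * indicator (cball 0 \<rho> :: 'n heis set) p)"
      using K by (intro integrable_bounded_support[where \<rho>=\<rho> and C="M powr q * K"]) auto
    show "AE p in lborel. norm (H p * ((\<psi> (move e i (- inverse (real (Suc m))) p) - \<psi> p) / inverse (real (Suc m))))
        \<le> M powr q * K * indicator (cball 0 \<rho>) p" for m
    proof (rule AE_I2)
      fix p :: "'n heis"
      let ?s = "inverse (real (Suc m))"
      have s: "0 < ?s" "?s \<le> 1" by (auto simp: field_simps)
      have "\<bar>(\<psi> (move e i (- ?s) p) - \<psi> p) / ?s\<bar> = \<bar>\<psi> (move e i (- ?s) p) - \<psi> p\<bar> / ?s"
        using s by (simp only: abs_divide abs_of_pos)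
      also have "\<dots> \<le> (K * ?s * indicator (cball 0 \<rho>) p) / ?s"
        using K(2)[of ?s p] s by (intro divide_right_mono) auto
      also have "\<dots> = K * indicator (cball 0 \<rho>) p" using s by simp
      finally show "norm (H p * ((\<psi> (move e i (- ?s) p) - \<psi> p) / ?s)) \<le> M powr q * K * indicator (cball 0 \<rho>) p"
        using H[of p] unfolding real_norm_def abs_mult mult.assoc by (intro mult_mono) auto
    qed
    show "AE p in lborel. (\<lambda>m. H p * ((\<psi> (move e i (- inverse (real (Suc m))) p) - \<psi> p) / inverse (real (Suc m)))) \<longlonglongrightarrow> H p * (- d p)"
    proof (intro AE_I2 tendsto_mult tendsto_const)
      fix p :: "'n heis"
      have "filterlim (\<lambda>m. - inverse (real (Suc m))) (at 0) sequentially"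
        unfolding filterlim_at using tendsto_minus[OF LIMSEQ_inverse_real_of_nat] by auto
      moreover have "((\<lambda>h. (\<psi> (move e i h p) - \<psi> p) / h) \<longlongrightarrow> d p) (at 0)"
        using deriv[of p] by (simp add: DERIV_def)
      ultimately have "(\<lambda>m. (\<psi> (move e i (- inverse (real (Suc m))) p) - \<psi> p) / (- inverse (real (Suc m)))) \<longlonglongrightarrow> d p"
        by (rule filterlim_compose[rotated])
      from tendsto_minus[OF this]
      show "(\<lambda>m. (\<psi> (move e i (- inverse (real (Suc m))) p) - \<psi> p) / inverse (real (Suc m))) \<longlonglongrightarrow> - d p"
        by simp
    qed
  qed measurable
  then have "(\<lambda>m. \<bar>I (inverse (real (Suc m)))\<bar>) \<longlonglongrightarrow> \<bar>LINT p|lborel. H p * (- d p)\<bar>"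
    by (rule tendsto_rabs)
  moreover have "(\<lambda>m. 2 * \<delta> * a + C * g + inverse (real (Suc m)) * E) \<longlonglongrightarrow> 2 * \<delta> * a + C * g + 0 * E"
    by (intro tendsto_intros LIMSEQ_inverse_real_of_nat)
  ultimately have "\<bar>LINT p|lborel. H p * (- d p)\<bar> \<le> 2 * \<delta> * a + C * g + 0 * E"
    by (rule LIMSEQ_le) (intro exI allI impI I_bound; simp add: field_simps)
  then show ?thesis by (simp add: H_def)
qed

section \<open>The norm in logarithmic form and its horizontal derivatives\<close>

text \<open>
  $A - B = (x_1^2 + x_{n+1}^2)/4$, the part of the norm that reflects the anisotropy.
\<close>

definition norm_D :: "'n::finite \<Rightarrow> 'n heis \<Rightarrow> real" where
  "norm_D e p = norm_A e p - norm_B e p"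

definition gauge_rad :: "'n::finite \<Rightarrow> 'n heis \<Rightarrow> real" where
  "gauge_rad e p = sqrt ((norm_B e p)\<^sup>2 + (snd p)\<^sup>2)"

lemma sum_split_pair:
  fixes F :: "'n::finite + 'n \<Rightarrow> real"
  shows "(\<Sum>i\<in>UNIV. F i) = F (Inl e) + F (Inr e) + (\<Sum>i\<in>UNIV - {Inl e, Inr e}. F i)"
proof -
  have "(\<Sum>i\<in>UNIV. F i) = (\<Sum>i\<in>{Inl e, Inr e}. F i) + (\<Sum>i\<in>UNIV - {Inl e, Inr e}. F i)"
    by (subst sum.union_disjoint[symmetric]) (auto intro: sum.cong)
  then show ?thesis by simp
qed

lemma wt_eq: "wt e (Inl e) = 1/2" "wt e (Inr e) = 1/2"
  "i \<in> UNIV - {Inl e, Inr e} \<Longrightarrow> wt e i = 1"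
  by (cases i; auto simp: wt_def weight_def)+

lemma norm_B_sum: "norm_B e p = (\<Sum>i\<in>UNIV. wt e i * (fst p $ i)\<^sup>2) / 2"
proof -
  have "(\<Sum>i\<in>UNIV - {Inl e, Inr e}. wt e i * (fst p $ i)\<^sup>2) = (\<Sum>i\<in>UNIV - {Inl e, Inr e}. (fst p $ i)\<^sup>2)"
    by (intro sum.cong refl) (simp only: wt_eq(3) mult_1)
  then have "(\<Sum>i\<in>UNIV. wt e i * (fst p $ i)\<^sup>2)
      = 1/2 * (fst p $ Inl e)\<^sup>2 + 1/2 * (fst p $ Inr e)\<^sup>2 + (\<Sum>i\<in>UNIV - {Inl e, Inr e}. (fst p $ i)\<^sup>2)"
    by (subst sum_split_pair[of _ e]) (simp only: wt_eq(1,2))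
  then show ?thesis by (simp add: norm_B_def add_divide_distrib)
qed

lemma norm_A_sum: "norm_A e p = (\<Sum>i\<in>UNIV. (fst p $ i)\<^sup>2) / 2"
  unfolding norm_A_def by (subst sum_split_pair[of _ e]) (simp add: add_divide_distrib)

lemma norm_D_sum: "norm_D e p = (\<Sum>i\<in>UNIV. (1 - wt e i) * (fst p $ i)\<^sup>2) / 2"
  unfolding norm_D_def norm_A_sum norm_B_sum
  by (simp add: left_diff_distrib sum_subtractf diff_divide_distrib)

lemma norm_B_nonneg: "0 \<le> norm_B e p"
proof -
  have "0 \<le> wt e i" for i using wt_bounds(1)[of e i] by linarith
  then show ?thesis unfolding norm_B_sum by (simp add: sum_nonneg)
qed

lemma norm_D_bounds: "0 \<le> norm_D e p" "norm_D e p \<le> norm_B e p"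
proof -
  show "0 \<le> norm_D e p" unfolding norm_D_def using norm_AB_bounds(1)[of e p] by simp
  have "1 - wt e i \<le> wt e i" for i using wt_bounds(1)[of e i] by linarith
  then show "norm_D e p \<le> norm_B e p" unfolding norm_D_sum norm_B_sum
    by (intro divide_right_mono sum_mono mult_right_mono) simp_all
qed

lemma gauge_rad_bounds: "norm_B e p \<le> gauge_rad e p" "\<bar>snd p\<bar> \<le> gauge_rad e p" "0 \<le> gauge_rad e p"
  unfolding gauge_rad_def
  by (auto intro!: real_le_rsqrt simp: norm_B_nonneg)

lemma gauge_rad_sq: "(gauge_rad e p)\<^sup>2 = (norm_B e p)\<^sup>2 + (snd p)\<^sup>2"
  unfolding gauge_rad_def by simp

lemma gauge_rad_pos: "p \<noteq> 0 \<Longrightarrow> 0 < gauge_rad e p"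
proof (rule ccontr)
  assume p: "p \<noteq> 0" and "\<not> 0 < gauge_rad e p"
  then have 0: "gauge_rad e p = 0" using gauge_rad_bounds(3)[of e p] by linarith
  then have "norm_B e p = 0" "snd p = 0"
    using gauge_rad_bounds(1)[of e p] gauge_rad_bounds(2)[of p e] norm_B_nonneg[of e p] by auto
  with norm_AB_bounds(2)[of p e] have "p = 0" by (simp add: prod_eq_iff)
  with p show False by simp
qed

lemma coordinate_bounds:
  "\<bar>fst p $ i\<bar> \<le> 2 * sqrt (norm_B e p)" "\<bar>quarter_turn (fst p) i\<bar> \<le> 2 * sqrt (norm_B e p)"
proof -
  have "norm (fst p) \<le> sqrt (4 * norm_B e p)"
    using norm_AB_bounds(2)[of p e] by (intro real_le_rsqrt)
  then have "norm (fst p) \<le> 2 * sqrt (norm_B e p)" by (simp add: real_sqrt_mult)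
  then have *: "\<bar>fst p $ i\<bar> \<le> 2 * sqrt (norm_B e p)" for i
    using component_le_norm_cart[of "fst p" i] by linarith
  show "\<bar>fst p $ i\<bar> \<le> 2 * sqrt (norm_B e p)" by (rule *)
  show "\<bar>quarter_turn (fst p) i\<bar> \<le> 2 * sqrt (norm_B e p)"
    by (cases i) (auto simp: quarter_turn_def *)
qed

lemma norm_le_gauge_rad: "(norm p)\<^sup>2 \<le> 4 * gauge_rad e p + (gauge_rad e p)\<^sup>2"
proof -
  have "(norm p)\<^sup>2 = (norm (fst p))\<^sup>2 + (snd p)\<^sup>2" by (simp add: norm_prod_def)
  moreover have "(snd p)\<^sup>2 \<le> (gauge_rad e p)\<^sup>2" unfolding gauge_rad_sq by simp
  ultimately show ?thesis
    using norm_AB_bounds(2)[of p e] gauge_rad_bounds(1)[of e p] by linarith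
qed

lemma sum_move:
  fixes p :: "'n::finite heis"
  shows "(\<Sum>l\<in>UNIV. c l * (fst (move e i s p) $ l)\<^sup>2) / 2
    = (\<Sum>l\<in>UNIV. c l * (fst p $ l)\<^sup>2) / 2 + c i * (fst p $ i * s + s\<^sup>2 / 2)"
proof -
  have "(\<Sum>l\<in>UNIV. c l * (fst (move e i s p) $ l)\<^sup>2)
     = (\<Sum>l\<in>UNIV. c l * (fst p $ l)\<^sup>2 + (if l = i then 2 * c i * (fst p $ i * s + s\<^sup>2 / 2) else 0))"
    by (intro sum.cong) (auto simp: move_eq axis_def power2_eq_square algebra_simps)
  then show ?thesis by (simp add: sum.distrib add_divide_distrib)
qed

lemma norm_B_move: "norm_B e (move e i s p) = norm_B e p + wt e i * (fst p $ i * s + s\<^sup>2 / 2)"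
  unfolding norm_B_sum sum_move ..

lemma norm_D_move: "norm_D e (move e i s p) = norm_D e p + (1 - wt e i) * (fst p $ i * s + s\<^sup>2 / 2)"
  unfolding norm_D_sum sum_move ..

lemma snd_move: "snd (move e i s p) = snd p + s * (wt e i * quarter_turn (fst p) i)"
  by (simp add: move_eq)

lemma fst_move: "fst (move e i s p) $ i = s + fst p $ i"
  by (simp add: move_eq axis_def)

lemma quarter_turn_move: "quarter_turn (fst (move e i s p)) i = quarter_turn (fst p) i"
  by (simp add: move_eq)

lemma norm_B_has_derivative:
  "((\<lambda>s. norm_B e (move e i s p)) has_real_derivative wt e i * fst p $ i) (at 0)"
  unfolding norm_B_move by (auto intro!: derivative_eq_intros)

text \<open>
  The formula of the norm simplifies because
  $AB + t^2 + A R = (B + R)(D + R)$.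
\<close>

definition log_gauge :: "'n::finite \<Rightarrow> 'n heis \<Rightarrow> real" where
  "log_gauge e p = (let n = real CARD('n); R = gauge_rad e p in
     ln R / (2 * n) - ln (R + norm_B e p) / (4 * n) + (1/2 - 1 / (4 * n)) * ln (norm_D e p + R))"

text \<open>
  The partial derivative of \<open>log_gauge\<close> with respect to $R$, at fixed $B$ and $D$.
\<close>

definition radial_coeff :: "'n::finite \<Rightarrow> 'n heis \<Rightarrow> real" where
  "radial_coeff e p = (let n = real CARD('n); R = gauge_rad e p in
     1 / (2 * n * R) - 1 / (4 * n * (R + norm_B e p)) + (1/2 - 1 / (4 * n)) / (norm_D e p + R))"

definition log_gauge_deriv :: "'n::finite \<Rightarrow> 'n + 'n \<Rightarrow> 'n heis \<Rightarrow> real" where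
  "log_gauge_deriv e i p = (let n = real CARD('n); R = gauge_rad e p; b = wt e i; x = fst p $ i in
     radial_coeff e p * ((norm_B e p * (b * x) + snd p * (b * quarter_turn (fst p) i)) / R)
     + (1/2 - 1 / (4 * n)) * ((1 - b) * x) / (norm_D e p + R) - b * x / (4 * n * (R + norm_B e p)))"

lemma log_gauge_has_derivative:
  assumes "p \<noteq> 0"
  shows "((\<lambda>s. log_gauge e (move e i s p)) has_real_derivative log_gauge_deriv e i p) (at 0)"
proof -
  define n where "n = real CARD('a)"
  have n: "n > 0" by (simp add: n_def)
  define b where "b = wt e i"
  define x where "x = fst p $ i"
  define j where "j = quarter_turn (fst p) i"
  define B D R where "B = norm_B e p" and "D = norm_D e p" and "R = gauge_rad e p"
  define t where "t = snd p"
  have R: "R > 0" using gauge_rad_pos[OF assms, of e] by (simp add: R_def)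
  have B: "0 \<le> B" and D: "0 \<le> D" using norm_B_nonneg[of e p] norm_D_bounds(1)[of e p] by (simp_all add: B_def D_def)
  have R2: "R = sqrt (B\<^sup>2 + t\<^sup>2)" by (simp add: R_def gauge_rad_def B_def t_def)
  have pos: "0 < B\<^sup>2 + t\<^sup>2" using R unfolding R2 by simp
  define fB where "fB s = B + b * (x * s + s\<^sup>2 / 2)" for s
  define fD where "fD s = D + (1 - b) * (x * s + s\<^sup>2 / 2)" for s
  define ft where "ft s = t + s * (b * j)" for s
  define fR where "fR s = sqrt ((fB s)\<^sup>2 + (ft s)\<^sup>2)" for s
  have at0: "fB 0 = B" "fD 0 = D" "ft 0 = t" "fR 0 = R" by (auto simp: fB_def fD_def ft_def fR_def R2)
  have dB: "(fB has_real_derivative b * x) (at 0)" unfolding fB_def by (auto intro!: derivative_eq_intros)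
  have dD: "(fD has_real_derivative (1 - b) * x) (at 0)" unfolding fD_def by (auto intro!: derivative_eq_intros)
  have dt: "(ft has_real_derivative b * j) (at 0)" unfolding ft_def by (auto intro!: derivative_eq_intros)
  have dR: "(fR has_real_derivative (B * (b * x) + t * (b * j)) / R) (at 0)"
    unfolding fR_def using pos R
    by (auto intro!: derivative_eq_intros dB dt simp: at0 R2[symmetric] field_simps)
  have "((\<lambda>s. ln (fR s) / (2 * n) - ln (fR s + fB s) / (4 * n) + (1/2 - 1 / (4 * n)) * ln (fD s + fR s))
      has_real_derivative
       ((B * (b * x) + t * (b * j)) / R) / R / (2 * n) - ((B * (b * x) + t * (b * j)) / R + b * x) / (R + B) / (4 * n)
       + (1/2 - 1 / (4 * n)) * (((1 - b) * x + (B * (b * x) + t * (b * j)) / R) / (D + R))) (at 0)"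
  proof (intro DERIV_add DERIV_diff DERIV_cdivide DERIV_cmult)
    have ln: "((\<lambda>s. ln (F s)) has_real_derivative F' / F 0) (at 0)"
      if "(F has_real_derivative F') (at 0)" "F 0 > 0" for F F'
      using that by (auto intro!: derivative_eq_intros)
    show "((\<lambda>s. ln (fR s)) has_real_derivative ((B * (b * x) + t * (b * j)) / R) / R) (at 0)"
      using ln[OF dR] R by (simp add: at0)
    show "((\<lambda>s. ln (fR s + fB s)) has_real_derivative ((B * (b * x) + t * (b * j)) / R + b * x) / (R + B)) (at 0)"
      using ln[OF DERIV_add[OF dR dB]] R B by (simp add: at0)
    show "((\<lambda>s. ln (fD s + fR s)) has_real_derivative ((1 - b) * x + (B * (b * x) + t * (b * j)) / R) / (D + R)) (at 0)"
      using ln[OF DERIV_add[OF dD dR]] R D by (simp add: at0)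
  qed
  moreover have rearrange: "S / R / (2 * n) - (S + y) / (R + B) / (4 * n) + c * ((X + S) / (D + R))
      = (1 / (2 * n * R) - 1 / (4 * n * (R + B)) + c / (D + R)) * S + c * X / (D + R) - y / (4 * n * (R + B))"
    for S y c X by (simp add: add_divide_distrib algebra_simps)
  have "((B * (b * x) + t * (b * j)) / R) / R / (2 * n) - ((B * (b * x) + t * (b * j)) / R + b * x) / (R + B) / (4 * n)
       + (1/2 - 1 / (4 * n)) * (((1 - b) * x + (B * (b * x) + t * (b * j)) / R) / (D + R)) = log_gauge_deriv e i p"
    unfolding log_gauge_deriv_def radial_coeff_def Let_def
      n_def[symmetric] b_def[symmetric] x_def[symmetric] j_def[symmetric] B_def[symmetric] D_def[symmetric] R_def[symmetric] t_def[symmetric]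
    by (rule rearrange)
  moreover have "(\<lambda>s. ln (fR s) / (2 * n) - ln (fR s + fB s) / (4 * n) + (1/2 - 1 / (4 * n)) * ln (fD s + fR s))
      = (\<lambda>s. log_gauge e (move e i s p))"
    unfolding log_gauge_def gauge_rad_def Let_def norm_B_move norm_D_move snd_move fR_def fB_def fD_def ft_def
      n_def b_def x_def j_def B_def D_def t_def ..
  ultimately show ?thesis by simp
qed

definition potential :: "'n::finite \<Rightarrow> real \<Rightarrow> 'n heis \<Rightarrow> real" where
  "potential e k p = heis_norm e p powr k"

abbreviation gibbs_integral :: "'n::finite \<Rightarrow> real \<Rightarrow> ('n heis \<Rightarrow> ennreal) \<Rightarrow> ennreal" where
  "gibbs_integral e k h \<equiv> \<integral>\<^sup>+p. ennreal (exp (- potential e k p)) * h p \<partial>lborel"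

lemma CARD_ge_1: "1 \<le> real CARD('n::finite)"
  by (simp add: Suc_le_eq)

lemma potential_eq_exp:
  fixes e :: "'n::finite"
  assumes "p \<noteq> 0"
  shows "potential e k p = exp (k * log_gauge e p)"
proof -
  define n where "n = real CARD('n)"
  define A B D R t where "A = norm_A e p" and "B = norm_B e p" and "D = norm_D e p" and "R = gauge_rad e p" and "t = snd p"
  have R: "R > 0" using gauge_rad_pos[OF assms, of e] by (simp add: R_def)
  have BD: "0 \<le> B" "0 \<le> D" using norm_B_nonneg[of e p] norm_D_bounds(1)[of e p] by (simp_all add: B_def D_def)
  have R2: "B\<^sup>2 + t\<^sup>2 = R\<^sup>2" using gauge_rad_sq[of e p] by (simp add: R_def B_def t_def)
  have sq: "sqrt (R\<^sup>2) = R" using R by simp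
  have AD: "A = B + D" by (simp add: A_def B_def D_def norm_D_def)
  have "A * B + t\<^sup>2 + A * R = (B + R) * (D + R)"
  proof -
    have "t\<^sup>2 = R\<^sup>2 - B\<^sup>2" using R2 by simp
    then show ?thesis unfolding AD by (simp add: power2_eq_square algebra_simps)
  qed
  then have "heis_norm e p = (R\<^sup>2) powr (1 / (4 * n)) * ((B + R) * (D + R)) powr (1/2 - 1 / (4 * n)) / (B + R) powr (1/2)"
    using assms unfolding heis_norm_def Let_def A_def[symmetric] B_def[symmetric] t_def[symmetric] R2 sq
    by (simp add: n_def)
  also have "\<dots> = exp ((1 / (4 * n)) * (2 * ln R)) * exp ((1/2 - 1 / (4 * n)) * (ln (B + R) + ln (D + R))) / exp ((1/2) * ln (B + R))"
    using R BD by (simp add: powr_def ln_mult ln_realpow)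
  also have "\<dots> = exp ((1 / (4 * n)) * (2 * ln R) + (1/2 - 1 / (4 * n)) * (ln (B + R) + ln (D + R)) - (1/2) * ln (B + R))"
    by (simp only: exp_add exp_diff)
  also have "(1 / (4 * n)) * (2 * ln R) + (1/2 - 1 / (4 * n)) * (ln (B + R) + ln (D + R)) - (1/2) * ln (B + R) = log_gauge e p"
    unfolding log_gauge_def Let_def n_def[symmetric] B_def[symmetric] D_def[symmetric] R_def[symmetric]
    by (simp add: algebra_simps)
  finally show ?thesis by (simp add: potential_def powr_def)
qed

lemma potential_nonneg: "0 \<le> potential e k p"
  by (simp add: potential_def)

lemma potential_upper:
  fixes e :: "'n::finite"
  assumes k: "k \<ge> 4"
  shows "potential e k p \<le> (2 * gauge_rad e p) powr (k / 2)"
proof (cases "p = 0")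
  case True
  then show ?thesis by (simp add: potential_def heis_norm_def)
next
  case False
  define n where "n = real CARD('n)"
  have n: "1 \<le> n" unfolding n_def by (rule CARD_ge_1)
  define B D R where "B = norm_B e p" and "D = norm_D e p" and "R = gauge_rad e p"
  have R: "R > 0" using gauge_rad_pos[OF False, of e] by (simp add: R_def)
  have BD: "0 \<le> B" "0 \<le> D" "D \<le> R" using norm_B_nonneg[of e p] norm_D_bounds[of e p] gauge_rad_bounds(1)[of e p]
    by (auto simp: B_def D_def R_def)
  have c: "0 \<le> 1/2 - 1 / (4 * n)" "1/2 - 1 / (4 * n) \<le> 1/2" using n by (auto simp: field_simps)
  have "log_gauge e p = ln R / (2 * n) - ln (R + B) / (4 * n) + (1/2 - 1 / (4 * n)) * ln (D + R)"
    by (simp add: log_gauge_def Let_def n_def B_def D_def R_def)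
  also have "\<dots> \<le> ln R / (2 * n) - ln R / (4 * n) + (1/2 - 1 / (4 * n)) * ln (2 * R)"
    using R BD c n by (intro add_mono diff_mono mult_left_mono divide_right_mono ln_mono) auto
  also have "\<dots> = ln R / 2 + (1/2 - 1 / (4 * n)) * ln 2"
    using R n by (simp add: ln_mult field_simps)
  also have "\<dots> \<le> ln R / 2 + 1/2 * ln 2"
    using c by (intro add_mono mult_right_mono) auto
  also have "\<dots> = ln (2 * R) / 2" using R by (simp add: ln_mult)
  finally have "k * log_gauge e p \<le> k * (ln (2 * R) / 2)" using k by (intro mult_left_mono) auto
  then show ?thesis using R unfolding potential_eq_exp[OF False] by (simp add: powr_def R_def)
qed

text \<open>
  The exponent 4 is needed for $V$ to dominate $R^2$, hence $t^2$, far from the origin.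
\<close>

lemma potential_lower:
  assumes k: "k \<ge> 4" and R: "16 \<le> gauge_rad e p"
  shows "(gauge_rad e p)\<^sup>2 / 16 \<le> potential e k p"
proof -
  define R N where "R = gauge_rad e p" and "N = heis_norm e p"
  have "p \<noteq> 0" using R by (auto simp: gauge_rad_def norm_B_def)
  then have N: "sqrt R / 2 \<le> N" using heis_norm_lower[of p e] by (simp add: R_def N_def gauge_rad_def)
  have "4 \<le> sqrt R" using R by (intro real_le_rsqrt) (simp add: R_def)
  with N have N1: "1 \<le> N" by simp
  have "R\<^sup>2 / 16 = (sqrt R / 2) ^ 4"
  proof -
    have "(sqrt R) ^ 4 = ((sqrt R)\<^sup>2)\<^sup>2" by (simp flip: power_mult)
    then show ?thesis using R by (simp add: power_divide R_def)
  qed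
  also have "\<dots> \<le> N ^ 4" using N R by (intro power_mono) (auto simp: R_def)
  also have "\<dots> = N powr 4" using N1 by simp
  also have "\<dots> \<le> N powr k" using N1 k by (intro powr_mono) auto
  finally show ?thesis by (simp add: potential_def R_def N_def)
qed

text \<open>
  At the origin the logarithm is not available; there $V = O(s^k)$ along the axes makes the derivative 0,
  which is also the value of the formula.
\<close>

lemma potential_has_derivative:
  assumes k: "k \<ge> 4"
  shows "((\<lambda>s. potential e k (move e i s p)) has_real_derivative
      k * potential e k p * log_gauge_deriv e i p) (at 0)"
proof (cases "p = 0")
  case False
  have "((\<lambda>s. exp (k * log_gauge e (move e i s p))) has_real_derivative
      exp (k * log_gauge e (move e i 0 p)) * (k * log_gauge_deriv e i p)) (at 0)"
    by (rule derivative_eq_intros log_gauge_has_derivative[OF False] refl)+ simp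
  then have "((\<lambda>s. exp (k * log_gauge e (move e i s p))) has_real_derivative
      k * potential e k p * log_gauge_deriv e i p) (at 0)"
    using False by (simp add: potential_eq_exp mult_ac)
  moreover have "open {s. move e i s p \<noteq> 0}"
    by (intro open_Collect_neq continuous_intros)
  ultimately show ?thesis
    by (rule has_field_derivative_transform_within_open) (auto simp: False potential_eq_exp)
next
  case True
  have R: "gauge_rad e (move e i s 0) \<le> s\<^sup>2 / 2" for s
  proof -
    have "norm_B e (move e i s 0) = wt e i * (s\<^sup>2 / 2)"
      unfolding norm_B_move by (simp add: norm_B_def)
    moreover have "snd (move e i s 0) = 0" by (simp add: snd_move quarter_turn_def split: sum.splits)
    ultimately have "gauge_rad e (move e i s 0) = wt e i * (s\<^sup>2 / 2)"
      using norm_B_nonneg[of e "move e i s 0"] by (simp add: gauge_rad_def)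
    also have "\<dots> \<le> 1 * (s\<^sup>2 / 2)" using wt_bounds(2)[of e i] by (intro mult_right_mono) auto
    finally show ?thesis by simp
  qed
  have le: "potential e k (move e i s 0) \<le> \<bar>s\<bar> * \<bar>s\<bar>" if s: "\<bar>s\<bar> \<le> 1" for s
  proof -
    have "potential e k (move e i s 0) \<le> (2 * gauge_rad e (move e i s 0)) powr (k / 2)"
      by (rule potential_upper[OF k])
    also have "\<dots> \<le> (s\<^sup>2) powr (k / 2)"
      using R[of s] gauge_rad_bounds(3)[of e "move e i s 0"] k by (intro powr_mono2) auto
    also have "\<dots> \<le> (s\<^sup>2) powr 1"
      using s k by (intro powr_mono') (auto simp: abs_square_le_1)
    finally show ?thesis by (simp add: power2_eq_square)
  qed
  have "((\<lambda>h. (potential e k (move e i (0 + h) 0) - potential e k (move e i 0 0)) / h) \<longlongrightarrow> 0) (at 0)"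
  proof (rule Lim_null_comparison)
    show "\<forall>\<^sub>F h in at 0. norm ((potential e k (move e i (0 + h) 0) - potential e k (move e i 0 0)) / h) \<le> \<bar>h\<bar>"
      unfolding eventually_at
    proof (intro exI[of _ 1] conjI ballI impI)
      fix h :: real assume h: "h \<noteq> 0 \<and> dist h 0 < 1"
      have "potential e k (move e i 0 0) = 0" by (simp add: potential_def heis_norm_def)
      then have "norm ((potential e k (move e i (0 + h) 0) - potential e k (move e i 0 0)) / h)
          = potential e k (move e i h 0) / \<bar>h\<bar>"
        using potential_nonneg[of e k "move e i h 0"] by simp
      also have "\<dots> \<le> (\<bar>h\<bar> * \<bar>h\<bar>) / \<bar>h\<bar>" using le[of h] h by (intro divide_right_mono) auto
      also have "\<dots> = \<bar>h\<bar>" using h by (simp del: abs_mult_self_eq)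
      finally show "norm ((potential e k (move e i (0 + h) 0) - potential e k (move e i 0 0)) / h) \<le> \<bar>h\<bar>" .
    qed simp
    show "((\<lambda>h::real. \<bar>h\<bar>) \<longlongrightarrow> 0) (at 0)" by (auto intro!: tendsto_eq_intros)
  qed
  then have "((\<lambda>s. potential e k (move e i s 0)) has_real_derivative 0) (at 0)"
    by (simp add: DERIV_def)
  then show ?thesis using True by (simp add: potential_def heis_norm_def)
qed

section \<open>A confining horizontal drift\<close>

lemma radial_coeff_bounds:
  fixes e :: "'n::finite"
  assumes "p \<noteq> 0"
  shows "0 \<le> radial_coeff e p" "radial_coeff e p \<le> 1 / gauge_rad e p"
proof -
  define n where "n = real CARD('n)"
  have n: "1 \<le> n" unfolding n_def by (rule CARD_ge_1)
  define B D R where "B = norm_B e p" and "D = norm_D e p" and "R = gauge_rad e p"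
  have R: "R > 0" using gauge_rad_pos[OF assms, of e] by (simp add: R_def)
  have BD: "0 \<le> B" "0 \<le> D"
    using norm_B_nonneg[of e p] norm_D_bounds[of e p] by (simp_all add: B_def D_def)
  have c: "0 \<le> 1/2 - 1 / (4 * n)" using n by (auto simp: field_simps)
  have P: "radial_coeff e p = 1 / (2 * n * R) - 1 / (4 * n * (R + B)) + (1/2 - 1 / (4 * n)) / (D + R)"
    by (simp add: radial_coeff_def Let_def n_def B_def D_def R_def)
  have "1 / (4 * n * (R + B)) \<le> 1 / (4 * n * R)"
    using R BD n by (intro divide_left_mono) auto
  also have "\<dots> \<le> 1 / (2 * n * R)" using R n by (intro divide_left_mono) auto
  finally show "0 \<le> radial_coeff e p" unfolding P using c R BD by simp
  have "radial_coeff e p \<le> 1 / (2 * n * R) - 0 + (1/2 - 1 / (4 * n)) / R"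
    unfolding P using c R BD n by (intro add_mono diff_mono divide_left_mono) auto
  also have "\<dots> = (1/2 + 1 / (4 * n)) / R" using R n by (simp add: field_simps)
  also have "\<dots> \<le> 1 / R" using n R by (intro divide_right_mono) (auto simp: field_simps)
  finally show "radial_coeff e p \<le> 1 / gauge_rad e p" by (simp add: R_def)
qed

text \<open>
  By homogeneity a horizontal derivative of $\log N$ has degree $-1$, and $\sqrt R$ has degree 1.
\<close>

lemma log_gauge_deriv_bound:
  fixes e :: "'n::finite"
  assumes "p \<noteq> 0"
  shows "\<bar>log_gauge_deriv e i p\<bar> \<le> 6 / sqrt (gauge_rad e p)"
proof -
  define n where "n = real CARD('n)"
  have n: "1 \<le> n" unfolding n_def by (rule CARD_ge_1)
  define B D R P t b x j where "B = norm_B e p" and "D = norm_D e p" and "R = gauge_rad e p"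
    and "P = radial_coeff e p" and "t = snd p" and "b = wt e i" and "x = fst p $ i" and "j = quarter_turn (fst p) i"
  define r where "r = sqrt R"
  have R: "R > 0" using gauge_rad_pos[OF assms, of e] by (simp add: R_def)
  then have r: "r > 0" "R = r * r" by (auto simp: r_def)
  have BD: "0 \<le> B" "0 \<le> D" "B \<le> R" "\<bar>t\<bar> \<le> R"
    using norm_B_nonneg[of e p] norm_D_bounds[of e p] gauge_rad_bounds(1)[of e p] gauge_rad_bounds(2)[of p e]
    by (simp_all add: B_def D_def R_def t_def)
  have P: "0 \<le> P" "P \<le> 1 / R" using radial_coeff_bounds[OF assms, of e] by (simp_all add: P_def R_def)
  have b: "0 \<le> b" "b \<le> 1" using wt_bounds[of e i] by (auto simp: b_def)
  have c: "0 \<le> 1/2 - 1 / (4 * n)" "1/2 - 1 / (4 * n) \<le> 1/2" using n by (auto simp: field_simps)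
  have "sqrt B \<le> r" using BD by (simp add: r_def)
  then have xj: "\<bar>x\<bar> \<le> 2 * r" "\<bar>j\<bar> \<le> 2 * r"
    using coordinate_bounds[of p i e] by (simp_all add: x_def j_def B_def)
  then have bxj: "\<bar>b * x\<bar> \<le> 2 * r" "\<bar>b * j\<bar> \<le> 2 * r" "\<bar>(1 - b) * x\<bar> \<le> 2 * r"
    using b mult_mono[of b 1 "\<bar>x\<bar>" "2 * r"] mult_mono[of b 1 "\<bar>j\<bar>" "2 * r"] mult_mono[of "1 - b" 1 "\<bar>x\<bar>" "2 * r"] r
    by (auto simp: abs_mult)
  have "\<bar>P * ((B * (b * x) + t * (b * j)) / R)\<bar> \<le> (1 / R) * ((R * (2 * r) + R * (2 * r)) / R)"
  proof -
    have "\<bar>B * (b * x) + t * (b * j)\<bar> \<le> B * \<bar>b * x\<bar> + \<bar>t\<bar> * \<bar>b * j\<bar>"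
      using abs_triangle_ineq[of "B * (b * x)" "t * (b * j)"] BD by (simp add: abs_mult)
    also have "\<dots> \<le> R * (2 * r) + R * (2 * r)"
      using BD bxj r R by (intro add_mono mult_mono) auto
    finally have "\<bar>(B * (b * x) + t * (b * j)) / R\<bar> \<le> (R * (2 * r) + R * (2 * r)) / R"
      unfolding abs_divide abs_of_pos[OF R] using R by (intro divide_right_mono) auto
    then show ?thesis using P R unfolding abs_mult by (intro mult_mono) auto
  qed
  also have "(1 / R) * ((R * (2 * r) + R * (2 * r)) / R) = 4 / r" using r by simp
  finally have 1: "\<bar>P * ((B * (b * x) + t * (b * j)) / R)\<bar> \<le> 4 / r" .
  have "\<bar>(1/2 - 1 / (4 * n)) * ((1 - b) * x) / (D + R)\<bar> = (1/2 - 1 / (4 * n)) * \<bar>(1 - b) * x\<bar> / (D + R)"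
    using c R BD by (simp add: abs_mult)
  also have "\<dots> \<le> (1/2 * (2 * r)) / R"
    using c R BD bxj r by (intro frac_le mult_mono mult_nonneg_nonneg) auto
  also have "\<dots> = 1 / r" using r by simp
  finally have 2: "\<bar>(1/2 - 1 / (4 * n)) * ((1 - b) * x) / (D + R)\<bar> \<le> 1 / r" .
  have "\<bar>b * x / (4 * n * (R + B))\<bar> = \<bar>b * x\<bar> / (4 * n * (R + B))" using n R BD by (simp add: abs_mult)
  also have "\<dots> \<le> (2 * r) / (4 * 1 * (R + 0))"
    using c R BD bxj r n by (intro frac_le mult_mono add_mono) auto
  also have "\<dots> \<le> 1 / r" using r by (simp add: field_simps)
  finally have 3: "\<bar>b * x / (4 * n * (R + B))\<bar> \<le> 1 / r" .
  have "log_gauge_deriv e i p = P * ((B * (b * x) + t * (b * j)) / R) + (1/2 - 1 / (4 * n)) * ((1 - b) * x) / (D + R) - b * x / (4 * n * (R + B))"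
    by (simp add: log_gauge_deriv_def Let_def n_def B_def D_def R_def P_def t_def b_def x_def j_def)
  then have "\<bar>log_gauge_deriv e i p\<bar> \<le> 4 / r + 1 / r + 1 / r" using 1 2 3 by linarith
  then show ?thesis by (simp add: r_def R_def)
qed

text \<open>
  The coefficients of the field $Y$.
\<close>

definition drift :: "'n::finite \<Rightarrow> 'n + 'n \<Rightarrow> 'n heis \<Rightarrow> real" where
  "drift e i p = (norm_B e p - 1) * fst p $ i + snd p * quarter_turn (fst p) i"

lemma sum_UNIV_plus:
  fixes F :: "'n::finite + 'n \<Rightarrow> real"
  shows "(\<Sum>i\<in>UNIV. F i) = (\<Sum>j\<in>UNIV. F (Inl j)) + (\<Sum>j\<in>UNIV. F (Inr j))"
  unfolding UNIV_sum by (subst sum.union_disjoint) (auto simp: sum.reindex)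

lemma drift_sums:
  fixes p :: "'n::finite heis"
  shows "(\<Sum>i\<in>UNIV. wt e i * fst p $ i * drift e i p) = 2 * norm_B e p * (norm_B e p - 1)"
    and "(\<Sum>i\<in>UNIV. wt e i * quarter_turn (fst p) i * drift e i p) = 2 * norm_B e p * snd p"
    and "(\<Sum>i\<in>UNIV. (1 - wt e i) * fst p $ i * drift e i p) = 2 * norm_D e p * (norm_B e p - 1)"
    and "(\<Sum>i\<in>UNIV. wt e i * (quarter_turn (fst p) i)\<^sup>2) = 2 * norm_B e p"
    and "(\<Sum>i\<in>UNIV. wt e i * (fst p $ i)\<^sup>2) = 2 * norm_B e p"
proof -
  let ?x = "\<lambda>i. fst p $ i" and ?j = "\<lambda>i. quarter_turn (fst p) i"
  have orth: "(\<Sum>i\<in>UNIV. wt e i * (?x i * ?j i)) = 0" "(\<Sum>i\<in>UNIV. (1 - wt e i) * (?x i * ?j i)) = 0"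
    unfolding sum_UNIV_plus by (simp_all add: quarter_turn_def wt_def sum_negf mult.commute)
  show xx: "(\<Sum>i\<in>UNIV. wt e i * (?x i)\<^sup>2) = 2 * norm_B e p" by (simp add: norm_B_sum)
  have dd: "(\<Sum>i\<in>UNIV. (1 - wt e i) * (?x i)\<^sup>2) = 2 * norm_D e p" by (simp add: norm_D_sum)
  show jj: "(\<Sum>i\<in>UNIV. wt e i * (?j i)\<^sup>2) = 2 * norm_B e p"
    unfolding xx[symmetric] sum_UNIV_plus by (simp add: quarter_turn_def wt_def)
  have "(\<Sum>i\<in>UNIV. wt e i * ?x i * drift e i p)
      = (\<Sum>i\<in>UNIV. (norm_B e p - 1) * (wt e i * (?x i)\<^sup>2) + snd p * (wt e i * (?x i * ?j i)))"
    by (intro sum.cong) (auto simp: drift_def power2_eq_square algebra_simps)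
  then show "(\<Sum>i\<in>UNIV. wt e i * ?x i * drift e i p) = 2 * norm_B e p * (norm_B e p - 1)"
    by (simp add: sum.distrib sum_distrib_left[symmetric] xx orth)
  have "(\<Sum>i\<in>UNIV. wt e i * ?j i * drift e i p)
      = (\<Sum>i\<in>UNIV. (norm_B e p - 1) * (wt e i * (?x i * ?j i)) + snd p * (wt e i * (?j i)\<^sup>2))"
    by (intro sum.cong) (auto simp: drift_def power2_eq_square algebra_simps)
  then show "(\<Sum>i\<in>UNIV. wt e i * ?j i * drift e i p) = 2 * norm_B e p * snd p"
    by (simp add: sum.distrib sum_distrib_left[symmetric] jj orth)
  have "(\<Sum>i\<in>UNIV. (1 - wt e i) * ?x i * drift e i p)
      = (\<Sum>i\<in>UNIV. (norm_B e p - 1) * ((1 - wt e i) * (?x i)\<^sup>2) + snd p * ((1 - wt e i) * (?x i * ?j i)))"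
    by (intro sum.cong) (auto simp: drift_def power2_eq_square algebra_simps)
  then show "(\<Sum>i\<in>UNIV. (1 - wt e i) * ?x i * drift e i p) = 2 * norm_D e p * (norm_B e p - 1)"
    by (simp add: sum.distrib sum_distrib_left[symmetric] dd orth)
qed

text \<open>
  Half of the derivative of \<open>log_gauge\<close> along $2 t\, \partial_t$, the vertical part of the generator of the
  dilations.
\<close>

definition vertical_share :: "'n::finite \<Rightarrow> 'n heis \<Rightarrow> real" where
  "vertical_share e p = radial_coeff e p * (snd p)\<^sup>2 / gauge_rad e p"

text \<open>
  Euler's relation: \<open>log_gauge\<close> grows by 1 under the generator
  $\sum_i x_i \partial_{x_i} + 2 t\, \partial_t$ of the dilations.
\<close>

lemma homogeneity:
  fixes e :: "'n::finite"
  assumes "p \<noteq> 0"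
  shows "radial_coeff e p * (norm_B e p)\<^sup>2 / gauge_rad e p
      + (1/2 - 1 / (4 * real CARD('n))) * norm_D e p / (norm_D e p + gauge_rad e p)
      - norm_B e p / (4 * real CARD('n) * (gauge_rad e p + norm_B e p)) = 1/2 - vertical_share e p"
proof -
  define n where "n = real CARD('n)"
  have n: "1 \<le> n" unfolding n_def by (rule CARD_ge_1)
  define B D R t P where "B = norm_B e p" and "D = norm_D e p" and "R = gauge_rad e p" and "t = snd p"
    and "P = radial_coeff e p"
  have R: "R > 0" using gauge_rad_pos[OF assms, of e] by (simp add: R_def)
  have BD: "0 \<le> B" "0 \<le> D" using norm_B_nonneg[of e p] norm_D_bounds(1)[of e p] by (simp_all add: B_def D_def)
  have P: "P = 1 / (2 * n * R) - 1 / (4 * n * (R + B)) + (1/2 - 1 / (4 * n)) / (D + R)"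
    by (simp add: radial_coeff_def Let_def n_def B_def D_def R_def P_def)
  have "P * B\<^sup>2 / R + P * t\<^sup>2 / R = P * R"
  proof -
    have "P * B\<^sup>2 / R + P * t\<^sup>2 / R = P * (B\<^sup>2 + t\<^sup>2) / R" by (simp add: add_divide_distrib algebra_simps)
    also have "B\<^sup>2 + t\<^sup>2 = R * R" using gauge_rad_sq[of e p] by (simp add: B_def t_def R_def power2_eq_square)
    finally show ?thesis using R by simp
  qed
  moreover have "P * R + (1/2 - 1 / (4 * n)) * D / (D + R) - B / (4 * n * (R + B)) = 1/2"
  proof -
    have "P * R = 1 / (2 * n) - R / (4 * n * (R + B)) + (1/2 - 1 / (4 * n)) * R / (D + R)"
      unfolding P using R by (simp add: algebra_simps)
    moreover have "R / (4 * n * (R + B)) + B / (4 * n * (R + B)) = 1 / (4 * n)"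
      using R BD n by (simp add: add_divide_distrib[symmetric])
    moreover have "(1/2 - 1 / (4 * n)) * R / (D + R) + (1/2 - 1 / (4 * n)) * D / (D + R) = 1/2 - 1 / (4 * n)"
      using R BD by (simp add: add_divide_distrib[symmetric] distrib_left[symmetric] add.commute)
    moreover have "1 / (2 * n) = 2 * (1 / (4 * n))" by simp
    ultimately show ?thesis by linarith
  qed
  ultimately have "P * B\<^sup>2 / R + (1/2 - 1 / (4 * n)) * D / (D + R) - B / (4 * n * (R + B)) = 1/2 - P * t\<^sup>2 / R"
    by linarith
  then show ?thesis unfolding vertical_share_def
      n_def[symmetric] B_def[symmetric] D_def[symmetric] R_def[symmetric] t_def[symmetric] P_def[symmetric] .
qed

lemma vertical_share_bounds:
  fixes e :: "'n::finite"
  assumes "p \<noteq> 0"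
  shows "0 \<le> vertical_share e p"
    "gauge_rad e p \<ge> 6 \<Longrightarrow> norm_B e p / 2 \<le> norm_B e p - 1 + 2 * vertical_share e p"
proof -
  define n where "n = real CARD('n)"
  have n: "1 \<le> n" unfolding n_def by (rule CARD_ge_1)
  define B D R t P where "B = norm_B e p" and "D = norm_D e p" and "R = gauge_rad e p" and "t = snd p"
    and "P = radial_coeff e p"
  have R: "R > 0" using gauge_rad_pos[OF assms, of e] by (simp add: R_def)
  have BD: "0 \<le> B" "0 \<le> D" "D \<le> B" "B \<le> R" using norm_B_nonneg[of e p] norm_D_bounds[of e p] gauge_rad_bounds(1)[of e p]
    by (simp_all add: B_def D_def R_def)
  have P: "0 \<le> P" "P \<le> 1 / R" using radial_coeff_bounds[OF assms, of e] by (simp_all add: P_def R_def)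
  have c: "0 \<le> 1/2 - 1 / (4 * n)" "1/2 - 1 / (4 * n) \<le> 1/2" using n by (auto simp: field_simps)
  show "0 \<le> vertical_share e p" using P R by (simp add: vertical_share_def P_def R_def)
  assume "gauge_rad e p \<ge> 6"
  then have R6: "R \<ge> 6" by (simp add: R_def)
  have "P * B\<^sup>2 / R \<le> (1 / R) * (B * R) / R"
    using P BD R by (intro divide_right_mono mult_mono) (auto simp: power2_eq_square intro!: mult_left_mono)
  also have "\<dots> = B / R" using R by simp
  finally have 1: "P * B\<^sup>2 / R \<le> B / R" .
  have 2: "(1/2 - 1 / (4 * n)) * D / (D + R) \<le> (1/2 * B) / R"
    using c BD R by (intro frac_le mult_mono) auto
  have 3: "0 \<le> B / (4 * n * (R + B))" using BD R n by simp
  have "1/2 - vertical_share e p = P * B\<^sup>2 / R + (1/2 - 1 / (4 * n)) * D / (D + R) - B / (4 * n * (R + B))"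
    using homogeneity[OF assms, of e] by (simp add: n_def B_def D_def R_def P_def)
  then have "1 - 2 * vertical_share e p \<le> 3 * (B / R)" using 1 2 3 by simp
  also have "\<dots> \<le> 3 * (B / 6)" using R6 BD by (intro mult_left_mono divide_left_mono) auto
  finally show "norm_B e p / 2 \<le> norm_B e p - 1 + 2 * vertical_share e p" by (simp add: B_def)
qed

text \<open>
  The radial part of $Y$ contributes $(B - 1)(1 - 2\tau)$ by \<open>homogeneity\<close> and the rotational part contributes
  $2 B \tau$; the products $B \tau$ cancel.
\<close>

lemma drift_log_gauge:
  fixes e :: "'n::finite"
  assumes "p \<noteq> 0"
  shows "(\<Sum>i\<in>UNIV. drift e i p * log_gauge_deriv e i p) = norm_B e p - 1 + 2 * vertical_share e p"
proof -
  define n where "n = real CARD('n)"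
  define B D R t P c where "B = norm_B e p" and "D = norm_D e p" and "R = gauge_rad e p" and "t = snd p"
    and "P = radial_coeff e p" and "c = 1/2 - 1 / (4 * n)"
  have R: "R > 0" using gauge_rad_pos[OF assms, of e] by (simp add: R_def)
  let ?y = "\<lambda>i. drift e i p"
  have "(\<Sum>i\<in>UNIV. ?y i * log_gauge_deriv e i p)
      = (\<Sum>i\<in>UNIV. P * B / R * (wt e i * fst p $ i * ?y i) + P * t / R * (wt e i * quarter_turn (fst p) i * ?y i)
          + c / (D + R) * ((1 - wt e i) * fst p $ i * ?y i) - 1 / (4 * n * (R + B)) * (wt e i * fst p $ i * ?y i))"
    unfolding log_gauge_deriv_def Let_def n_def[symmetric] B_def[symmetric] D_def[symmetric] R_def[symmetric] t_def[symmetric] P_def[symmetric] c_def[symmetric]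
    by (intro sum.cong refl) (simp add: add_divide_distrib diff_divide_distrib algebra_simps)
  also have "\<dots> = P * B / R * (2 * B * (B - 1)) + P * t / R * (2 * B * t) + c / (D + R) * (2 * D * (B - 1)) - 1 / (4 * n * (R + B)) * (2 * B * (B - 1))"
    by (simp only: sum.distrib sum_subtractf sum_distrib_left[symmetric] drift_sums B_def D_def t_def)
  also have "\<dots> = 2 * (B - 1) * (P * B\<^sup>2 / R + c * D / (D + R) - B / (4 * n * (R + B))) + 2 * B * (P * t\<^sup>2 / R)"
    by (simp add: power2_eq_square algebra_simps)
  also have "P * B\<^sup>2 / R + c * D / (D + R) - B / (4 * n * (R + B)) = 1/2 - vertical_share e p"
    using homogeneity[OF assms, of e] by (simp add: n_def B_def D_def R_def P_def c_def)
  also have "P * t\<^sup>2 / R = vertical_share e p"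
    by (simp add: vertical_share_def P_def t_def R_def)
  also have "2 * (B - 1) * (1/2 - vertical_share e p) + 2 * B * vertical_share e p = B - 1 + 2 * vertical_share e p"
    by (simp add: algebra_simps)
  finally show ?thesis by (simp add: B_def)
qed

lemma drift_has_derivative:
  "((\<lambda>s. drift e i (move e i s p)) has_real_derivative
     wt e i * (fst p $ i)\<^sup>2 + (norm_B e p - 1) + wt e i * (quarter_turn (fst p) i)\<^sup>2) (at 0)"
  unfolding drift_def norm_B_move fst_move snd_move quarter_turn_move
  by (auto intro!: derivative_eq_intros simp: power2_eq_square)

lemma drift_divergence:
  fixes e :: "'n::finite"
  shows "(\<Sum>i\<in>UNIV. wt e i * (fst p $ i)\<^sup>2 + (norm_B e p - 1) + wt e i * (quarter_turn (fst p) i)\<^sup>2)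
     = (2 * real CARD('n) + 4) * norm_B e p - 2 * real CARD('n)"
  by (simp only: sum.distrib drift_sums(4,5)) (simp add: card_UNIV_sum algebra_simps)

text \<open>
  Each coordinate is at most $2 \sqrt B$, so $y_i^2 \le 4 B (1 + 2R)^2$. For $R \ge 16$ the bound $V \ge R^2/16$
  applies; for $R \le 16$ the constant $69696 = 4 \cdot 16 \cdot 33^2$ suffices.
\<close>

lemma drift_bound:
  assumes k: "k \<ge> 4"
  shows "(drift e i p)\<^sup>2 \<le> 69696 * (1 + norm_B e p * potential e k p)"
proof -
  define B R where "B = norm_B e p" and "R = gauge_rad e p"
  have B: "0 \<le> B" "B \<le> R" "\<bar>snd p\<bar> \<le> R"
    using norm_B_nonneg[of e p] gauge_rad_bounds(1)[of e p] gauge_rad_bounds(2)[of p e] by (simp_all add: B_def R_def)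
  have V: "0 \<le> potential e k p" by (rule potential_nonneg)
  have "\<bar>drift e i p\<bar> \<le> \<bar>B - 1\<bar> * (2 * sqrt B) + \<bar>snd p\<bar> * (2 * sqrt B)"
    unfolding drift_def B_def using coordinate_bounds[of p i e]
    by (intro order_trans[OF abs_triangle_ineq] add_mono) (auto simp: abs_mult intro!: mult_left_mono)
  also have "\<dots> = (\<bar>B - 1\<bar> + \<bar>snd p\<bar>) * (2 * sqrt B)" by (simp add: algebra_simps)
  also have "\<dots> \<le> (1 + 2 * R) * (2 * sqrt B)" using B by (intro mult_right_mono) auto
  finally have "(drift e i p)\<^sup>2 \<le> ((1 + 2 * R) * (2 * sqrt B))\<^sup>2"
    by (intro abs_le_square_iff[THEN iffD1]) (use B in auto)
  also have "\<dots> = 4 * B * (1 + 2 * R)\<^sup>2" using B by (simp add: power_mult_distrib)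
  finally have y: "(drift e i p)\<^sup>2 \<le> 4 * B * (1 + 2 * R)\<^sup>2" .
  show ?thesis
  proof (cases "R \<ge> 16")
    case True
    have "(1 + 2 * R)\<^sup>2 \<le> (3 * R)\<^sup>2" using True by (intro power_mono) auto
    also have "\<dots> = 144 * (R\<^sup>2 / 16)" by (simp add: power2_eq_square)
    also have "\<dots> \<le> 144 * potential e k p" using potential_lower[OF k, of e p] True by (simp add: R_def)
    finally have "4 * B * (1 + 2 * R)\<^sup>2 \<le> 4 * B * (144 * potential e k p)" using B by (intro mult_left_mono) auto
    also have "\<dots> = 576 * (B * potential e k p)" by simp
    also have "\<dots> \<le> 69696 * (1 + B * potential e k p)"
      using mult_nonneg_nonneg[OF B(1) V] unfolding distrib_left by (intro add_increasing mult_right_mono) auto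
    finally show ?thesis using y by (simp add: B_def)
  next
    case False
    then have "4 * B * (1 + 2 * R)\<^sup>2 \<le> 4 * 16 * 33\<^sup>2" using B by (intro mult_mono power_mono) auto
    also have "\<dots> \<le> 69696 * (1 + B * potential e k p)" using B V mult_nonneg_nonneg[OF B(1) V] by simp
    finally show ?thesis using y by (simp add: B_def)
  qed
qed

lemma gauge_rad_sublevel_bounded: "gauge_rad e p \<le> r \<Longrightarrow> norm p \<le> 4 + r"
proof -
  assume r: "gauge_rad e p \<le> r"
  have "(norm p)\<^sup>2 \<le> 4 * gauge_rad e p + (gauge_rad e p)\<^sup>2" by (rule norm_le_gauge_rad)
  also have "\<dots> \<le> (4 + gauge_rad e p)\<^sup>2"
    using gauge_rad_bounds(3)[of e p] by (simp add: power2_eq_square algebra_simps)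
  finally have "norm p \<le> 4 + gauge_rad e p"
    by (rule power2_le_imp_le) (use gauge_rad_bounds(3)[of e p] in simp)
  with r show ?thesis by simp
qed

text \<open>
  The functions of $V$ used as weights live on a sublevel set; one constant bounds all quantities that
  occur in the weights and their derivatives there. The derivative of $V$ is of order $V / \sqrt R$, which stays
  bounded near the origin because $V \le (2R)^{k/2}$.
\<close>

lemma sublevel_bounded:
  assumes k: "k \<ge> 4"
  shows "\<exists>\<Lambda>\<ge>1. \<forall>(p :: 'n::finite heis) i. potential e k p \<le> L \<longrightarrow>
    norm p \<le> \<Lambda> \<and> norm_B e p \<le> \<Lambda> \<and> potential e k p \<le> \<Lambda> \<and> \<bar>fst p $ i\<bar> \<le> \<Lambda> \<and> \<bar>quarter_turn (fst p) i\<bar> \<le> \<Lambda>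
    \<and> \<bar>drift e i p\<bar> \<le> \<Lambda> \<and> \<bar>k * potential e k p * log_gauge_deriv e i p\<bar> \<le> \<Lambda>"
proof -
  define R1 where "R1 = max 16 (4 * sqrt \<bar>L\<bar>)"
  define a3 a2 where "a3 = 69696 * (1 + R1 * \<bar>L\<bar>)" and "a2 = k * ((\<bar>L\<bar> + 2 powr (k / 2)) * 6)"
  define \<Lambda> where "\<Lambda> = 1 + 5 * R1 + R1\<^sup>2 + \<bar>L\<bar> + (a3 + 1) + a2"
  have R1: "16 \<le> R1" by (simp add: R1_def)
  have nonneg: "0 \<le> a3" "0 \<le> a2" "0 \<le> R1\<^sup>2" using R1 k by (simp_all add: a3_def a2_def)
  have "norm p \<le> \<Lambda> \<and> norm_B e p \<le> \<Lambda> \<and> potential e k p \<le> \<Lambda> \<and> \<bar>fst p $ i\<bar> \<le> \<Lambda> \<and> \<bar>quarter_turn (fst p) i\<bar> \<le> \<Lambda>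
    \<and> \<bar>drift e i p\<bar> \<le> \<Lambda> \<and> \<bar>k * potential e k p * log_gauge_deriv e i p\<bar> \<le> \<Lambda>"
    if V: "potential e k p \<le> L" for p :: "'n heis" and i
  proof -
    define R where "R = gauge_rad e p"
    have L: "0 \<le> L" using V potential_nonneg[of e k p] by linarith
    have R: "0 \<le> R" "norm_B e p \<le> R" using gauge_rad_bounds(1,3)[of e p] by (simp_all add: R_def)
    have RR1: "R \<le> R1"
    proof (cases "R \<ge> 16")
      case True
      then have "R\<^sup>2 / 16 \<le> L" using potential_lower[OF k, of e p] V by (simp add: R_def)
      then have "sqrt (R\<^sup>2) \<le> sqrt (16 * L)" by (intro real_sqrt_le_mono) simp
      then show ?thesis using R L by (simp add: R1_def real_sqrt_mult)
    qed (use R1 in simp)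
    have sR: "sqrt R1 \<le> R1" using R1 by (intro real_le_lsqrt) (auto simp: power2_eq_square)
    have "2 * sqrt (norm_B e p) \<le> 2 * sqrt R1" using R RR1 by simp
    then have xj: "\<bar>fst p $ i\<bar> \<le> 2 * R1" "\<bar>quarter_turn (fst p) i\<bar> \<le> 2 * R1"
      using coordinate_bounds[of p i e] sR by linarith+
    have "norm p \<le> 4 + R" by (rule gauge_rad_sublevel_bounded[of e]) (simp add: R_def)
    then have np: "norm p \<le> 5 * R1" using RR1 R1 by linarith
    have "(drift e i p)\<^sup>2 \<le> 69696 * (1 + norm_B e p * potential e k p)" by (rule drift_bound[OF k])
    also have "\<dots> \<le> 69696 * (1 + R1 * \<bar>L\<bar>)"
      using R RR1 V L norm_B_nonneg[of e p] potential_nonneg[of e k p] R1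
      by (intro mult_left_mono add_left_mono mult_mono) auto
    finally have "(drift e i p)\<^sup>2 \<le> 69696 * (1 + R1 * \<bar>L\<bar>)" .
    moreover have "\<bar>drift e i p\<bar> \<le> (drift e i p)\<^sup>2 + 1"
      using zero_le_power2[of "\<bar>drift e i p\<bar> - 1"] zero_le_power2[of "drift e i p"] by (simp add: power2_diff)
    ultimately have dr: "\<bar>drift e i p\<bar> \<le> 69696 * (1 + R1 * \<bar>L\<bar>) + 1" by linarith
    have "potential e k p * \<bar>log_gauge_deriv e i p\<bar> \<le> (\<bar>L\<bar> + 2 powr (k / 2)) * 6"
    proof (cases "p = 0")
      case True
      then show ?thesis by (simp add: potential_def heis_norm_def)
    next
      case False
      then have Rp: "0 < R" using gauge_rad_pos[OF False, of e] by (simp add: R_def)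
      have "potential e k p / sqrt R \<le> \<bar>L\<bar> + 2 powr (k / 2)"
      proof (cases "R \<ge> 1")
        case True
        then have "potential e k p / sqrt R \<le> potential e k p / 1"
          using potential_nonneg[of e k p] by (intro divide_left_mono) auto
        then show ?thesis using V L by (simp add: add_increasing2)
      next
        case False
        have "potential e k p / sqrt R \<le> (2 * R) powr (k / 2) / R powr (1/2)"
          using potential_upper[OF k, of e p] Rp by (simp add: R_def powr_half_sqrt divide_right_mono)
        also have "\<dots> = 2 powr (k / 2) * R powr (k / 2 - 1 / 2)"
          using Rp by (simp add: powr_mult powr_diff)
        also have "\<dots> \<le> 2 powr (k / 2) * 1"
          using False Rp k by (intro mult_left_mono powr_le1) auto
        finally show ?thesis by simp
      qed
      moreover have "potential e k p * \<bar>log_gauge_deriv e i p\<bar> \<le> potential e k p * (6 / sqrt R)"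
        using log_gauge_deriv_bound[OF False, of e i] potential_nonneg[of e k p] by (intro mult_left_mono) (simp_all add: R_def)
      moreover have "potential e k p * (6 / sqrt R) = potential e k p / sqrt R * 6" by simp
      ultimately show ?thesis by (smt (verit) mult_right_mono)
    qed
    then have "k * (potential e k p * \<bar>log_gauge_deriv e i p\<bar>) \<le> k * ((\<bar>L\<bar> + 2 powr (k / 2)) * 6)"
      using k by (intro mult_left_mono) auto
    then have "\<bar>k * potential e k p * log_gauge_deriv e i p\<bar> \<le> k * ((\<bar>L\<bar> + 2 powr (k / 2)) * 6)"
      using k potential_nonneg[of e k p] by (simp only: abs_mult mult.assoc)
    moreover have "norm_B e p \<le> R1" using R RR1 by linarith
    ultimately show ?thesis using np xj dr V L R1 nonneg unfolding \<Lambda>_def a3_def[symmetric] a2_def[symmetric]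
      by (intro conjI) linarith+
  qed
  moreover have "\<Lambda> \<ge> 1" using R1 nonneg unfolding \<Lambda>_def by linarith
  ultimately show ?thesis by blast
qed

text \<open>
  A compactly supported $C^1$ approximation of $e^{-v}$ from below that satisfies $\omega \le - \omega'$. Because of
  this inequality, $- \mathrm{div}(\omega(V)\, Y) \ge \omega(V) (Y V - \mathrm{div}\, Y)$ where $Y V \ge 0$, and the truncation
  produces no error term.
\<close>

definition cutoff :: "real \<Rightarrow> real \<Rightarrow> real" where
  "cutoff L v = (max 0 (exp (- v / 2) - exp (- L / 2)))\<^sup>2"

definition cutoff_deriv :: "real \<Rightarrow> real \<Rightarrow> real" where
  "cutoff_deriv L v = - (max 0 (exp (- v / 2) - exp (- L / 2)) * exp (- v / 2))"

lemma max_0_square_has_derivative: "((\<lambda>z::real. (max 0 z)\<^sup>2) has_real_derivative 2 * max 0 z) (at z)"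
proof -
  consider "z > 0" | "z < 0" | "z = 0" by linarith
  then show ?thesis
  proof cases
    case 1
    have "((\<lambda>z::real. z\<^sup>2) has_real_derivative 2 * max 0 z) (at z)"
      using 1 by (auto intro!: derivative_eq_intros)
    then show ?thesis
      by (rule has_field_derivative_transform_within_open[where S="{0<..}"]) (use 1 in auto)
  next
    case 2
    have "((\<lambda>z::real. 0) has_real_derivative 2 * max 0 z) (at z)" using 2 by auto
    then show ?thesis
      by (rule has_field_derivative_transform_within_open[where S="{..<0}"]) (use 2 in auto)
  next
    case 3
    have "((\<lambda>h::real. (max 0 h)\<^sup>2 / h) \<longlongrightarrow> 0) (at 0)"
    proof (rule Lim_null_comparison)
      show "\<forall>\<^sub>F h::real in at 0. norm ((max 0 h)\<^sup>2 / h) \<le> \<bar>h\<bar>"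
        by (intro always_eventually allI) (auto simp: max_def power2_eq_square)
      show "((\<lambda>h::real. \<bar>h\<bar>) \<longlongrightarrow> 0) (at 0)" by (auto intro!: tendsto_eq_intros)
    qed
    then show ?thesis using 3 by (simp add: DERIV_def)
  qed
qed

lemma cutoff_has_derivative: "(cutoff L has_real_derivative cutoff_deriv L v) (at v)"
proof -
  have "((\<lambda>v. exp (- v / 2) - exp (- L / 2)) has_real_derivative - exp (- v / 2) / 2) (at v)"
    by (auto intro!: derivative_eq_intros)
  from DERIV_chain2[OF max_0_square_has_derivative this] show ?thesis
    unfolding cutoff_def[abs_def] cutoff_deriv_def by simp
qed

lemma cutoff_facts:
  shows cutoff_nonneg: "0 \<le> cutoff L v"
    and cutoff_le: "cutoff L v \<le> - cutoff_deriv L v" "- cutoff_deriv L v \<le> exp (- v)"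
    and cutoff_eq_0: "L \<le> v \<Longrightarrow> cutoff L v = 0" "L \<le> v \<Longrightarrow> cutoff_deriv L v = 0"
proof -
  let ?a = "exp (- v / 2)" and ?b = "exp (- L / 2)"
  have m: "0 \<le> max 0 (?a - ?b)" "max 0 (?a - ?b) \<le> ?a" by auto
  show "0 \<le> cutoff L v" by (simp add: cutoff_def)
  show "cutoff L v \<le> - cutoff_deriv L v"
    unfolding cutoff_def cutoff_deriv_def power2_eq_square minus_minus by (intro mult_left_mono m)
  have "max 0 (?a - ?b) * ?a \<le> ?a * ?a" by (intro mult_right_mono m) simp
  then show "- cutoff_deriv L v \<le> exp (- v)"
    unfolding cutoff_deriv_def minus_minus by (simp flip: exp_add)
  show "L \<le> v \<Longrightarrow> cutoff L v = 0" "L \<le> v \<Longrightarrow> cutoff_deriv L v = 0"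
    by (auto simp: cutoff_def cutoff_deriv_def)
qed

lemma cutoff_tendsto: "(\<lambda>m. cutoff (real m) v) \<longlonglongrightarrow> exp (- v)"
proof -
  have "(\<lambda>m. exp (- 1 / 2 :: real) ^ m) \<longlonglongrightarrow> 0"
    by (intro LIMSEQ_power_zero) simp
  then have "(\<lambda>m. exp (- real m / 2)) \<longlonglongrightarrow> 0"
    by (simp flip: exp_of_nat_mult)
  then have "(\<lambda>m. (max 0 (exp (- v / 2) - exp (- real m / 2)))\<^sup>2) \<longlonglongrightarrow> (max 0 (exp (- v / 2) - 0))\<^sup>2"
    by (intro tendsto_intros)
  then show ?thesis by (simp add: cutoff_def power2_eq_square flip: exp_add)
qed

lemma cutoff_mono: "L \<le> L' \<Longrightarrow> cutoff L v \<le> cutoff L' v"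
  unfolding cutoff_def by (intro power_mono max.mono diff_mono) auto

text \<open>
  If $q |y| z \le \delta G x$, the first term on the right suffices; otherwise $x$ can be eliminated. In the second
  case a factor $G^{q/2} G^{1-q}$ is left over, which is at most 1 for $q \ge 2$.
\<close>

lemma weighted_young:
  fixes x y z G K \<delta> q :: real
  assumes q: "2 \<le> q" and x: "0 \<le> x" and z: "0 \<le> z" and \<delta>: "0 < \<delta>" and G: "1 \<le> G" and K: "0 \<le> K"
    and y: "y\<^sup>2 \<le> K * G"
  shows "q * x powr (q - 1) * \<bar>y\<bar> * z \<le> \<delta> * G * x powr q + (q powr q * K powr (q / 2) * \<delta> powr (1 - q)) * z powr q"
proof -
  define T where "T = q * \<bar>y\<bar> * z"
  have T: "0 \<le> T" using q z by (simp add: T_def)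
  have \<delta>G: "0 < \<delta> * G" using \<delta> G by simp
  have nonneg: "0 \<le> \<delta> * G * x powr q" "0 \<le> (q powr q * K powr (q / 2) * \<delta> powr (1 - q)) * z powr q"
    using \<delta>G by auto
  have xq: "x powr (q - 1) * x = x powr q" using x by (cases "x = 0") (auto simp: powr_diff)
  have lhs: "q * x powr (q - 1) * \<bar>y\<bar> * z = x powr (q - 1) * T" by (simp add: T_def)
  show ?thesis
  proof (cases "T \<le> \<delta> * G * x")
    case True
    then have "x powr (q - 1) * T \<le> x powr (q - 1) * (\<delta> * G * x)" by (intro mult_left_mono) auto
    also have "\<dots> = \<delta> * G * x powr q" by (simp add: xq[symmetric] mult_ac)
    finally show ?thesis using lhs nonneg by linarith
  next
    case False
    then have Tp: "0 < T" using \<delta>G x mult_nonneg_nonneg[of "\<delta> * G" x] by linarith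
    have "x \<le> T / (\<delta> * G)" using False \<delta>G by (simp add: pos_le_divide_eq mult.commute)
    then have "x powr (q - 1) * T \<le> (T / (\<delta> * G)) powr (q - 1) * T"
      using x q T by (intro mult_right_mono powr_mono2) auto
    also have "\<dots> = T powr q * (\<delta> * G) powr (1 - q)"
      using Tp \<delta>G by (simp add: powr_divide powr_diff field_simps)
    also have "T powr q = q powr q * \<bar>y\<bar> powr q * z powr q" by (simp add: T_def powr_mult)
    also have "(\<delta> * G) powr (1 - q) = \<delta> powr (1 - q) * G powr (1 - q)" by (simp add: powr_mult)
    also have "q powr q * \<bar>y\<bar> powr q * z powr q * (\<delta> powr (1 - q) * G powr (1 - q))
        \<le> q powr q * (K * G) powr (q / 2) * z powr q * (\<delta> powr (1 - q) * G powr (1 - q))"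
    proof -
      have "\<bar>y\<bar> powr q = (y\<^sup>2) powr (q / 2)"
        by (cases "y = 0") (simp_all add: powr_def ln_realpow[of "\<bar>y\<bar>" 2, simplified])
      also have "\<dots> \<le> (K * G) powr (q / 2)" using y q by (intro powr_mono2) auto
      finally show ?thesis by (intro mult_right_mono mult_left_mono) auto
    qed
    also have "\<dots> = (q powr q * K powr (q / 2) * \<delta> powr (1 - q)) * z powr q * (G powr (q / 2) * G powr (1 - q))"
      by (simp add: powr_mult mult_ac)
    also have "\<dots> \<le> (q powr q * K powr (q / 2) * \<delta> powr (1 - q)) * z powr q * 1"
    proof (rule mult_left_mono)
      have "G powr (q / 2) * G powr (1 - q) = G powr (1 - q / 2)" using G by (simp flip: powr_add)
      also have "\<dots> \<le> G powr 0" using G q by (intro powr_mono) auto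
      finally show "G powr (q / 2) * G powr (1 - q) \<le> 1" using G by simp
    qed auto
    finally show ?thesis using lhs nonneg by linarith
  qed
qed

lemma coordinate_measurable [measurable]:
  "(\<lambda>p :: 'n::finite heis. fst p $ i) \<in> borel_measurable borel"
  "(\<lambda>p :: 'n heis. quarter_turn (fst p) i) \<in> borel_measurable borel"
  "(\<lambda>p :: 'n heis. snd p) \<in> borel_measurable borel"
  by (intro borel_measurable_continuous_onI continuous_intros)+

lemma gauge_measurable [measurable]:
  fixes e :: "'n::finite"
  shows "norm_B e \<in> borel_measurable borel" "norm_D e \<in> borel_measurable borel"
    "gauge_rad e \<in> borel_measurable borel" "potential e k \<in> borel_measurable borel"
    "log_gauge_deriv e i \<in> borel_measurable borel" "drift e i \<in> borel_measurable borel"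
proof -
  have B[measurable]: "norm_B e \<in> borel_measurable borel" and D[measurable]: "norm_D e \<in> borel_measurable borel"
    by (simp_all add: norm_B_sum[abs_def] norm_D_sum[abs_def])
  show R[measurable]: "gauge_rad e \<in> borel_measurable borel" unfolding gauge_rad_def by measurable
  show "potential e k \<in> borel_measurable borel" unfolding potential_def by measurable
  show "log_gauge_deriv e i \<in> borel_measurable borel" unfolding log_gauge_deriv_def radial_coeff_def Let_def by measurable
  show "drift e i \<in> borel_measurable borel" unfolding drift_def by measurable
  show "norm_B e \<in> borel_measurable borel" "norm_D e \<in> borel_measurable borel" by (rule B D)+
qed

lemma cutoff_measurable [measurable]: "cutoff L \<in> borel_measurable borel" "cutoff_deriv L \<in> borel_measurable borel"
  unfolding cutoff_def[abs_def] cutoff_deriv_def[abs_def] by measurable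

definition weighted_drift_deriv :: "'n::finite \<Rightarrow> real \<Rightarrow> real \<Rightarrow> 'n + 'n \<Rightarrow> 'n heis \<Rightarrow> real" where
  "weighted_drift_deriv e k L i p =
     (wt e i * (fst p $ i)\<^sup>2 + (norm_B e p - 1) + wt e i * (quarter_turn (fst p) i)\<^sup>2) * cutoff L (potential e k p)
     + drift e i p * (cutoff_deriv L (potential e k p) * (k * potential e k p * log_gauge_deriv e i p))"

lemma cutoff_potential_has_derivative:
  assumes "k \<ge> 4"
  shows "((\<lambda>s. cutoff L (potential e k (move e i s p))) has_real_derivative
    cutoff_deriv L (potential e k p) * (k * potential e k p * log_gauge_deriv e i p)) (at 0)"
  using DERIV_chain2[of "cutoff L" "cutoff_deriv L (potential e k p)" "\<lambda>s. potential e k (move e i s p)", OF _ potential_has_derivative[OF assms]]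
  by (simp add: cutoff_has_derivative)

lemma weighted_drift_has_derivative:
  assumes "k \<ge> 4"
  shows "((\<lambda>s. drift e i (move e i s p) * cutoff L (potential e k (move e i s p))) has_real_derivative
    weighted_drift_deriv e k L i p) (at 0)"
  using DERIV_mult[OF drift_has_derivative[of e i p] cutoff_potential_has_derivative[OF assms, of L e i p]]
  by (simp add: weighted_drift_deriv_def mult.commute)

text \<open>
  The sum of the \<open>weighted_drift_deriv\<close> is the divergence of $\omega(V)\, Y$. For $R > 16 (n + 2)$ one has $V \ge 2n + 4$,
  so $Y V \ge k V B / 2 \ge 2 B V$, half of which absorbs the divergence of $Y$. On the remaining ball only crude bounds
  are needed, and $V e^{-V} \le 1$ makes them independent of \<open>L\<close>.
\<close>

lemma confining_drift:
  fixes e :: "'n::finite"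
  assumes k: "k \<ge> 4" and p: "p \<noteq> 0"
  defines "n \<equiv> real CARD('n)"
  defines "R0 \<equiv> 16 * (n + 2)"
  shows "(1 + norm_B e p * potential e k p) * cutoff L (potential e k p)
    \<le> - (\<Sum>i\<in>UNIV. weighted_drift_deriv e k L i p)
       + (k + (2 * n + 5) * R0 + 1) * (if gauge_rad e p \<le> R0 then 1 else 0)"
proof -
  have n: "1 \<le> n" unfolding n_def by (rule CARD_ge_1)
  define B V w v \<tau> where "B = norm_B e p" and "V = potential e k p" and "w = cutoff L V" and "v = - cutoff_deriv L V"
    and "\<tau> = vertical_share e p"
  have B: "0 \<le> B" "B \<le> gauge_rad e p" using norm_B_nonneg[of e p] gauge_rad_bounds(1)[of e p] by (simp_all add: B_def)
  have V: "0 \<le> V" by (simp add: V_def potential_nonneg)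
  have w: "0 \<le> w" "w \<le> v" "v \<le> exp (- V)" using cutoff_nonneg cutoff_le by (simp_all add: w_def v_def)
  have Vexp: "V * exp (- V) \<le> 1"
  proof -
    have "V \<le> exp V" using exp_ge_add_one_self[of V] by linarith
    then show ?thesis by (simp add: exp_minus field_simps)
  qed
  have \<tau>: "0 \<le> \<tau>" using vertical_share_bounds(1)[OF p] by (simp add: \<tau>_def)
  have "(\<Sum>i\<in>UNIV. weighted_drift_deriv e k L i p)
      = (\<Sum>i\<in>UNIV. wt e i * (fst p $ i)\<^sup>2 + (norm_B e p - 1) + wt e i * (quarter_turn (fst p) i)\<^sup>2) * w
        + (cutoff_deriv L V * (k * V)) * (\<Sum>i\<in>UNIV. drift e i p * log_gauge_deriv e i p)"
    unfolding weighted_drift_deriv_def sum.distrib[of "\<lambda>i. _ i * cutoff L (potential e k p)"]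
    by (simp only: sum_distrib_right[symmetric] sum_distrib_left V_def w_def) (simp add: mult_ac)
  also have "\<dots> = ((2 * n + 4) * B - 2 * n) * w - v * (k * V) * (B - 1 + 2 * \<tau>)"
    unfolding drift_divergence drift_log_gauge[OF p] by (simp add: n_def B_def v_def \<tau>_def)
  finally have eq: "- (\<Sum>i\<in>UNIV. weighted_drift_deriv e k L i p) = v * (k * V) * (B - 1 + 2 * \<tau>) - ((2 * n + 4) * B - 2 * n) * w"
    by simp
  have "(1 + B * V) * w \<le> - (\<Sum>i\<in>UNIV. weighted_drift_deriv e k L i p)
       + (k + (2 * n + 5) * R0 + 1) * (if gauge_rad e p \<le> R0 then 1 else 0)"
  proof (cases "gauge_rad e p \<le> R0")
    case False
    then have R: "R0 \<le> gauge_rad e p" by simp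
    have "(16 * (n + 2))\<^sup>2 / 16 \<le> (gauge_rad e p)\<^sup>2 / 16"
      using R n by (intro divide_right_mono power_mono) (auto simp: R0_def)
    also have "\<dots> \<le> V" unfolding V_def using R n by (intro potential_lower[OF k]) (auto simp: R0_def)
    finally have "(16 * (n + 2))\<^sup>2 / 16 \<le> V" .
    moreover have "(16 * (n + 2))\<^sup>2 / 16 = 16 * (n + 2) * (n + 2)" by (simp add: power2_eq_square)
    ultimately have "16 * (n + 2) * (n + 2) \<le> V" by simp
    moreover have "2 * n + 4 \<le> 16 * (n + 2) * (n + 2)" using n by (simp add: algebra_simps)
    ultimately have V2: "2 * n + 4 \<le> V" by linarith
    have "B / 2 \<le> B - 1 + 2 * \<tau>"
      unfolding B_def \<tau>_def using R n by (intro vertical_share_bounds(2)[OF p]) (auto simp: R0_def)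
    then have "v * (k * V) * (B / 2) \<le> v * (k * V) * (B - 1 + 2 * \<tau>)"
      using w V k by (intro mult_left_mono) auto
    moreover have "w * (4 * V) * (B / 2) \<le> v * (k * V) * (B / 2)"
      using w V k B by (intro mult_right_mono mult_mono) auto
    moreover have "w * (4 * V) * (B / 2) = (2 * B * V) * w" by simp
    moreover have "(1 + B * V + ((2 * n + 4) * B - 2 * n)) * w \<le> (2 * B * V) * w"
    proof (rule mult_right_mono)
      have "(2 * n + 4) * B \<le> V * B" using V2 B by (intro mult_right_mono)
      then show "1 + B * V + ((2 * n + 4) * B - 2 * n) \<le> 2 * B * V" using n by (simp add: mult.commute)
    qed fact
    ultimately show ?thesis using False unfolding eq by (simp add: algebra_simps)
  next
    case True
    have w1: "w \<le> 1" using w V by (smt (verit) exp_le_one_iff)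
    have Vv: "v * V \<le> 1" using mult_right_mono[OF w(3) V] Vexp by (simp add: mult.commute)
    have Vw: "w * V \<le> 1" using mult_right_mono[OF w(2) V] Vv by linarith
    have "- k \<le> v * (k * V) * (B - 1 + 2 * \<tau>)"
    proof -
      have "v * (k * V) * (- 1) \<le> v * (k * V) * (B - 1 + 2 * \<tau>)"
        using w V k B \<tau> by (intro mult_left_mono) auto
      moreover have "k * (v * V) \<le> k * 1" using Vv k by (intro mult_left_mono) auto
      ultimately show ?thesis by (simp add: mult_ac)
    qed
    moreover have "((2 * n + 4) * B - 2 * n) * w \<le> ((2 * n + 4) * R0) * 1"
    proof -
      have "((2 * n + 4) * B - 2 * n) * w \<le> ((2 * n + 4) * B) * w" using w n by (intro mult_right_mono) auto
      also have "\<dots> \<le> ((2 * n + 4) * R0) * 1" using w w1 n B True by (intro mult_mono) auto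
      finally show ?thesis .
    qed
    moreover have "(1 + B * V) * w \<le> 1 + R0"
    proof -
      have "(1 + B * V) * w = w + B * (w * V)" by (simp add: algebra_simps)
      also have "\<dots> \<le> 1 + R0 * 1" using w1 Vw w V B True by (intro add_mono mult_mono) auto
      finally show ?thesis by simp
    qed
    ultimately show ?thesis using True unfolding eq by (simp add: algebra_simps)
  qed
  then show ?thesis by (simp add: B_def w_def V_def)
qed

section \<open>The weighted inequality\<close>

text \<open>
  The tail estimate with the truncated weight. It is essential that the constants do not depend on \<open>L\<close> or
  on the bound \<open>M\<close> of \<open>u\<close>; these two only ensure that the integral to be absorbed is finite.
\<close>

lemma cutoff_energy_bound:
  fixes e :: "'n::finite"
  assumes k: "k \<ge> 4" and q: "q \<ge> 2"
    and lb: "line_bound e q u \<gamma>" and M: "\<And>p. \<bar>u p\<bar> \<le> M"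
    and \<gamma>: "\<And>\<rho>. (ball_integral \<rho> \<gamma>) < \<infinity>"
  defines "n \<equiv> real CARD('n)"
  defines "R0 \<equiv> 16 * (n + 2)"
  defines "C1 \<equiv> 4 * n * (q powr q * 69696 powr (q / 2) * (1 / (8 * n)) powr (1 - q))"
    and "C2 \<equiv> 2 * (k + (2 * n + 5) * R0 + 1)"
  shows "(\<integral>\<^sup>+p. ennreal (cutoff L (potential e k p)) * abs_powr q (u p) \<partial>lborel)
    \<le> ennreal C1 * (\<integral>\<^sup>+p. ennreal (cutoff L (potential e k p)) * \<gamma> p \<partial>lborel)
      + ennreal C2 * (ball_integral (4 + R0) (\<lambda>p. abs_powr q (u p)))"
proof -
  have [measurable]: "u \<in> borel_measurable borel" "\<gamma> \<in> borel_measurable borel"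
    using lb by (auto simp: line_bound_def)
  have n: "1 \<le> n" unfolding n_def by (rule CARD_ge_1)
  have R0: "0 \<le> R0" using n by (simp add: R0_def)
  \<comment> \<open>There are \<open>2 * n\<close> fields and each contributes \<open>2 * \<delta>\<close> times the weighted integral, so exactly half of it is absorbed.\<close>
  define \<delta> where "\<delta> = 1 / (8 * n)"
  define Cy where "Cy = q powr q * 69696 powr (q / 2) * \<delta> powr (1 - q)"
  have \<delta>: "0 < \<delta>" using n by (simp add: \<delta>_def)
  have Cy: "0 \<le> Cy" by (simp add: Cy_def)
  define w W H where "w p = cutoff L (potential e k p)"
    and "W p = (1 + norm_B e p * potential e k p) * cutoff L (potential e k p)" and "H p = \<bar>u p\<bar> powr q" for p
  define d where "d i p = weighted_drift_deriv e k L i p" for i p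
  have [measurable]: "w \<in> borel_measurable borel" "W \<in> borel_measurable borel" "H \<in> borel_measurable borel"
    "d i \<in> borel_measurable borel" for i
    unfolding w_def[abs_def] W_def[abs_def] H_def[abs_def] d_def[abs_def] weighted_drift_deriv_def by measurable
  obtain \<Lambda> where \<Lambda>: "1 \<le> \<Lambda>" and sub: "\<And>(p :: 'n heis) i. potential e k p \<le> L \<Longrightarrow>
    norm p \<le> \<Lambda> \<and> norm_B e p \<le> \<Lambda> \<and> potential e k p \<le> \<Lambda> \<and> \<bar>fst p $ i\<bar> \<le> \<Lambda> \<and> \<bar>quarter_turn (fst p) i\<bar> \<le> \<Lambda>
    \<and> \<bar>drift e i p\<bar> \<le> \<Lambda> \<and> \<bar>k * potential e k p * log_gauge_deriv e i p\<bar> \<le> \<Lambda>"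
    using sublevel_bounded[OF k, of e L] by blast
  have V0: "0 \<le> potential e k p" and B0: "0 \<le> norm_B e p" for p :: "'n heis"
    by (rule potential_nonneg norm_B_nonneg)+
  have w0: "0 \<le> w p" and w1: "w p \<le> 1" and c1: "\<bar>cutoff_deriv L (potential e k p)\<bar> \<le> 1" for p :: "'n heis"
  proof -
    have "exp (- potential e k p) \<le> 1" using V0[of p] by simp
    then show "0 \<le> w p" "w p \<le> 1" "\<bar>cutoff_deriv L (potential e k p)\<bar> \<le> 1"
      using cutoff_nonneg[of L "potential e k p"] cutoff_le[of L "potential e k p"] unfolding w_def by linarith+
  qed
  \<comment> \<open>All weights vanish above the level \<open>L\<close>, so below it \<open>\<Lambda>\<close> bounds them and their derivatives.\<close>
  have supp: "L < potential e k p \<Longrightarrow> w p = 0 \<and> W p = 0 \<and> d i p = 0 \<and> cutoff_deriv L (potential e k p) = 0" for p i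
    using cutoff_eq_0[of L "potential e k p"] by (simp add: w_def W_def d_def weighted_drift_deriv_def)
  have in_sub: "potential e k p \<le> L" if "w p \<noteq> 0 \<or> W p \<noteq> 0 \<or> d i p \<noteq> 0" for p i
    using supp[of p i] that by (cases "potential e k p \<le> L") auto
  have bdd: "bounded {p :: 'n heis. potential e k p \<le> L}"
    unfolding bounded_iff using sub by blast
  have W0: "0 \<le> W p" for p unfolding W_def using V0[of p] B0[of p] cutoff_nonneg by simp
  have W1: "W p \<le> 1 + \<Lambda> * \<Lambda>" for p
  proof (cases "potential e k p \<le> L")
    case True
    then have "W p \<le> (1 + \<Lambda> * \<Lambda>) * 1"
      unfolding W_def using sub[OF True] V0[of p] B0[of p] w0[of p] w1[of p] \<Lambda>
      by (intro mult_mono add_mono) (auto simp: w_def)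
    then show ?thesis by simp
  next
    case False
    then show ?thesis using supp[of p] \<Lambda> by simp
  qed
  have sq: "\<bar>wt e i * x\<^sup>2\<bar> \<le> \<Lambda> * \<Lambda>" if "\<bar>x\<bar> \<le> \<Lambda>" for x i
  proof -
    have "\<bar>wt e i * x\<^sup>2\<bar> = wt e i * (\<bar>x\<bar> * \<bar>x\<bar>)" using wt_bounds(1)[of e i] by (simp add: abs_mult power2_eq_square)
    also have "\<dots> \<le> 1 * (\<Lambda> * \<Lambda>)" using wt_bounds[of e i] that \<Lambda> by (intro mult_mono) auto
    finally show ?thesis by simp
  qed
  have d1: "\<bar>d i p\<bar> \<le> 4 * (\<Lambda> * \<Lambda>)" for i p
  proof (cases "potential e k p \<le> L")
    case True
    note s = sub[OF True, of i]
    have \<Lambda>\<Lambda>: "\<Lambda> \<le> \<Lambda> * \<Lambda>" using \<Lambda> by simp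
    have "\<bar>norm_B e p - 1\<bar> \<le> \<Lambda> * \<Lambda>" using s B0[of p] \<Lambda> \<Lambda>\<Lambda> by linarith
    then have "\<bar>wt e i * (fst p $ i)\<^sup>2 + (norm_B e p - 1) + wt e i * (quarter_turn (fst p) i)\<^sup>2\<bar> \<le> 3 * (\<Lambda> * \<Lambda>)"
      using sq[of "fst p $ i" i] sq[of "quarter_turn (fst p) i" i] s by linarith
    then have "\<bar>(wt e i * (fst p $ i)\<^sup>2 + (norm_B e p - 1) + wt e i * (quarter_turn (fst p) i)\<^sup>2) * w p\<bar> \<le> 3 * (\<Lambda> * \<Lambda>) * 1"
      unfolding abs_mult using w0[of p] w1[of p] \<Lambda> by (intro mult_mono) auto
    moreover have "\<bar>drift e i p * (cutoff_deriv L (potential e k p) * (k * potential e k p * log_gauge_deriv e i p))\<bar> \<le> \<Lambda> * (1 * \<Lambda>)"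
      unfolding abs_mult[of "drift e i p"] abs_mult[of "cutoff_deriv L (potential e k p)"]
      using s c1[of p] \<Lambda> by (intro mult_mono) auto
    ultimately show ?thesis
      unfolding d_def weighted_drift_deriv_def w_def[symmetric] by (smt (verit) abs_triangle_ineq)
  next
    case False
    then show ?thesis using supp[of p i] \<Lambda> by simp
  qed
  have lip_w: "lipschitz_along e i w" for i
  proof (rule lipschitz_alongI)
    show "((\<lambda>s. w (move e i s p)) has_real_derivative cutoff_deriv L (potential e k p) * (k * potential e k p * log_gauge_deriv e i p)) (at 0)" for p
      unfolding w_def by (rule cutoff_potential_has_derivative[OF k])
    show "\<bar>cutoff_deriv L (potential e k p) * (k * potential e k p * log_gauge_deriv e i p)\<bar> \<le> 1 * \<Lambda>" for p
    proof (cases "potential e k p \<le> L")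
      case True
      show ?thesis unfolding abs_mult[of "cutoff_deriv L (potential e k p)"]
        using sub[OF True, of i] c1[of p] by (intro mult_mono) auto
    qed (use supp[of p] \<Lambda> in simp)
    show "bounded {p. w p \<noteq> 0}" using in_sub by (intro bounded_subset[OF bdd]) blast
  qed
  have lip_W: "lipschitz_along e i W" for i
  proof (rule lipschitz_alongI)
    let ?V' = "\<lambda>p. k * potential e k p * log_gauge_deriv e i p"
    let ?W' = "\<lambda>p. (wt e i * fst p $ i * potential e k p + ?V' p * norm_B e p) * w p
        + cutoff_deriv L (potential e k p) * ?V' p * (1 + norm_B e p * potential e k p)"
    show "((\<lambda>s. W (move e i s p)) has_real_derivative ?W' p) (at 0)" for p
    proof -
      have "((\<lambda>s. 1 + norm_B e (move e i s p) * potential e k (move e i s p)) has_real_derivative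
          0 + (wt e i * fst p $ i * potential e k (move e i 0 p) + ?V' p * norm_B e (move e i 0 p))) (at 0)"
        by (intro DERIV_add DERIV_const DERIV_mult norm_B_has_derivative potential_has_derivative[OF k])
      from DERIV_mult[OF this cutoff_potential_has_derivative[OF k, of L e i p]] show ?thesis
        by (simp add: W_def w_def mult_ac)
    qed
    show "\<bar>?W' p\<bar> \<le> 2 * (\<Lambda> * \<Lambda>) + \<Lambda> * (1 + \<Lambda> * \<Lambda>)" for p
    proof (cases "potential e k p \<le> L")
      case True
      note s = sub[OF True, of i]
      have "\<bar>wt e i * fst p $ i * potential e k p\<bar> \<le> (1 * \<Lambda>) * \<Lambda>"
        unfolding abs_mult using s wt_bounds[of e i] V0[of p] \<Lambda> by (intro mult_mono) auto
      moreover have "\<bar>?V' p * norm_B e p\<bar> \<le> \<Lambda> * \<Lambda>"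
        unfolding abs_mult[of "?V' p"] using s B0[of p] \<Lambda> by (intro mult_mono) auto
      ultimately have "\<bar>wt e i * fst p $ i * potential e k p + ?V' p * norm_B e p\<bar> \<le> 2 * (\<Lambda> * \<Lambda>)"
        by linarith
      then have 1: "\<bar>(wt e i * fst p $ i * potential e k p + ?V' p * norm_B e p) * w p\<bar> \<le> 2 * (\<Lambda> * \<Lambda>) * 1"
        unfolding abs_mult[of _ "w p"] using w0[of p] w1[of p] \<Lambda> by (intro mult_mono) auto
      have "\<bar>cutoff_deriv L (potential e k p) * ?V' p\<bar> \<le> 1 * \<Lambda>"
        unfolding abs_mult[of "cutoff_deriv L (potential e k p)"] using s c1[of p] by (intro mult_mono) auto
      moreover have "\<bar>1 + norm_B e p * potential e k p\<bar> \<le> 1 + \<Lambda> * \<Lambda>"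
        using s B0[of p] V0[of p] \<Lambda> mult_mono[of "norm_B e p" \<Lambda> "potential e k p" \<Lambda>] by simp
      ultimately have "\<bar>cutoff_deriv L (potential e k p) * ?V' p * (1 + norm_B e p * potential e k p)\<bar> \<le> (1 * \<Lambda>) * (1 + \<Lambda> * \<Lambda>)"
        unfolding abs_mult[of _ "1 + norm_B e p * potential e k p"] using \<Lambda> by (intro mult_mono) auto
      with 1 show ?thesis by linarith
    qed (use supp[of p] \<Lambda> in simp)
    show "bounded {p. W p \<noteq> 0}" using in_sub by (intro bounded_subset[OF bdd]) blast
  qed
  have deriv: "((\<lambda>s. drift e i (move e i s p) * w (move e i s p)) has_real_derivative d i p) (at 0)" for i p
    unfolding w_def d_def by (rule weighted_drift_has_derivative[OF k])
  have supp_\<psi>: "bounded {p. drift e i p * w p \<noteq> 0}" for i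
    using in_sub by (intro bounded_subset[OF bdd]) auto
  have lip_\<psi>: "lipschitz_along e i (\<lambda>p. drift e i p * w p)" for i
    by (rule lipschitz_alongI[OF deriv d1 supp_\<psi>])
  have \<psi>1: "\<bar>drift e i p * w p\<bar> \<le> \<Lambda>" for i p
  proof (cases "potential e k p \<le> L")
    case True
    then have "\<bar>drift e i p\<bar> * \<bar>w p\<bar> \<le> \<Lambda> * 1" using sub[OF True, of i] w0[of p] w1[of p] \<Lambda> by (intro mult_mono) auto
    then show ?thesis by (simp add: abs_mult)
  qed (use supp[of p] \<Lambda> in simp)
  have young: "q * x powr (q - 1) * \<bar>drift e i p * w p\<bar> * z \<le> \<delta> * W p * x powr q + Cy * w p * z powr q"
    if "0 \<le> x" "0 \<le> z" for x z i p
  proof -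
    have "q * x powr (q - 1) * \<bar>drift e i p\<bar> * z \<le> \<delta> * (1 + norm_B e p * potential e k p) * x powr q + Cy * z powr q"
      unfolding Cy_def using q that \<delta> V0[of p] B0[of p] by (intro weighted_young drift_bound[OF k]) auto
    from mult_right_mono[OF this w0[of p]] show ?thesis
      using w0[of p] by (simp add: abs_mult W_def w_def algebra_simps)
  qed
  have H0: "0 \<le> H p" "H p \<le> M powr q" for p
    using M[of p] q by (auto simp: H_def intro!: powr_mono2)
  have iWH: "integrable lborel (\<lambda>p. W p * H p)"
  proof (rule integrable_if_bounded_on_bounded_support)
    show "\<bar>W p * H p\<bar> \<le> (1 + \<Lambda> * \<Lambda>) * M powr q" for p
      unfolding abs_mult using W0[of p] W1[of p] H0[of p] \<Lambda> by (intro mult_mono) auto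
    show "W p * H p \<noteq> 0 \<Longrightarrow> norm p \<le> \<Lambda>" for p using in_sub[of p] sub[of p] by auto
  qed measurable
  have idH: "integrable lborel (\<lambda>p. H p * d i p)" for i
  proof (rule integrable_if_bounded_on_bounded_support)
    show "\<bar>H p * d i p\<bar> \<le> M powr q * (4 * (\<Lambda> * \<Lambda>))" for p
      unfolding abs_mult using d1[of i p] H0[of p] by (intro mult_mono) auto
    show "H p * d i p \<noteq> 0 \<Longrightarrow> norm p \<le> \<Lambda>" for p using in_sub[of p i] sub[of p] by auto
  qed measurable
  let ?K = "cball (0 :: 'n heis) (4 + R0)"
  have iKH: "integrable lborel (\<lambda>p. indicator ?K p * H p)"
  proof (rule integrable_if_bounded_on_bounded_support)
    show "\<bar>indicator ?K p * H p\<bar> \<le> 1 * M powr q" for p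
      unfolding abs_mult using H0[of p] by (intro mult_mono) auto
    show "indicator ?K p * H p \<noteq> 0 \<Longrightarrow> norm p \<le> 4 + R0" for p by (auto simp: indicator_def split: if_splits)
  qed measurable
  define a where "a = (LINT p|lborel. W p * H p)"
  define h where "h = (LINT p|lborel. indicator ?K p * H p)"
  have a: "0 \<le> a" "(\<integral>\<^sup>+p. ennreal (W p) * abs_powr q (u p) \<partial>lborel) = ennreal a"
  proof -
    show "0 \<le> a" unfolding a_def using W0 H0 by simp
    have "(\<integral>\<^sup>+p. ennreal (W p * H p) \<partial>lborel) = ennreal a"
      unfolding a_def using W0 H0 by (intro nn_integral_eq_integral iWH) auto
    then show "(\<integral>\<^sup>+p. ennreal (W p) * abs_powr q (u p) \<partial>lborel) = ennreal a"
      using W0 by (simp add: ennreal_mult' H_def)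
  qed
  have h: "0 \<le> h" "(\<integral>\<^sup>+p. indicator ?K p * abs_powr q (u p) \<partial>lborel) = ennreal h"
  proof -
    show "0 \<le> h" unfolding h_def using H0 by simp
    have "(\<integral>\<^sup>+p. ennreal (indicator ?K p * H p) \<partial>lborel) = ennreal h"
      unfolding h_def using H0 by (intro nn_integral_eq_integral iKH) auto
    moreover have "ennreal (indicator ?K p * H p) = indicator ?K p * abs_powr q (u p)" for p
      by (simp add: H_def indicator_def)
    ultimately show "(\<integral>\<^sup>+p. indicator ?K p * abs_powr q (u p) \<partial>lborel) = ennreal h" by simp
  qed
  define g where "g = enn2real (\<integral>\<^sup>+p. ennreal (w p) * \<gamma> p \<partial>lborel)"
  have g: "0 \<le> g" "(\<integral>\<^sup>+p. ennreal (w p) * \<gamma> p \<partial>lborel) = ennreal g"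
  proof -
    have "(\<integral>\<^sup>+p. ennreal (w p) * \<gamma> p \<partial>lborel) \<le> (ball_integral \<Lambda> \<gamma>)"
    proof (intro nn_integral_mono mult_right_mono)
      fix p :: "'n heis"
      show "ennreal (w p) \<le> indicator (cball 0 \<Lambda>) p"
        using in_sub[of p] sub[of p] w1[of p] by (cases "w p = 0") (auto simp: ennreal_le_1)
    qed simp
    also have "\<dots> < \<infinity>" by (rule \<gamma>)
    finally show "0 \<le> g" "(\<integral>\<^sup>+p. ennreal (w p) * \<gamma> p \<partial>lborel) = ennreal g" by (auto simp: g_def)
  qed
  have bound: "\<bar>LINT p|lborel. H p * d i p\<bar> \<le> 2 * \<delta> * a + Cy * g" for i
    unfolding H_def
    by (rule integration_by_parts_bound[OF _ lb M \<gamma>, of w W "\<lambda>p. drift e i p * w p" "d i" i \<Lambda> \<delta> Cy])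
       (use q w0 W0 lip_w lip_W lip_\<psi> \<psi>1 supp_\<psi> deriv \<delta> Cy young a g in auto)
  have "a \<le> (LINT p|lborel. (\<Sum>i\<in>UNIV. - (H p * d i p)) + C2 / 2 * (indicator ?K p * H p))"
    unfolding a_def
  proof (rule integral_mono_AE[OF iWH])
    show "integrable lborel (\<lambda>p. (\<Sum>i\<in>UNIV. - (H p * d i p)) + C2 / 2 * (indicator ?K p * H p))"
      using idH iKH by (intro Bochner_Integration.integrable_add Bochner_Integration.integrable_sum Bochner_Integration.integrable_minus integrable_mult_right) auto
    \<comment> \<open>The formula for \<open>log_gauge\<close> breaks down at the origin, a null set.\<close>
    have "AE p :: 'n heis in lborel. p \<noteq> 0" using AE_lborel_singleton[of "0 :: 'n heis"] .
    then show "AE p in lborel. W p * H p \<le> (\<Sum>i\<in>UNIV. - (H p * d i p)) + C2 / 2 * (indicator ?K p * H p)"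
    proof eventually_elim
      case (elim p)
      have C2: "0 \<le> C2 / 2" using k n R0 by (simp add: C2_def)
      have "W p \<le> - (\<Sum>i\<in>UNIV. d i p) + C2 / 2 * (if gauge_rad e p \<le> R0 then 1 else 0)"
      proof -
        have "C2 / 2 = k + (2 * n + 5) * R0 + 1" by (simp add: C2_def)
        then show ?thesis unfolding W_def d_def
          by (simp only:) (rule confining_drift[OF k elim, where e=e and L=L, folded n_def, folded R0_def])
      qed
      also have "\<dots> \<le> - (\<Sum>i\<in>UNIV. d i p) + C2 / 2 * indicator ?K p"
        using gauge_rad_sublevel_bounded[of e p R0] C2 by (intro add_left_mono mult_left_mono) auto
      finally have "W p * H p \<le> (- (\<Sum>i\<in>UNIV. d i p) + C2 / 2 * indicator ?K p) * H p"
        using H0 by (intro mult_right_mono)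
      also have "\<dots> = (\<Sum>i\<in>UNIV. - (H p * d i p)) + C2 / 2 * (indicator ?K p * H p)"
        by (simp add: sum_negf sum_distrib_left algebra_simps)
      finally show ?case .
    qed
  qed
  also have "\<dots> = (\<Sum>i\<in>UNIV. - (LINT p|lborel. H p * d i p)) + C2 / 2 * h"
    using idH iKH by (simp add: h_def sum_negf)
  also have "\<dots> \<le> (\<Sum>i\<in>(UNIV :: ('n + 'n) set). 2 * \<delta> * a + Cy * g) + C2 / 2 * h"
  proof (intro add_right_mono sum_mono)
    fix i show "- (LINT p|lborel. H p * d i p) \<le> 2 * \<delta> * a + Cy * g"
      using bound[of i] by linarith
  qed
  also have "\<dots> = a / 2 + 2 * n * Cy * g + C2 / 2 * h"
    using n by (simp add: \<delta>_def n_def card_sum field_simps)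
  finally have "a \<le> C1 * g + C2 * h"
    by (simp add: C1_def Cy_def \<delta>_def field_simps)
  have "(\<integral>\<^sup>+p. ennreal (w p) * abs_powr q (u p) \<partial>lborel) \<le> (\<integral>\<^sup>+p. ennreal (W p) * abs_powr q (u p) \<partial>lborel)"
  proof (intro nn_integral_mono mult_right_mono ennreal_leI)
    fix p :: "'n heis"
    have "1 * w p \<le> (1 + norm_B e p * potential e k p) * w p"
      using V0[of p] B0[of p] w0[of p] by (intro mult_right_mono) auto
    then show "w p \<le> W p" by (simp add: W_def w_def)
  qed simp
  also have "\<dots> \<le> ennreal (C1 * g + C2 * h)"
    unfolding a(2) by (rule ennreal_leI) fact
  also have "\<dots> = ennreal C1 * ennreal g + ennreal C2 * ennreal h"
  proof -
    have "0 \<le> C1" "0 \<le> C2" using n k R0 by (simp_all add: C1_def C2_def)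
    then show ?thesis using g h by (simp add: ennreal_mult)
  qed
  finally show ?thesis unfolding g(2)[symmetric] h(2)[symmetric] by (simp add: w_def)
qed

text \<open>
  Truncations are contractions, so they inherit the bound with the same \<open>\<gamma>\<close>.
\<close>

lemma line_bound_contraction:
  assumes lb: "line_bound e q f \<gamma>" and q: "0 \<le> q" and u: "u \<in> borel_measurable borel"
    and le: "\<And>p p'. \<bar>u p - u p'\<bar> \<le> \<bar>f p - f p'\<bar>"
  shows "line_bound e q u \<gamma>"
  unfolding line_bound_def
proof (intro conjI allI impI)
  show "u \<in> borel_measurable borel" "\<gamma> \<in> borel_measurable borel" using lb u by (auto simp: line_bound_def)
  fix i and s :: real and w :: "'a heis \<Rightarrow> ennreal"
  assume s: "0 < s" and w: "w \<in> borel_measurable borel"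
  have "(\<integral>\<^sup>+p. w p * abs_powr q (u (move e i s p) - u p) \<partial>lborel)
      \<le> (\<integral>\<^sup>+p. w p * abs_powr q (f (move e i s p) - f p) \<partial>lborel)"
    using q le by (intro nn_integral_mono mult_left_mono ennreal_leI powr_mono2) auto
  also note line_boundD[OF lb s w]
  finally show "(\<integral>\<^sup>+p. w p * abs_powr q (u (move e i s p) - u p) \<partial>lborel)
    \<le> ennreal (s powr (q - 1)) *
       (\<integral>\<^sup>+r. indicator {0..s} r * (\<integral>\<^sup>+p. w (move e i (- r) p) * \<gamma> p \<partial>lborel) \<partial>lborel)" .
qed

lemma cball_le_weight:
  fixes e :: "'n::finite"
  assumes k: "k \<ge> 4"
  obtains c where "0 \<le> c" "\<And>p. (indicator (cball 0 \<rho>) p :: ennreal) \<le> ennreal c * ennreal (exp (- potential e k p))"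
proof -
  define r where "r = \<rho>\<^sup>2 + \<bar>\<rho>\<bar>"
  define c where "c = exp ((2 * r) powr (k / 2))"
  have "(indicator (cball 0 \<rho>) p :: ennreal) \<le> ennreal c * ennreal (exp (- potential e k p))" for p
  proof (cases "p \<in> cball 0 \<rho>")
    case True
    then have p: "norm p \<le> \<bar>\<rho>\<bar>" by simp
    have "norm_B e p \<le> norm_A e p" by (rule norm_AB_bounds)
    also have "norm_A e p = (norm (fst p))\<^sup>2 / 2" by (simp add: norm_A_sum norm_vec_def L2_set_def sum_nonneg)
    also have "\<dots> \<le> (norm (fst p))\<^sup>2" by simp
    also have "\<dots> \<le> (norm p)\<^sup>2"
      using power_mono[OF norm_fst_le[of "fst p" "snd p"], of 2] by simp
    also have "\<dots> \<le> \<rho>\<^sup>2" using power_mono[OF p, of 2] by simp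
    finally have B: "norm_B e p \<le> \<rho>\<^sup>2" .
    have t: "\<bar>snd p\<bar> \<le> \<bar>\<rho>\<bar>" using norm_snd_le[of "snd p" "fst p"] p by simp
    have "gauge_rad e p \<le> norm_B e p + \<bar>snd p\<bar>"
      unfolding gauge_rad_def using sqrt_sum_squares_le_sum_abs[of "norm_B e p" "snd p"] norm_B_nonneg[of e p] by simp
    then have R: "gauge_rad e p \<le> r" using B t by (simp add: r_def)
    have "potential e k p \<le> (2 * gauge_rad e p) powr (k / 2)" by (rule potential_upper[OF k])
    also have "\<dots> \<le> (2 * r) powr (k / 2)" using R gauge_rad_bounds(3)[of e p] k by (intro powr_mono2) auto
    finally have "1 \<le> c * exp (- potential e k p)" by (simp add: c_def flip: exp_add)
    then show ?thesis using True by (simp add: c_def flip: ennreal_mult)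
  qed simp
  then show thesis by (rule that[rotated]) (simp add: c_def)
qed

lemma weighted_energy_bound:
  fixes e :: "'n::finite"
  assumes k: "k \<ge> 4" and q: "q \<ge> 2"
  obtains C \<rho> where "0 \<le> C" "0 < \<rho>" "\<And>u \<gamma> M. line_bound e q u \<gamma> \<Longrightarrow> (\<And>p. \<bar>u p\<bar> \<le> M) \<Longrightarrow>
    (\<And>\<rho>'. (ball_integral \<rho>' \<gamma>) < \<infinity>) \<Longrightarrow>
    (gibbs_integral e k (\<lambda>p. abs_powr q (u p)))
    \<le> ennreal C * ((gibbs_integral e k \<gamma>)
       + (ball_integral \<rho> (\<lambda>p. abs_powr q (u p))))"
proof -
  define n where "n = real CARD('n)"
  have n: "1 \<le> n" unfolding n_def by (rule CARD_ge_1)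
  define R0 where "R0 = 16 * (n + 2)"
  define C1 where "C1 = 4 * n * (q powr q * 69696 powr (q / 2) * (1 / (8 * n)) powr (1 - q))"
  define C2 where "C2 = 2 * (k + (2 * n + 5) * R0 + 1)"
  define C where "C = max C1 C2"
  have C: "0 \<le> C" "C1 \<le> C" "C2 \<le> C" using n by (auto simp: C_def C1_def le_max_iff_disj)
  have "(gibbs_integral e k (\<lambda>p. abs_powr q (u p)))
    \<le> ennreal C * ((gibbs_integral e k \<gamma>)
       + (ball_integral (4 + R0) (\<lambda>p. abs_powr q (u p))))"
    if lb: "line_bound e q u \<gamma>" and M: "\<And>p. \<bar>u p\<bar> \<le> M"
      and \<gamma>: "\<And>\<rho>'. (ball_integral \<rho>' \<gamma>) < \<infinity>" for u \<gamma> M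
  proof (rule LIMSEQ_le_const2)
    have [measurable]: "u \<in> borel_measurable borel" using lb by (auto simp: line_bound_def)
    show "(\<lambda>m. \<integral>\<^sup>+p. ennreal (cutoff (real m) (potential e k p)) * abs_powr q (u p) \<partial>lborel)
      \<longlonglongrightarrow> (gibbs_integral e k (\<lambda>p. abs_powr q (u p)))"
    proof (rule nn_integral_LIMSEQ)
      show "incseq (\<lambda>m p. ennreal (cutoff (real m) (potential e k p)) * abs_powr q (u p))"
        by (intro incseq_SucI le_funI mult_right_mono ennreal_leI cutoff_mono) auto
      show "(\<lambda>m. ennreal (cutoff (real m) (potential e k p)) * abs_powr q (u p))
          \<longlonglongrightarrow> ennreal (exp (- potential e k p)) * abs_powr q (u p)" for p
        using tendsto_ennrealI[OF tendsto_mult[OF cutoff_tendsto tendsto_const[of "\<bar>u p\<bar> powr q"]]]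
        by (simp add: ennreal_mult cutoff_nonneg)
    qed measurable
    have "(\<integral>\<^sup>+p. ennreal (cutoff (real m) (potential e k p)) * abs_powr q (u p) \<partial>lborel)
      \<le> ennreal C * ((gibbs_integral e k \<gamma>)
       + (ball_integral (4 + R0) (\<lambda>p. abs_powr q (u p))))" for m
    proof -
      have "(\<integral>\<^sup>+p. ennreal (cutoff (real m) (potential e k p)) * abs_powr q (u p) \<partial>lborel)
        \<le> ennreal C1 * (\<integral>\<^sup>+p. ennreal (cutoff (real m) (potential e k p)) * \<gamma> p \<partial>lborel)
        + ennreal C2 * (ball_integral (4 + R0) (\<lambda>p. abs_powr q (u p)))"
        using cutoff_energy_bound[OF k q lb M \<gamma>, of "real m"] unfolding C1_def C2_def R0_def n_def by simp
      also have "\<dots> \<le> ennreal C * (gibbs_integral e k \<gamma>)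
        + ennreal C * (ball_integral (4 + R0) (\<lambda>p. abs_powr q (u p)))"
        using C cutoff_le[of "real m"]
        by (intro add_mono mult_mono nn_integral_mono ennreal_leI) (auto intro: order_trans)
      finally show ?thesis by (simp add: distrib_left)
    qed
    then show "\<exists>N. \<forall>m\<ge>N. (\<integral>\<^sup>+p. ennreal (cutoff (real m) (potential e k p)) * abs_powr q (u p) \<partial>lborel)
      \<le> ennreal C * ((gibbs_integral e k \<gamma>)
       + (ball_integral (4 + R0) (\<lambda>p. abs_powr q (u p))))" by blast
  qed
  moreover have "0 < 4 + R0" using n by (simp add: R0_def)
  ultimately show thesis using C(1) that by blast
qed

text \<open>
  The truncations of $f - m$ are bounded, so the tail estimate applies to them; the ball integral that it leaves is
  at most that of $f - m$ and is controlled by the local inequality. The constants do not depend on the level of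
  the truncation, which is then sent to infinity.
\<close>

lemma weighted_poincare:
  fixes e :: "'n::finite"
  assumes k: "k \<ge> 4" and q: "q \<ge> 2"
  obtains C where "0 \<le> C" "\<And>f \<gamma>. line_bound e q f \<gamma> \<Longrightarrow>
    (gibbs_integral e k \<gamma>) < \<infinity> \<Longrightarrow>
    \<exists>m. (gibbs_integral e k (\<lambda>p. abs_powr q (f p - m)))
      \<le> ennreal C * (gibbs_integral e k \<gamma>)"
proof -
  obtain C \<rho> where C: "0 \<le> C" "0 < \<rho>" and energy: "\<And>u \<gamma> M. line_bound e q u \<gamma> \<Longrightarrow> (\<And>p. \<bar>u p\<bar> \<le> M) \<Longrightarrow>
    (\<And>\<rho>'. (ball_integral \<rho>' \<gamma>) < \<infinity>) \<Longrightarrow>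
    (gibbs_integral e k (\<lambda>p. abs_powr q (u p)))
    \<le> ennreal C * ((gibbs_integral e k \<gamma>)
       + (ball_integral \<rho> (\<lambda>p. abs_powr q (u p))))"
    using weighted_energy_bound[OF k q, where e=e] by blast
  have q1: "1 < q" using q by simp
  obtain K \<rho>' where K: "0 \<le> K" and local: "\<And>f \<gamma>. line_bound e q f \<gamma> \<Longrightarrow>
    \<exists>m. (ball_integral \<rho> (\<lambda>p. abs_powr q (f p - m)))
        \<le> ennreal K * (ball_integral \<rho>' \<gamma>)"
    using local_poincare[OF q1 C(2), where e=e] by blast
  obtain c where c: "0 \<le> c" "\<And>p. (indicator (cball 0 \<rho>') p :: ennreal) \<le> ennreal c * ennreal (exp (- potential e k p))"
    using cball_le_weight[OF k, where e=e and \<rho>=\<rho>'] by blast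
  have "\<exists>m. (gibbs_integral e k (\<lambda>p. abs_powr q (f p - m)))
      \<le> ennreal (C * (1 + K * c)) * (gibbs_integral e k \<gamma>)"
    if lb: "line_bound e q f \<gamma>" and fin: "(gibbs_integral e k \<gamma>) < \<infinity>" for f \<gamma>
  proof -
    have [measurable]: "f \<in> borel_measurable borel" "\<gamma> \<in> borel_measurable borel"
      using lb by (auto simp: line_bound_def)
    let ?E = "\<integral>\<^sup>+p. ennreal (exp (- potential e k p)) * \<gamma> p \<partial>lborel"
    have ball_le: "(ball_integral r \<gamma>) \<le> ennreal b * ?E"
      if "\<And>p. (indicator (cball 0 r) p :: ennreal) \<le> ennreal b * ennreal (exp (- potential e k p))" for b r
    proof -
      have "(ball_integral r \<gamma>) \<le> (\<integral>\<^sup>+p. ennreal b * (ennreal (exp (- potential e k p)) * \<gamma> p) \<partial>lborel)"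
        unfolding mult.assoc[symmetric] by (intro nn_integral_mono mult_right_mono that) simp
      also have "\<dots> = ennreal b * ?E" by (rule nn_integral_cmult) measurable
      finally show ?thesis .
    qed
    have loc: "(ball_integral r \<gamma>) < \<infinity>" for r
    proof -
      obtain b where b: "\<And>p. (indicator (cball 0 r) p :: ennreal) \<le> ennreal b * ennreal (exp (- potential e k p))"
        using cball_le_weight[OF k, where e=e and \<rho>=r] by blast
      have "ennreal b * ?E < \<infinity>" using fin by (simp add: ennreal_mult_less_top)
      with ball_le[OF b] show ?thesis by (rule le_less_trans)
    qed
    obtain m where m: "(ball_integral \<rho> (\<lambda>p. abs_powr q (f p - m)))
        \<le> ennreal K * (ball_integral \<rho>' \<gamma>)"
      using local[OF lb] by blast
    define u where "u j p = max (- real j) (min (real j) (f p - m))" for j p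
    have [measurable]: "u j \<in> borel_measurable borel" for j unfolding u_def[abs_def] by measurable
    have abs_u: "\<bar>u j p\<bar> = min (real j) \<bar>f p - m\<bar>" for j p by (auto simp: u_def)
    have uj: "(gibbs_integral e k (\<lambda>p. abs_powr q (u j p)))
        \<le> ennreal (C * (1 + K * c)) * ?E" for j
    proof -
      have "line_bound e q (u j) \<gamma>"
        by (rule line_bound_contraction[OF lb]) (use q in \<open>auto simp: u_def\<close>)
      then have "(gibbs_integral e k (\<lambda>p. abs_powr q (u j p)))
          \<le> ennreal C * (?E + (ball_integral \<rho> (\<lambda>p. abs_powr q (u j p))))"
        by (rule energy[of _ _ "real j", OF _ _ loc]) (auto simp: abs_u)
      also have "\<dots> \<le> ennreal C * (?E + (ball_integral \<rho> (\<lambda>p. abs_powr q (f p - m))))"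
        using q by (intro mult_left_mono add_left_mono nn_integral_mono ennreal_leI powr_mono2) (auto simp: abs_u)
      also have "\<dots> \<le> ennreal C * (?E + ennreal K * (ennreal c * ?E))"
        using order_trans[OF m mult_left_mono[OF ball_le[OF c(2)]]] by (intro mult_left_mono add_left_mono) auto
      also have "\<dots> = ennreal (C * (1 + K * c)) * ?E"
        using C(1) K c(1) by (simp add: ennreal_mult distrib_left distrib_right mult.assoc)
      finally show ?thesis .
    qed
    have "(gibbs_integral e k (\<lambda>p. abs_powr q (f p - m))) \<le> ennreal (C * (1 + K * c)) * ?E"
    proof (rule LIMSEQ_le_const2)
      show "(\<lambda>j. \<integral>\<^sup>+p. ennreal (exp (- potential e k p)) * abs_powr q (u j p) \<partial>lborel)
        \<longlonglongrightarrow> (gibbs_integral e k (\<lambda>p. abs_powr q (f p - m)))"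
      proof (rule nn_integral_LIMSEQ)
        show "incseq (\<lambda>j p. ennreal (exp (- potential e k p)) * abs_powr q (u j p))"
          using q by (intro incseq_SucI le_funI mult_left_mono ennreal_leI powr_mono2) (auto simp: abs_u)
        show "(\<lambda>j. ennreal (exp (- potential e k p)) * abs_powr q (u j p))
          \<longlonglongrightarrow> ennreal (exp (- potential e k p)) * abs_powr q (f p - m)" for p
        proof (rule tendsto_eventually)
          have "\<forall>\<^sub>F j in sequentially. \<bar>f p - m\<bar> \<le> real j"
            using eventually_ge_at_top[of "nat \<lceil>\<bar>f p - m\<bar>\<rceil>"] by eventually_elim linarith
          then show "\<forall>\<^sub>F j in sequentially. ennreal (exp (- potential e k p)) * abs_powr q (u j p)
             = ennreal (exp (- potential e k p)) * abs_powr q (f p - m)"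
            by eventually_elim (simp add: abs_u min_def)
        qed
      qed measurable
      show "\<exists>N. \<forall>j\<ge>N. (gibbs_integral e k (\<lambda>p. abs_powr q (u j p)))
         \<le> ennreal (C * (1 + K * c)) * ?E"
        using uj by blast
    qed
    then show ?thesis by blast
  qed
  moreover have "0 \<le> C * (1 + K * c)" using C(1) K c(1) by simp
  ultimately show thesis using that by blast
qed

lemma nn_integral_heis_mu:
  fixes e :: "'n::finite"
  assumes [measurable]: "h \<in> borel_measurable lebesgue"
  shows "(\<integral>\<^sup>+p. h p \<partial>heis_mu e k) = ennreal (1 / heis_Z e k) * (gibbs_integral e k h)"
proof -
  have Z: "0 \<le> heis_Z e k" unfolding heis_Z_def by (intro integral_nonneg_AE) simp
  have pm: "potential e k \<in> borel_measurable lebesgue" by (intro measurable_completion) measurable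
  have [measurable]: "(\<lambda>p. ennreal (exp (- potential e k p))) \<in> borel_measurable lebesgue"
    using pm by measurable
  have "heis_mu e k = density lebesgue (\<lambda>p. ennreal (1 / heis_Z e k) * ennreal (exp (- potential e k p)))"
    unfolding heis_mu_def potential_def using Z by (simp flip: ennreal_mult)
  then have "(\<integral>\<^sup>+p. h p \<partial>heis_mu e k) = (\<integral>\<^sup>+p. ennreal (1 / heis_Z e k) * ennreal (exp (- potential e k p)) * h p \<partial>lebesgue)"
    by (simp only:) (rule nn_integral_density; measurable)
  also have "\<dots> = ennreal (1 / heis_Z e k) * (\<integral>\<^sup>+p. ennreal (exp (- potential e k p)) * h p \<partial>lebesgue)"
    unfolding mult.assoc by (rule nn_integral_cmult) measurable
  finally show ?thesis by (simp add: nn_integral_completion)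
qed

lemma heis_Z_pos:
  fixes e :: "'n::finite"
  assumes "k \<ge> 4"
  shows "heis_Z e k > 0"
proof (rule ccontr)
  assume "\<not> heis_Z e k > 0"
  moreover have "0 \<le> heis_Z e k" unfolding heis_Z_def by (intro integral_nonneg_AE) simp
  ultimately have "heis_Z e k = 0" by simp
  then have "emeasure (heis_mu e k) (space (heis_mu e k)) = 0"
    using nn_integral_heis_mu[of "\<lambda>_. 1" e k] by simp
  then show False using prob_space.emeasure_space_1[OF prob_space_heis_mu[OF assms, of e]] by simp
qed

theorem corollary6:
  fixes e :: "'n::finite" and k q :: real
  assumes "CARD('n) > 5" and "k \<ge> 4" and "q \<ge> 2"
  shows "\<exists>c::real. c > 0 \<and>
    (\<forall>(f :: 'n heis \<Rightarrow> real) (g :: 'n heis \<Rightarrow> real ^ ('n + 'n)).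
      integrable (heis_mu e k) f \<longrightarrow> weak_subgradient e f g \<longrightarrow>
      (\<integral>\<^sup>+p. ennreal (\<bar>f p - (LINT p'|heis_mu e k. f p')\<bar> powr q) \<partial>heis_mu e k)
      \<le> ennreal c * (\<integral>\<^sup>+p. ennreal (norm (g p) powr q) \<partial>heis_mu e k))"
proof -
  note k = assms(2) and q = assms(3)
  have q1: "1 < q" using q by simp
  let ?\<mu> = "heis_mu e k"
  interpret \<mu>: prob_space ?\<mu> by (rule prob_space_heis_mu[OF k])
  obtain C where C: "0 \<le> C" and poincare: "\<And>f \<gamma>. line_bound e q f \<gamma> \<Longrightarrow>
    (gibbs_integral e k \<gamma>) < \<infinity> \<Longrightarrow>
    \<exists>m. (gibbs_integral e k (\<lambda>p. abs_powr q (f p - m)))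
      \<le> ennreal C * (gibbs_integral e k \<gamma>)"
    using weighted_poincare[OF k q, where e=e] by blast
  define c where "c = 2 powr q * (2 * C) + 1"
  have c: "0 < c" using C by (simp add: c_def add_nonneg_pos)
  have "(\<integral>\<^sup>+p. abs_powr q (f p - (LINT p'|?\<mu>. f p')) \<partial>?\<mu>) \<le> ennreal c * (\<integral>\<^sup>+p. ennreal (norm (g p) powr q) \<partial>?\<mu>)"
    if int: "integrable ?\<mu> f" and wsg: "weak_subgradient e f g" for f :: "'n heis \<Rightarrow> real" and g
  proof (cases "(\<integral>\<^sup>+p. ennreal (norm (g p) powr q) \<partial>?\<mu>) = \<infinity>")
    case True
    then show ?thesis using c by (simp add: ennreal_mult_top)
  next
    case False
    have f: "f \<in> borel_measurable lebesgue" and g: "g \<in> borel_measurable lebesgue"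
      using wsg unfolding weak_subgradient_def by (auto intro: locally_integrable_imp_lebesgue_measurable)
    obtain f' where f'[measurable]: "f' \<in> borel_measurable borel" and ff: "AE p in lborel. f p = f' p"
      using completion_ex_borel_measurable_real[OF f] by auto
    obtain g' where g'[measurable]: "g' \<in> borel_measurable borel" and gg: "AE p in lborel. g p = g' p"
      using lebesgue_measurable_borel_version[OF g] by auto
    let ?\<gamma> = "\<lambda>p. ennreal (norm (g' p) powr q)"
    let ?E = "\<integral>\<^sup>+p. ennreal (exp (- potential e k p)) * ?\<gamma> p \<partial>lborel"
    let ?Z = "ennreal (1 / heis_Z e k)"
    have lb: "line_bound e q f' ?\<gamma>"
      by (rule weak_subgradient_line_bound[OF weak_subgradient_cong_AE[OF wsg f' g' ff gg] q1]) measurable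
    have mg: "(\<lambda>p. ennreal (norm (g p) powr q)) \<in> borel_measurable lebesgue" using g by measurable
    have mf: "(\<lambda>p. abs_powr q (f p - a)) \<in> borel_measurable lebesgue" for a using f by measurable
    have G: "(\<integral>\<^sup>+p. ennreal (norm (g p) powr q) \<partial>?\<mu>) = ?Z * ?E"
      unfolding nn_integral_heis_mu[OF mg]
      by (intro arg_cong2[where f="(*)"] refl nn_integral_cong_AE) (use gg in \<open>eventually_elim, simp\<close>)
    have "?E < \<infinity>"
      using False heis_Z_pos[OF k, of e] unfolding G by (auto simp: ennreal_mult_eq_top_iff less_top)
    from poincare[OF lb this] obtain m where
      m: "(gibbs_integral e k (\<lambda>p. abs_powr q (f' p - m))) \<le> ennreal C * ?E" ..
    have "(\<integral>\<^sup>+p. abs_powr q (f p - m) \<partial>?\<mu>)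
        = ?Z * (gibbs_integral e k (\<lambda>p. abs_powr q (f' p - m)))"
      unfolding nn_integral_heis_mu[OF mf]
      by (intro arg_cong2[where f="(*)"] refl nn_integral_cong_AE) (use ff in \<open>eventually_elim, simp\<close>)
    also have "\<dots> \<le> ?Z * (ennreal C * ?E)" by (intro mult_left_mono m) simp
    also have "\<dots> = ennreal C * (\<integral>\<^sup>+p. ennreal (norm (g p) powr q) \<partial>?\<mu>)" unfolding G by (simp add: mult_ac)
    finally have fm: "(\<integral>\<^sup>+p. abs_powr q (f p - m) \<partial>?\<mu>) \<le> ennreal C * (\<integral>\<^sup>+p. ennreal (norm (g p) powr q) \<partial>?\<mu>)" .
    let ?F = "\<integral>\<^sup>+p. abs_powr q (f p - m) \<partial>?\<mu>"
    let ?b = "\<mu>.expectation f"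
    have fmeas[measurable]: "f \<in> borel_measurable ?\<mu>" using int by simp
    have mean: "abs_powr q (m - ?b) \<le> ?F"
    proof -
      have "\<mu>.expectation (\<lambda>p. f p - m) = ?b - m" using int by (simp add: \<mu>.prob_space)
      then show ?thesis
        using \<mu>.powr_abs_expectation_le[OF q1, of "\<lambda>p. f p - m"] by (simp add: abs_minus_commute)
    qed
    have "(\<integral>\<^sup>+p. abs_powr q (f p - ?b) \<partial>?\<mu>)
        \<le> (\<integral>\<^sup>+p. ennreal (2 powr q) * (abs_powr q (f p - m) + abs_powr q (m - ?b)) \<partial>?\<mu>)"
    proof (rule nn_integral_mono)
      fix p
      have "\<bar>f p - ?b\<bar> powr q \<le> 2 powr q * (\<bar>f p - m\<bar> powr q + \<bar>m - ?b\<bar> powr q)"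
        using abs_add_powr_le[of q "f p - m" "m - ?b"] q by simp
      then show "abs_powr q (f p - ?b) \<le> ennreal (2 powr q) * (abs_powr q (f p - m) + abs_powr q (m - ?b))"
        by (simp flip: ennreal_plus ennreal_mult')
    qed
    also have "\<dots> = ennreal (2 powr q) * (?F + abs_powr q (m - ?b))"
      by (subst nn_integral_cmult, measurable, subst nn_integral_add) (auto simp: \<mu>.emeasure_space_1)
    also have "\<dots> \<le> ennreal (2 powr q) * (?F + ?F)" by (intro mult_left_mono add_left_mono mean) simp
    also have "\<dots> = ennreal (2 powr q * 2) * ?F" by (simp add: ennreal_mult mult.assoc flip: mult_2)
    also have "\<dots> \<le> ennreal (2 powr q * 2) * (ennreal C * (\<integral>\<^sup>+p. ennreal (norm (g p) powr q) \<partial>?\<mu>))"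
      by (intro mult_left_mono fm) simp
    also have "\<dots> = ennreal (2 powr q * (2 * C)) * (\<integral>\<^sup>+p. ennreal (norm (g p) powr q) \<partial>?\<mu>)"
      using C by (simp add: mult.assoc ennreal_mult)
    also have "\<dots> \<le> ennreal c * (\<integral>\<^sup>+p. ennreal (norm (g p) powr q) \<partial>?\<mu>)"
      by (intro mult_right_mono ennreal_leI) (auto simp: c_def)
    finally show ?thesis .
  qed
  with c show ?thesis by blast
qed

end
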